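(* Let $d_0$ be the smallest integer such that all monomials appearing in the cost, dynamics and constraint polynomials have degree at most $2d_0$, and for $d\ge d_0$ let $$p_d^*=\inf_{z}\ \sum_{\beta\in\mathbb{N}^{1+n+1+m}_{2d}}c_\beta z_\beta\quad\text{s.t.}\quad\sum_{\beta\in\mathbb{N}^{1+n+1+m}_{2d}}a_{\alpha,\beta}z_\beta=b_\alpha\ \ \forall\alpha\in\bar{\mathbb{N}}^{1+n}_{2d},\quad M_d(g_i\,z)\succeq0,\ i=0,\dots,n_G.$$ Then $p^*_{d_0}\le p^*_{d_0+1}\le\cdots\le p^*_\infty=p_F^*$.
   Context: $T=[t_0,t_f]$, $0\le t_0<t_f$; $p$ even; $y_0,y_f$ prescribed boundary states; $l\in\mathbb{R}[t,\bar y,\bar u]$, $f\in\mathbb{R}[t,\bar y,\bar u]^n$ of degree $\le p$ in $\bar u\in\mathbb{R}^m$; $Y=\{\bar y: g_i(\bar y)\ge0\}$ compact basic semialgebraic including a ball constraint. $W=\{(\bar w_0,\bar w)\in[0,1]\times\mathbb{R}^m:\bar w_0\ge0,\ \bar w_0^p=1-\sum_i\bar w_i^p\}$, $G=T\times Y\times W=\{g_i\ge0,\ i=0,\dots,n_G\}$ with $g_0=1$, equalities as two inequalities, one $g_i=r-\|(t,\bar y,\bar w_0,\bar w)\|_2^2$. Homogenization: for $h=\sum_{|\alpha|\le p}h_\alpha(t,\bar y)\bar u^\alpha$, $\hat h=\sum_\alpha h_\alpha\bar w_0^{p-|\alpha|}\bar w^\alpha$. $p_F^*=\inf_{\gamma\in\mathcal{M}^+(G)}\int\hat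 l\,d\gamma$ s.t. $\int(\frac{\partial v}{\partial t}\bar w_0^p+\frac{\partial v}{\partial\bar y}\hat f)d\gamma=v(t_f,y_f)-v(t_0,y_0)$ for all $v\in C^1(T\times Y)$. Moments $z_\beta$ indexed by monomials $e_\beta$ in $(t,\bar y,\bar w_0,\bar w)$, $\ell_z(\sum h_\beta e_\beta)=\sum h_\beta z_\beta$, localizing matrix $[M_d(g\,z)]_{\alpha,\beta}=\ell_z(g\,e_{\alpha+\beta})$ for $\alpha,\beta$ of total degree $\le d$; $c_\beta$ coefficients of $\hat l$; for $v_\alpha=t^{\alpha_1}\bar y^{(\alpha_2,\dots,\alpha_{n+1})}$, $\sum_\beta a_{\alpha,\beta}z_\beta=\ell_z(\frac{\partial v_\alpha}{\partial t}\bar w_0^p+\frac{\partial v_\alpha}{\partial\bar y}\hat f)$ and $b_\alpha=v_\alpha(t_f,y_f)-v_\alpha(t_0,y_0)$. $\mathbb{N}^k_{2d}$ is the set of multi-indices of total degree $\le 2d$; $\bar{\mathbb{N}}^{1+n}_{2d}=\{\alpha\in\mathbb{N}^{1+n}:\deg(\frac{\partial v_\alpha}{\partial t}\bar w_0^p+\frac{\partial v_\alpha}{\partial\bar y}\hat f)\le 2d\}$. $p_\infty^*$ is the value of the same problem with all moments, all $\alpha\in\mathbb{N}^{1+n}$, and $M_d(g_i\,z)\succeq0$ for all $d\in\mathbb{N}$. *)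

theory Defs
  imports "HOL-Analysis.Analysis"
begin

type_synonym 'v expo = "'v \<Rightarrow> nat"
type_synonym 'v rpoly = "('v \<Rightarrow> nat) \<Rightarrow> real"

definition is_poly :: "'v rpoly \<Rightarrow> bool" where
  "is_poly P \<longleftrightarrow> finite {\<alpha>. P \<alpha> \<noteq> 0}"

definition mdeg :: "('v::finite) expo \<Rightarrow> nat" where
  "mdeg \<alpha> = (\<Sum>i\<in>UNIV. \<alpha> i)"

definition monom_eval :: "('v::finite) expo \<Rightarrow> real^'v \<Rightarrow> real" where
  "monom_eval \<alpha> x = (\<Prod>i\<in>UNIV. (x $ i) ^ (\<alpha> i))"

definition peval :: "('v::finite) rpoly \<Rightarrow> real^'v \<Rightarrow> real" where
  "peval P x = (\<Sum>\<alpha>\<in>{\<alpha>. P \<alpha> \<noteq> 0}. P \<alpha> * monom_eval \<alpha> x)"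

definition deg_le :: "('v::finite) rpoly \<Rightarrow> nat \<Rightarrow> bool" where
  "deg_le P k \<longleftrightarrow> (\<forall>\<alpha>. P \<alpha> \<noteq> 0 \<longrightarrow> mdeg \<alpha> \<le> k)"

definition pconst :: "real \<Rightarrow> 'v rpoly" where
  "pconst c = (\<lambda>\<alpha>. if \<alpha> = (\<lambda>_. 0) then c else 0)"

definition pmonom :: "real \<Rightarrow> 'v expo \<Rightarrow> 'v rpoly" where
  "pmonom c \<beta> = (\<lambda>\<alpha>. if \<alpha> = \<beta> then c else 0)"

definition padd :: "'v rpoly \<Rightarrow> 'v rpoly \<Rightarrow> 'v rpoly" where
  "padd P Q = (\<lambda>\<gamma>. P \<gamma> + Q \<gamma>)"

definition pmult :: "'v rpoly \<Rightarrow> 'v rpoly \<Rightarrow> 'v rpoly" where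
  "pmult P Q = (\<lambda>\<gamma>. \<Sum>(a,b)\<in>{(a,b). P a \<noteq> 0 \<and> Q b \<noteq> 0 \<and> (\<lambda>i. a i + b i) = \<gamma>}. P a * Q b)"

definition ball_poly :: "real \<Rightarrow> ('v::finite) rpoly" where
  "ball_poly r = (\<lambda>\<alpha>. (if \<alpha> = (\<lambda>_. 0) then r else 0)
      - (\<Sum>j\<in>UNIV. if \<alpha> = (\<lambda>i. if i = j then 2 else 0) then 1 else 0))"

text \<open>Original variables (t, y, u): Inl () = t, Inr (Inl j) = y_j, Inr (Inr j) = u_j.\<close>
type_synonym ('n,'m) ovar = "unit + 'n + 'm"
text \<open>Lifted variables (t, y, w0, w): Inl () = t, Inr (Inl j) = y_j,
  Inr (Inr (Inl ())) = w0, Inr (Inr (Inr j)) = w_j.\<close>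
type_synonym ('n,'m) var = "unit + 'n + unit + 'm"

definition tc :: "real^(('n::finite,'m::finite) var) \<Rightarrow> real" where
  "tc x = x $ Inl ()"
definition yc :: "real^(('n::finite,'m::finite) var) \<Rightarrow> real^'n" where
  "yc x = (\<chi> j. x $ Inr (Inl j))"
definition w0c :: "real^(('n::finite,'m::finite) var) \<Rightarrow> real" where
  "w0c x = x $ Inr (Inr (Inl ()))"
definition wc :: "real^(('n::finite,'m::finite) var) \<Rightarrow> real^'m" where
  "wc x = (\<chi> j. x $ Inr (Inr (Inr j)))"

definition udeg :: "(('n::finite,'m::finite) ovar) expo \<Rightarrow> nat" where
  "udeg \<beta> = (\<Sum>j\<in>UNIV. \<beta> (Inr (Inr j)))"

definition hexp :: "nat \<Rightarrow> (('n::finite,'m::finite) ovar) expo \<Rightarrow> (('n,'m) var) expo" where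
  "hexp p \<beta> = (\<lambda>v. case v of
      Inl _ \<Rightarrow> \<beta> (Inl ())
    | Inr (Inl j) \<Rightarrow> \<beta> (Inr (Inl j))
    | Inr (Inr (Inl _)) \<Rightarrow> p - udeg \<beta>
    | Inr (Inr (Inr j)) \<Rightarrow> \<beta> (Inr (Inr j)))"

definition homog :: "nat \<Rightarrow> (('n::finite,'m::finite) ovar) rpoly \<Rightarrow> (('n,'m) var) rpoly" where
  "homog p h = (\<lambda>\<gamma>. \<Sum>\<beta>\<in>{\<beta>. h \<beta> \<noteq> 0 \<and> hexp p \<beta> = \<gamma>}. h \<beta>)"

definition semialg :: "nat \<Rightarrow> (nat \<Rightarrow> ('v::finite) rpoly) \<Rightarrow> (real^'v) set" where
  "semialg k g = {x. \<forall>i<k. peval (g i) x \<ge> 0}"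

definition Gset :: "real \<Rightarrow> real \<Rightarrow> (real^'n) set \<Rightarrow> nat \<Rightarrow> (real^(('n::finite,'m::finite) var)) set" where
  "Gset t0 tf Y p = {x. t0 \<le> tc x \<and> tc x \<le> tf \<and> yc x \<in> Y \<and>
      0 \<le> w0c x \<and> w0c x \<le> 1 \<and> w0c x ^ p = 1 - (\<Sum>j\<in>UNIV. (wc x $ j) ^ p)}"

definition pos_measures :: "('a::topological_space) set \<Rightarrow> 'a measure set" where
  "pos_measures G = {\<gamma>. sets \<gamma> = sets borel \<and> finite_measure \<gamma> \<and> emeasure \<gamma> (UNIV - G) = 0}"

definition is_C1 :: "('a::real_normed_vector \<Rightarrow> real) \<Rightarrow> bool" where
  "is_C1 v \<longleftrightarrow> (\<exists>D. (\<forall>z. (v has_derivative blinfun_apply (D z)) (at z)) \<and> continuous_on UNIV D)"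

definition pF :: "real \<Rightarrow> real \<Rightarrow> real^'n \<Rightarrow> real^'n \<Rightarrow> nat \<Rightarrow> (('n::finite,'m::finite) ovar) rpoly
    \<Rightarrow> ('n \<Rightarrow> (('n,'m) ovar) rpoly) \<Rightarrow> (real^'n) set \<Rightarrow> ereal" where
  "pF t0 tf y0 yf p l f Y = Inf {ereal (\<integral>x. peval (homog p l) x \<partial>\<gamma>) | \<gamma>.
      \<gamma> \<in> pos_measures (Gset t0 tf Y p :: (real^(('n,'m) var)) set) \<and>
      (\<forall>v :: real \<times> (real^'n) \<Rightarrow> real. is_C1 v \<longrightarrow>
         (\<integral>x. frechet_derivative v (at (tc x, yc x))
                 (w0c x ^ p, \<chi> j. peval (homog p (f j)) x) \<partial>\<gamma>)
           = v (tf, yf) - v (t0, y0))}"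

definition lz :: "('v expo \<Rightarrow> real) \<Rightarrow> 'v rpoly \<Rightarrow> real" where
  "lz z P = (\<Sum>\<beta>\<in>{\<beta>. P \<beta> \<noteq> 0}. P \<beta> * z \<beta>)"

definition locmat :: "'v rpoly \<Rightarrow> ('v expo \<Rightarrow> real) \<Rightarrow> 'v expo \<Rightarrow> 'v expo \<Rightarrow> real" where
  "locmat g z \<alpha> \<beta> = lz z (pmult g (pmonom 1 (\<lambda>i. \<alpha> i + \<beta> i)))"

definition psd_on :: "'i set \<Rightarrow> ('i \<Rightarrow> 'i \<Rightarrow> real) \<Rightarrow> bool" where
  "psd_on I M \<longleftrightarrow> (\<forall>c. (\<Sum>\<alpha>\<in>I. \<Sum>\<beta>\<in>I. c \<alpha> * M \<alpha> \<beta> * c \<beta>) \<ge> 0)"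

definition loc_psd :: "nat \<Rightarrow> ('v::finite) rpoly \<Rightarrow> ('v expo \<Rightarrow> real) \<Rightarrow> bool" where
  "loc_psd d g z \<longleftrightarrow> psd_on {\<alpha>. mdeg \<alpha> \<le> d} (locmat g z)"

definition tyemb :: "(unit + 'n) expo \<Rightarrow> (('n::finite,'m::finite) var) expo" where
  "tyemb \<alpha> = (\<lambda>v. case v of Inl _ \<Rightarrow> \<alpha> (Inl ()) | Inr (Inl j) \<Rightarrow> \<alpha> (Inr j) | _ \<Rightarrow> 0)"

definition w0exp :: "nat \<Rightarrow> (('n::finite,'m::finite) var) expo" where
  "w0exp p = (\<lambda>v. if v = Inr (Inr (Inl ())) then p else 0)"

text \<open>For v_alpha = t^alpha_1 y^alpha': the polynomial
  dv_alpha/dt * w0^p + dv_alpha/dy * hat f.\<close>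
definition dyn_poly :: "nat \<Rightarrow> ('n \<Rightarrow> (('n::finite,'m::finite) ovar) rpoly) \<Rightarrow> (unit + 'n) expo
    \<Rightarrow> (('n,'m) var) rpoly" where
  "dyn_poly p f \<alpha> = padd
     (pmonom (real (\<alpha> (Inl ()))) (\<lambda>v. tyemb (\<alpha>(Inl () := \<alpha> (Inl ()) - 1)) v + w0exp p v))
     (\<lambda>\<gamma>. \<Sum>j\<in>UNIV. pmult (pmonom (real (\<alpha> (Inr j))) (tyemb (\<alpha>(Inr j := \<alpha> (Inr j) - 1))))
                            (homog p (f j)) \<gamma>)"

definition vmon :: "(unit + 'n::finite) expo \<Rightarrow> real \<Rightarrow> real^'n \<Rightarrow> real" where
  "vmon \<alpha> t y = t ^ (\<alpha> (Inl ())) * (\<Prod>j\<in>UNIV. (y $ j) ^ (\<alpha> (Inr j)))"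

definition bval :: "real \<Rightarrow> real \<Rightarrow> real^'n \<Rightarrow> real^'n \<Rightarrow> (unit + 'n::finite) expo \<Rightarrow> real" where
  "bval t0 tf y0 yf \<alpha> = vmon \<alpha> tf yf - vmon \<alpha> t0 y0"

definition pd :: "nat \<Rightarrow> real \<Rightarrow> real \<Rightarrow> real^'n \<Rightarrow> real^'n \<Rightarrow> nat \<Rightarrow> (('n::finite,'m::finite) ovar) rpoly
    \<Rightarrow> ('n \<Rightarrow> (('n,'m) ovar) rpoly) \<Rightarrow> nat \<Rightarrow> (nat \<Rightarrow> (('n,'m) var) rpoly) \<Rightarrow> ereal" where
  "pd d t0 tf y0 yf p l f nG g = Inf {ereal (\<Sum>\<beta>\<in>{\<beta>. mdeg \<beta> \<le> 2*d}. homog p l \<beta> * z \<beta>) | z.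
      (\<forall>\<alpha>. deg_le (dyn_poly p f \<alpha>) (2*d) \<longrightarrow> lz z (dyn_poly p f \<alpha>) = bval t0 tf y0 yf \<alpha>) \<and>
      (\<forall>i\<le>nG. loc_psd d (g i) z)}"

definition pinf :: "real \<Rightarrow> real \<Rightarrow> real^'n \<Rightarrow> real^'n \<Rightarrow> nat \<Rightarrow> (('n::finite,'m::finite) ovar) rpoly
    \<Rightarrow> ('n \<Rightarrow> (('n,'m) ovar) rpoly) \<Rightarrow> nat \<Rightarrow> (nat \<Rightarrow> (('n,'m) var) rpoly) \<Rightarrow> ereal" where
  "pinf t0 tf y0 yf p l f nG g = Inf {ereal (lz z (homog p l)) | z.
      (\<forall>\<alpha>. lz z (dyn_poly p f \<alpha>) = bval t0 tf y0 yf \<alpha>) \<and>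
      (\<forall>i\<le>nG. \<forall>d. loc_psd d (g i) z)}"

definition dzero :: "nat \<Rightarrow> (('n::finite,'m::finite) ovar) rpoly
    \<Rightarrow> ('n \<Rightarrow> (('n,'m) ovar) rpoly) \<Rightarrow> nat \<Rightarrow> (nat \<Rightarrow> (('n,'m) var) rpoly) \<Rightarrow> nat" where
  "dzero p l f nG g = (LEAST d. deg_le (homog p l) (2*d) \<and> (\<forall>j. deg_le (homog p (f j)) (2*d))
      \<and> (\<forall>i\<le>nG. deg_le (g i) (2*d)))"

end

theory Submission
  imports Defs "HOL-Probability.Helly_Selection" "HOL-Library.Function_Algebras" "HOL-Library.Poly_Mapping"
begin

text \<open>
  The relaxations are ordered because a moment sequence that is feasible at a higher order is feasible
  at a lower one. A feasible measure gives a feasible moment sequence by integrating monomials, so the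
  content is the converse: a sequence \<open>z\<close> whose localizing matrices are all positive semidefinite has
  a representing measure on \<open>G\<close> (Putinar), and the dynamics constraint for monomials \<open>v\<^sub>\<alpha>\<close> implies it for
  all \<open>C\<^sup>1\<close> test functions.

  Let \<open>L\<close> be the functional of \<open>z\<close>. The ball constraint bounds the moments geometrically, and
  iterated Cauchy-Schwarz then shows that \<open>L (w q\<^sup>2) \<ge> 0\<close> for all \<open>q\<close> is inherited from \<open>w\<close> by
  \<open>w (R + x\<^sub>i)\<close> and \<open>w (R - x\<^sub>i)\<close>. Hence \<open>L\<close> is nonnegative on all products of Bernstein polynomials of the
  cube \<open>[-R, R]\<^sup>N\<close>. Taking these values as the weights of atoms on a grid gives measures whose moments
  converge to those of \<open>L\<close>. Lifting the atoms along a space-filling curve to the real line, Helly's theorem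
  yields a weak limit, which represents \<open>L\<close>; testing \<open>L (g\<^sub>i q\<^sup>2) \<ge> 0\<close> with \<open>q\<close> close to the negative
  part of \<open>g\<^sub>i\<close> shows that it is carried by \<open>G\<close>. Finally, Bernstein operators applied to one coordinate
  after the other approximate a \<open>C\<^sup>1\<close> function together with its derivative by polynomials.
\<close>

subsection \<open>Schoenberg's space-filling curve\<close>

text \<open>The obstacle in the converse direction is that the ball constraint controls
  multiplication by a variable only for the trivial weight: it gives
  \<open>L (x_i^2 q^2) <= R^2 L (q^2)\<close>, whereas products of Bernstein polynomials call for
  the same bound with a weight \<open>w\<close>, and nothing is assumed about products of
  constraints. The way out is that the growth rate of the moments belongs to \<open>L\<close> alone,
  not to a weight. Once known to be \<open>R\<close>, it forces
  \<open>L (w x_i^2 q^2) <= R^2 L (w q^2)\<close> for every \<open>w\<close> with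
  \<open>L (w q^2) >= 0\<close>, and \<open>2R (R + x) = (R + x)^2 + (R^2 - x^2)\<close> (likewise
  for \<open>R - x\<close>) makes this property pass from \<open>w\<close> to
  \<open>w (R + x_i)\<close> and \<open>w (R - x_i)\<close>. No sum-of-squares certificate appears.
  The measure is built from the trivial and the ball constraint only; the other constraints merely
  locate its support.

  The space-filling curve reduces weak compactness on the cube to the line: every atom of the cube
  is the image of an atom in \<open>[0,1]\<close>. For the dynamics, uniform approximation of values
  would not suffice, as the integrand contains the derivative of the test function; Bernstein
  averages also control derivatives.\<close>

lemma binary_expansion_exists:
  fixes x :: real
  assumes "0 \<le> x" "x \<le> 1"
  shows "\<exists>b :: nat \<Rightarrow> bool. (\<lambda>n. of_bool (b n) / 2 ^ Suc n) sums x"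
proof -
  \<comment> \<open>\<open>r n\<close> is the remainder after \<open>n\<close> digits, scaled back
    to \<open>[0,1]\<close>. The endpoint 1 is a fixed point of the doubling step and receives the
    digits 1, 1, 1, ...\<close>
  define r where "r = rec_nat x (\<lambda>_ y. if y \<ge> 1/2 then 2 * y - 1 else 2 * y)"
  have r0: "r 0 = x" and rS: "\<And>n. r (Suc n) = (if r n \<ge> 1/2 then 2 * r n - 1 else 2 * r n)"
    by (auto simp: r_def)
  have r01: "0 \<le> r n \<and> r n \<le> 1" for n
    by (induction n) (use assms in \<open>auto simp: r0 rS\<close>)
  have part: "(\<Sum>k<n. of_bool (r k \<ge> 1/2) / 2 ^ Suc k) = x - r n / 2 ^ n" for n
    by (induction n) (auto simp: r0 rS field_simps)
  have "(\<lambda>n. (1/2::real) ^ n) \<longlonglongrightarrow> 0"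
    by (simp add: LIMSEQ_power_zero)
  then have "(\<lambda>n. r n / 2 ^ n) \<longlonglongrightarrow> 0"
    by (rule Lim_null_comparison[rotated])
      (auto intro!: always_eventually simp: power_divide divide_right_mono r01)
  then have "(\<lambda>n. x - r n / 2 ^ n) \<longlonglongrightarrow> x - 0"
    by (intro tendsto_intros)
  then show ?thesis
    unfolding sums_def part[symmetric] by auto
qed

text \<open>A clipped cosine takes the place of Schoenberg's piecewise linear wave: it has period 2,
  and the clipping levels are reached at 1/3 and 2/3, where \<open>cos (pi * t)\<close> is 1/2 and
  -1/2.\<close>

definition schoenberg_wave :: "real \<Rightarrow> real" where
  "schoenberg_wave t = max 0 (min 1 (1/2 - cos (pi * t)))"

lemma schoenberg_wave_bounds: "0 \<le> schoenberg_wave t" "schoenberg_wave t \<le> 1"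
  by (auto simp: schoenberg_wave_def)

lemma schoenberg_wave_periodic: "schoenberg_wave (2 * real k + t) = schoenberg_wave t"
proof -
  have "cos (pi * (2 * real k + t)) = cos (pi * t + (2 * pi) * real k)"
    by (simp add: algebra_simps)
  also have "\<dots> = cos (pi * t)"
    by (simp only: cos_add cos_int_2pin[of "int k", simplified] sin_int_2pin[of "int k", simplified] mult_1_right mult_zero_right diff_zero)
  finally show ?thesis
    unfolding schoenberg_wave_def by simp
qed

lemma schoenberg_wave_eq_0:
  assumes "0 \<le> t" "t \<le> 1/3"
  shows "schoenberg_wave t = 0"
proof -
  have "cos (pi / 3) \<le> cos (pi * t)"
    using assms by (intro cos_monotone_0_pi_le) auto
  then show ?thesis
    by (simp add: schoenberg_wave_def cos_60)
qed

lemma schoenberg_wave_eq_1: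
  assumes "2/3 \<le> t" "t \<le> 1"
  shows "schoenberg_wave t = 1"
proof -
  have "cos (pi * t) \<le> cos (2 * pi / 3)"
    using assms by (intro cos_monotone_0_pi_le) auto
  also have "\<dots> = - 1/2"
    by (simp add: cos_120)
  finally show ?thesis
    by (simp add: schoenberg_wave_def)
qed

text \<open>Multiplication by \<open>3 ^ k\<close> shifts the ternary expansion. All digits are 0 or
  2, so the integer part is even and disappears by periodicity; the remaining fraction lies in
  \<open>[0,1/3]\<close> or \<open>[2/3,1]\<close> according to the next digit.\<close>

lemma schoenberg_wave_ternary_digit:
  fixes a :: "nat \<Rightarrow> bool"
  shows "schoenberg_wave (3 ^ k * suminf (\<lambda>n. 2 * of_bool (a n) / 3 ^ Suc n)) = of_bool (a k)"
proof -
  \<comment> \<open>The series of the expansion shifted by \<open>k\<close> places; its sum is the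
    fractional part after multiplication by \<open>3 ^ k\<close>.\<close>
  define g where "g k n = 2 * (of_bool (a (n + k)) :: real) / 3 ^ Suc n" for k n
  have geo: "(\<lambda>n. 2 * (1/3::real) ^ Suc n) sums 1"
    using sums_mult[OF geometric_sums[of "1/3::real"], of "2/3"] by simp
  have le: "0 \<le> g k n" "g k n \<le> 2 * (1/3) ^ Suc n" for k n
    by (auto simp: g_def power_divide field_simps)
  have sg: "summable (g k)" for k
    by (rule summable_comparison_test[OF _ sums_summable[OF geo]]) (use le in auto)
  have tail: "suminf (g k) = 2 * of_bool (a k) / 3 + suminf (g (Suc k)) / 3" for k
  proof -
    have "suminf (g k) = g k 0 + suminf (\<lambda>n. g k (Suc n))"
      using suminf_split_head[OF sg] by simp
    also have "(\<lambda>n. g k (Suc n)) = (\<lambda>n. g (Suc k) n / 3)"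
      by (auto simp: g_def fun_eq_iff)
    also have "suminf \<dots> = suminf (g (Suc k)) / 3"
      by (rule suminf_divide[OF sg])
    also have "g k 0 = 2 * of_bool (a k) / 3"
      by (simp add: g_def)
    finally show ?thesis .
  qed
  have bnd: "0 \<le> suminf (g k)" "suminf (g k) \<le> 1" for k
  proof -
    show "0 \<le> suminf (g k)" by (rule suminf_nonneg[OF sg]) (rule le)
    have "suminf (g k) \<le> suminf (\<lambda>n. 2 * (1/3::real) ^ Suc n)"
      by (rule suminf_le[OF le(2) sg sums_summable[OF geo]])
    then show "suminf (g k) \<le> 1" using sums_unique[OF geo] by simp
  qed
  have int: "\<exists>m::nat. 3 ^ k * suminf (g 0) = 2 * real m + suminf (g k)" for k
  proof (induction k)
    case 0
    show ?case by (rule exI[of _ 0]) simp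
  next
    case (Suc k)
    then obtain m where m: "3 ^ k * suminf (g 0) = 2 * real m + suminf (g k)" by blast
    have "3 ^ Suc k * suminf (g 0) = 3 * (2 * real m + suminf (g k))"
      by (simp add: m[symmetric])
    also have "\<dots> = 2 * real (3 * m + of_bool (a k)) + suminf (g (Suc k))"
      by (subst tail) simp
    finally show ?case by blast
  qed
  obtain m where "3 ^ k * suminf (g 0) = 2 * real m + suminf (g k)"
    using int by blast
  moreover have "schoenberg_wave (suminf (g k)) = of_bool (a k)"
    using tail[of k] bnd[of "Suc k"]
    by (cases "a k") (auto intro!: schoenberg_wave_eq_0 schoenberg_wave_eq_1)
  moreover have "(\<lambda>n. 2 * of_bool (a n) / 3 ^ Suc n) = g 0"
    by (simp add: g_def fun_eq_iff)
  ultimately show ?thesis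
    by (simp only: schoenberg_wave_periodic)
qed

lemma continuous_on_schoenberg_wave: "continuous_on UNIV schoenberg_wave"
  unfolding schoenberg_wave_def by (intro continuous_intros)

text \<open>With \<open>N\<close> coordinates numbered by \<open>e\<close>, the ternary digit of
  \<open>t\<close> at place \<open>N * n + e i\<close> encodes the binary digit at place
  \<open>n\<close> of coordinate \<open>i\<close>. The wave reads off each digit continuously, and
  the factor \<open>1 / 2 ^ Suc n\<close> makes the series converge uniformly.\<close>

lemma space_filling_curve:
  "\<exists>c :: real \<Rightarrow> real^'v::finite. continuous_on UNIV c \<and> (\<forall>t i. c t $ i \<in> {0..1}) \<and>
     (\<forall>s. (\<forall>i. s $ i \<in> {0..1}) \<longrightarrow> (\<exists>t\<in>{0..1}. c t = s))"
proof -
  define N where "N = CARD('v)"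
  obtain e :: "'v \<Rightarrow> nat" where e: "bij_betw e UNIV {0..<N}"
    unfolding N_def using ex_bij_betw_finite_nat[of "UNIV :: 'v set"] by auto
  define T where "T i n t = schoenberg_wave (3 ^ (N * n + e i) * t) / 2 ^ Suc n" for i n t
  define c :: "real \<Rightarrow> real^'v" where "c t = (\<chi> i. suminf (\<lambda>n. T i n t))" for t
  have geo: "(\<lambda>n. (1/2::real) ^ Suc n) sums 1"
    using power_half_series by simp
  have T: "0 \<le> T i n t" "T i n t \<le> (1/2) ^ Suc n" for i n t
    using schoenberg_wave_bounds[of "3 ^ (N * n + e i) * t"]
    by (auto simp: T_def power_divide divide_right_mono)
  have sT: "summable (\<lambda>n. T i n t)" for i t
    by (rule summable_comparison_test[OF _ sums_summable[OF geo]]) (use T in auto)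
  have cont: "continuous_on UNIV (\<lambda>t. suminf (\<lambda>n. T i n t))" for i
  proof (rule uniform_limit_theorem)
    show "uniform_limit UNIV (\<lambda>n t. \<Sum>k<n. T i k t) (\<lambda>t. suminf (\<lambda>n. T i n t)) sequentially"
      by (rule Weierstrass_m_test[OF _ sums_summable[OF geo]]) (use T in auto)
    show "\<forall>\<^sub>F n in sequentially. continuous_on UNIV (\<lambda>t. \<Sum>k<n. T i k t)"
      unfolding T_def
      by (intro always_eventually allI continuous_intros
          continuous_on_compose2[OF continuous_on_schoenberg_wave]) auto
  qed auto
  have "continuous_on UNIV c"
    unfolding c_def by (intro continuous_on_vec_lambda cont)
  moreover have "c t $ i \<in> {0..1}" for t i
  proof -
    have "suminf (\<lambda>n. T i n t) \<le> suminf (\<lambda>n. (1/2::real) ^ Suc n)"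
      by (rule suminf_le[OF T(2) sT sums_summable[OF geo]])
    then show ?thesis
      using sums_unique[OF geo] suminf_nonneg[OF sT T(1)] by (simp add: c_def)
  qed
  moreover have "\<exists>t\<in>{0..1}. c t = s" if s: "\<And>i. s $ i \<in> {0..1}" for s
  proof -
    have "\<exists>b :: nat \<Rightarrow> bool. (\<lambda>n. of_bool (b n) / 2 ^ Suc n) sums (s $ i)" for i
      using s[of i] by (intro binary_expansion_exists) auto
    then obtain b :: "'v \<Rightarrow> nat \<Rightarrow> bool"
      where b: "\<And>i. (\<lambda>n. of_bool (b i n) / 2 ^ Suc n) sums (s $ i)"
      by metis
    \<comment> \<open>The binary digits of all coordinates are interleaved into one
      sequence.\<close>
    define a where "a k = b (inv e (k mod N)) (k div N)" for k
    have inj: "inj e" and eN: "e i < N" for i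
      using e by (auto simp: bij_betw_def)
    have a: "a (N * n + e i) = b i n" for n i
      using eN[of i] inj by (simp add: a_def)
    define t :: real where "t = suminf (\<lambda>n. 2 * of_bool (a n) / 3 ^ Suc n)"
    have geo3: "(\<lambda>n. 2 * (1/3::real) ^ Suc n) sums 1"
      using sums_mult[OF geometric_sums[of "1/3::real"], of "2/3"] by simp
    have le3: "0 \<le> 2 * of_bool (a n) / (3::real) ^ Suc n"
      "2 * of_bool (a n) / (3::real) ^ Suc n \<le> 2 * (1/3) ^ Suc n" for n
      by (auto simp: power_divide field_simps)
    have s3: "summable (\<lambda>n. 2 * of_bool (a n) / (3::real) ^ Suc n)"
      by (rule summable_comparison_test[OF _ sums_summable[OF geo3]]) (use le3 in auto)
    have "0 \<le> t" unfolding t_def by (rule suminf_nonneg[OF s3 le3(1)])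
    moreover have "t \<le> 1"
      unfolding t_def using suminf_le[OF le3(2) s3 sums_summable[OF geo3]] sums_unique[OF geo3]
      by simp
    moreover have "c t = s"
    proof -
      have "T i n t = of_bool (b i n) / 2 ^ Suc n" for i n
        unfolding T_def t_def schoenberg_wave_ternary_digit a ..
      then show ?thesis
        using sums_unique[OF b] by (simp add: c_def vec_eq_iff)
    qed
    ultimately show ?thesis by (intro bexI[of _ t]) auto
  qed
  ultimately show ?thesis by blast
qed

subsection \<open>Measures from Bernstein-positive functionals\<close>

text \<open>Each atom is moved to a preimage under the curve \<open>c\<close>. The measures on the
  line so obtained all live on \<open>[0,1]\<close>, hence are tight, and a weak limit is pushed
  forward by \<open>c\<close> again. Since \<open>h o c\<close> is continuous and bounded for every
  continuous \<open>h\<close>, weak convergence on the line gives convergence of the sums.\<close>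

lemma discrete_measures_on_cube_compact:
  fixes J :: "nat \<Rightarrow> 'j set" and w :: "nat \<Rightarrow> 'j \<Rightarrow> real" and s :: "nat \<Rightarrow> 'j \<Rightarrow> real^'v::finite"
  assumes fin: "\<And>k. finite (J k)" and w: "\<And>k j. j \<in> J k \<Longrightarrow> 0 \<le> w k j"
    and w1: "\<And>k. (\<Sum>j\<in>J k. w k j) = 1" and s: "\<And>k j i. j \<in> J k \<Longrightarrow> s k j $ i \<in> {0..1}"
  shows "\<exists>r \<mu>. strict_mono (r :: nat \<Rightarrow> nat) \<and> prob_space \<mu> \<and> sets \<mu> = sets borel \<and>
     (AE x in \<mu>. \<forall>i. x $ i \<in> {0..1}) \<and>
     (\<forall>h :: real^'v \<Rightarrow> real. continuous_on UNIV h \<longrightarrow>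
        (\<lambda>k. \<Sum>j\<in>J (r k). w (r k) j * h (s (r k) j)) \<longlonglongrightarrow> (\<integral>x. h x \<partial>\<mu>))"
proof -
  obtain c :: "real \<Rightarrow> real^'v" where c: "continuous_on UNIV c" "\<And>t i. c t $ i \<in> {0..1}"
    and onto: "\<And>s. (\<And>i. s $ i \<in> {0..1}) \<Longrightarrow> \<exists>t\<in>{0..1}. c t = s"
    using space_filling_curve by blast
  have ex: "\<exists>t. t \<in> {0..1} \<and> c t = s k j" if "j \<in> J k" for k j
    using onto[OF s[OF that]] by blast
  define \<tau> where "\<tau> k j = (SOME t. t \<in> {0..1} \<and> c t = s k j)" for k j
  have \<tau>: "\<tau> k j \<in> {0..1} \<and> c (\<tau> k j) = s k j" if "j \<in> J k" for k j
    unfolding \<tau>_def by (rule someI_ex[OF ex[OF that]])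
  \<comment> \<open>On a point measure every function is measurable, so the arbitrary choice of
    preimages \<open>\<tau>\<close> causes no trouble.\<close>
  define M0 where "M0 k = point_measure (J k) (\<lambda>j. ennreal (w k j))" for k
  define M where "M k = distr (M0 k) borel (\<tau> k)" for k
  have M0: "prob_space (M0 k)" for k
    unfolding M0_def by (rule prob_space_point_measure) (use fin w w1 in auto)
  have \<tau>_meas: "\<tau> k \<in> borel_measurable (M0 k)" for k
    by (simp add: M0_def)
  have space_M0: "space (M0 k) = J k" for k
    by (simp add: M0_def space_point_measure)
  have rd: "real_distribution (M k)" for k
    unfolding M_def real_distribution_def real_distribution_axioms_def
    using prob_space.prob_space_distr[OF M0 \<tau>_meas] by simp
  have tight: "tight M"
    unfolding tight_def
  proof (intro conjI allI impI rd)
    fix \<epsilon> :: real assume "\<epsilon> > 0"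
    \<comment> \<open>Tightness is phrased with half-open intervals; this one contains
      \<open>[0,1]\<close>.\<close>
    have "1 - \<epsilon> < measure (M k) {-1<..2}" for k
    proof -
      interpret prob_space "M0 k" by (rule M0)
      have "measure (M k) {-1<..2} = measure (M0 k) (\<tau> k -` {-1<..2} \<inter> space (M0 k))"
        unfolding M_def by (rule measure_distr) (use \<tau>_meas in auto)
      also have "\<tau> k -` {-1<..2} \<inter> space (M0 k) = space (M0 k)"
        using \<tau> by (fastforce simp: space_M0)
      finally show "1 - \<epsilon> < measure (M k) {-1<..2}"
        using \<open>\<epsilon> > 0\<close> by (simp add: prob_space)
    qed
    then show "\<exists>a b. a < b \<and> (\<forall>n. 1 - \<epsilon> < measure (M n) {a<..b})"
      by (intro exI[of _ "-1"] exI[of _ 2]) auto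
  qed
  obtain r N where r: "strict_mono r" and N: "real_distribution N" "weak_conv_m (M \<circ> id \<circ> r) N"
    using tight_imp_convergent_subsubsequence[OF tight strict_mono_id] by (auto simp: id_def)
  interpret N: real_distribution N by (rule N)
  have c_meas: "c \<in> borel_measurable borel"
    using c(1) by (rule borel_measurable_continuous_onI)
  have c_measN: "c \<in> borel_measurable N"
    using c_meas by (simp add: measurable_def)
  define \<mu> where "\<mu> = distr N borel c"
  have "prob_space \<mu>"
    unfolding \<mu>_def using N.prob_space_distr[OF c_measN] .
  moreover have "AE x in \<mu>. \<forall>i. x $ i \<in> {0..1}"
    unfolding \<mu>_def by (subst AE_distr_iff[OF c_measN]) (use c(2) in \<open>auto simp del: atLeastAtMost_iff\<close>)
  moreover have "(\<lambda>k. \<Sum>j\<in>J (r k). w (r k) j * h (s (r k) j)) \<longlonglongrightarrow> (\<integral>x. h x \<partial>\<mu>)"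
    if h: "continuous_on UNIV h" for h :: "real^'v \<Rightarrow> real"
  proof -
    have "compact (h ` cbox 0 1)"
      by (intro compact_continuous_image continuous_on_subset[OF h]) auto
    then obtain B where B: "\<And>x. x \<in> cbox 0 1 \<Longrightarrow> \<bar>h x\<bar> \<le> B"
      using compact_imp_bounded bounded_iff by (metis imageI real_norm_def)
    have hc: "continuous_on UNIV (\<lambda>t. h (c t))"
      by (rule continuous_on_compose2[OF h c(1)]) auto
    have "(\<lambda>k. integral\<^sup>L ((M \<circ> id \<circ> r) k) (\<lambda>t. h (c t))) \<longlonglongrightarrow> integral\<^sup>L N (\<lambda>t. h (c t))"
    proof (rule weak_conv_imp_integral_bdd_continuous_conv)
      show "weak_conv_m (M \<circ> id \<circ> r) N" by (rule N)
      show "isCont (\<lambda>t. h (c t)) x" for x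
        using hc by (simp add: continuous_on_eq_continuous_at)
      show "norm (h (c x)) \<le> B" for x
        using c(2) B by (auto simp: mem_box_cart)
    qed (use rd N in auto)
    moreover have "integral\<^sup>L ((M \<circ> id \<circ> r) k) (\<lambda>t. h (c t)) = (\<Sum>j\<in>J (r k). w (r k) j * h (s (r k) j))" for k
    proof -
      have "integral\<^sup>L (M (r k)) (\<lambda>t. h (c t)) = integral\<^sup>L (M0 (r k)) (\<lambda>j. h (c (\<tau> (r k) j)))"
        unfolding M_def
        by (rule integral_distr[OF \<tau>_meas]) (use hc borel_measurable_continuous_onI in auto)
      also have "\<dots> = (\<Sum>j\<in>J (r k). w (r k) j *\<^sub>R h (c (\<tau> (r k) j)))"
        unfolding M0_def by (rule lebesgue_integral_point_measure_finite) (use fin w in auto)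
      finally show ?thesis using \<tau> by (auto intro!: sum.cong)
    qed
    moreover have "integral\<^sup>L N (\<lambda>t. h (c t)) = (\<integral>x. h x \<partial>\<mu>)"
      unfolding \<mu>_def using borel_measurable_continuous_onI[OF h] by (intro integral_distr[symmetric] c_measN) auto
    ultimately show ?thesis by simp
  qed
  ultimately show ?thesis
    using r by (intro exI[of _ r] exI[of _ \<mu>]) (auto simp: \<mu>_def)
qed

text \<open>The ratio is the product of \<open>(j - s) / (k - s)\<close> over \<open>s < m\<close>;
  it is compared factor by factor with \<open>j / k\<close>, all factors having absolute value at
  most 1.\<close>

lemma binomial_ratio_approx:
  fixes j k m :: nat
  assumes "j \<le> k" "2 * m < k"
  shows "\<bar>real (j choose m) / real (k choose m) - (real j / real k) ^ m\<bar> \<le> real m * (real m / (real k - real m))"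
proof -
  have pos: "real k - real s > 0" if "s < m" for s using that assms by auto
  have "real (j choose m) / real (k choose m) =
      (\<Prod>s<m. real j - real s) / (\<Prod>s<m. real k - real s)"
    by (simp add: binomial_gbinomial gbinomial_prod_rev lessThan_atLeast0)
  also have "\<dots> = (\<Prod>s<m. (real j - real s) / (real k - real s))"
    by (rule prod_dividef[symmetric])
  finally have eq: "real (j choose m) / real (k choose m) = (\<Prod>s<m. (real j - real s) / (real k - real s))" .
  have "norm ((\<Prod>s<m. (real j - real s) / (real k - real s)) - (\<Prod>s<m. real j / real k))
     \<le> (\<Sum>s<m. norm ((real j - real s) / (real k - real s) - real j / real k))"
  proof (rule norm_prod_diff)
    fix s assume s: "s \<in> {..<m}"
    \<comment> \<open>If \<open>j < s\<close>, then \<open>s - j \<le> s \<le> k - s\<close>,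
      because \<open>2 * m < k\<close>.\<close>
    then have "\<bar>real j - real s\<bar> \<le> real k - real s"
      using assms by auto
    then show "norm ((real j - real s) / (real k - real s)) \<le> 1"
      using pos[of s] s by (simp add: abs_divide)
    show "norm (real j / real k) \<le> 1" using assms by (simp add: divide_le_eq)
  qed
  also have "\<dots> \<le> (\<Sum>s<m. real m / (real k - real m))"
  proof (rule sum_mono)
    fix s assume "s \<in> {..<m}"
    then have s: "s < m" by simp
    have "(real j - real s) / (real k - real s) - real j / real k
        = - (real s * (real k - real j) / (real k * (real k - real s)))"
      using pos[OF s] assms by (simp add: field_simps)
    then have "norm ((real j - real s) / (real k - real s) - real j / real k)
        = real s / (real k - real s) * ((real k - real j) / real k)"
      using pos[OF s] assms by (simp add: abs_mult abs_divide)
    also have "\<dots> \<le> real s / (real k - real s) * 1"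
      using pos[OF s] assms by (intro mult_left_mono) (auto simp: divide_le_eq)
    also have "\<dots> \<le> real m / (real k - real m)"
      using pos[OF s] assms s by (auto intro!: frac_le)
    finally show "norm ((real j - real s) / (real k - real s) - real j / real k) \<le> real m / (real k - real m)" .
  qed
  finally show ?thesis by (simp add: eq)
qed

text \<open>The factorial moments of the binomial distribution, as an identity in an arbitrary
  commutative ring. With \<open>j choose m\<close> in place of \<open>j ^ m\<close> the identity is
  exact, so it can be applied under a functional before anything is approximated.\<close>

lemma binomial_moment_Bernstein:
  fixes u :: "'r::comm_ring_1"
  shows "(\<Sum>j\<le>k. of_nat (j choose m) * (of_nat (k choose j) * u ^ j * (1 - u) ^ (k - j)))
       = of_nat (k choose m) * u ^ m"
proof (cases "m \<le> k")
  case False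
  then show ?thesis by (auto simp: binomial_eq_0 intro!: sum.neutral)
next
  case True
  have "(\<Sum>j\<le>k. of_nat (j choose m) * (of_nat (k choose j) * u ^ j * (1 - u) ^ (k - j)))
     = (\<Sum>j\<in>{m..k}. of_nat (j choose m) * (of_nat (k choose j) * u ^ j * (1 - u) ^ (k - j)))"
    by (rule sum.mono_neutral_right) (auto simp: binomial_eq_0)
  also have "\<dots> = (\<Sum>i\<le>k - m. of_nat ((i + m) choose m) * (of_nat (k choose (i + m)) * u ^ (i + m) * (1 - u) ^ (k - (i + m))))"
    by (rule sum.reindex_bij_witness[of _ "\<lambda>i. i + m" "\<lambda>j. j - m"]) (use True in auto)
  also have "\<dots> = (\<Sum>i\<le>k - m. of_nat (k choose m) * u ^ m * (of_nat ((k - m) choose i) * u ^ i * (1 - u) ^ (k - m - i)))"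
  proof (rule sum.cong[OF refl])
    fix i assume "i \<in> {..k - m}"
    then have "(k choose (i + m)) * ((i + m) choose m) = (k choose m) * ((k - m) choose i)"
      using choose_mult[of m "i + m" k] True by simp
    then have "(of_nat (k choose (i + m)) :: 'r) * of_nat ((i + m) choose m) = of_nat (k choose m) * of_nat ((k - m) choose i)"
      by (metis of_nat_mult)
    moreover have "of_nat ((i + m) choose m) * (of_nat (k choose (i + m)) * u ^ (i + m) * (1 - u) ^ (k - (i + m)))
       = (of_nat (k choose (i + m)) * of_nat ((i + m) choose m)) * (u ^ i * u ^ m * (1 - u) ^ (k - m - i))"
      by (simp add: power_add ac_simps)
    ultimately show "of_nat ((i + m) choose m) * (of_nat (k choose (i + m)) * u ^ (i + m) * (1 - u) ^ (k - (i + m)))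
      = of_nat (k choose m) * u ^ m * (of_nat ((k - m) choose i) * u ^ i * (1 - u) ^ (k - m - i))"
      by (simp add: ac_simps)
  qed
  also have "\<dots> = of_nat (k choose m) * u ^ m * (u + (1 - u)) ^ (k - m)"
    by (simp only: sum_distrib_left binomial_ring)
  finally show ?thesis by simp
qed

text \<open>Hausdorff's moment problem in algebraic form. The grid point \<open>j / k\<close>
  receives the weight \<open>L (\<beta> k j)\<close>, where \<open>\<beta> k j\<close> is a product
  of Bernstein polynomials in the ring elements \<open>u i\<close>. Coefficients that are natural
  numbers are all that occurs, so additivity lets them pass through \<open>L\<close>.\<close>

lemma moment_measure_on_cube:
  fixes L :: "'r::comm_ring_1 \<Rightarrow> real" and u :: "'v::finite \<Rightarrow> 'r"
  assumes add: "\<And>p q. L (p + q) = L p + L q"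
    and pos: "\<And>a b. 0 \<le> L (\<Prod>i\<in>UNIV. u i ^ a i * (1 - u i) ^ b i)"
  shows "\<exists>\<mu>. finite_measure \<mu> \<and> sets \<mu> = sets borel \<and> (AE x in \<mu>. \<forall>i. x $ i \<in> {0..1}) \<and>
    (\<forall>\<alpha>. L (\<Prod>i\<in>UNIV. u i ^ \<alpha> i) = (\<integral>x. (\<Prod>i\<in>UNIV. (x $ i) ^ \<alpha> i) \<partial>(\<mu> :: (real^'v) measure)))"
proof -
  have L0: "L 0 = 0" using add[of 0 0] by simp
  have sum: "L (sum h A) = (\<Sum>x\<in>A. L (h x))" for h :: "('v \<Rightarrow> nat) \<Rightarrow> 'r" and A
    by (induction A rule: infinite_finite_induct) (auto simp: L0 add)
  have nat: "L (of_nat n * p) = real n * L p" for n p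
    by (induction n) (auto simp: L0 add algebra_simps)
  define J where "J k = PiE (UNIV :: 'v set) (\<lambda>_. {..k})" for k :: nat
  define \<beta> where "\<beta> k j = (\<Prod>i\<in>UNIV. of_nat (k choose j i) * u i ^ j i * (1 - u i) ^ (k - j i))"
    for k and j :: "'v \<Rightarrow> nat"
  have finJ: "finite (J k)" for k by (auto simp: J_def intro: finite_PiE)
  have \<beta>pos: "0 \<le> L (\<beta> k j)" for k j
  proof -
    have "\<beta> k j = of_nat (\<Prod>i\<in>UNIV. k choose j i) * (\<Prod>i\<in>UNIV. u i ^ j i * (1 - u i) ^ (k - j i))"
      by (simp add: \<beta>_def prod.distrib mult.assoc)
    then have "L (\<beta> k j) = real (\<Prod>i\<in>UNIV. k choose j i) * L (\<Prod>i\<in>UNIV. u i ^ j i * (1 - u i) ^ (k - j i))"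
      by (simp only: nat)
    then show ?thesis
      using pos[of j "\<lambda>i. k - j i"] by (simp add: prod_nonneg)
  qed
  \<comment> \<open>The atoms reproduce the factorial moments of \<open>L\<close> without error; the
    error for the ordinary moments comes solely from \<open>binomial_ratio_approx\<close>.\<close>
  have quad: "(\<Sum>j\<in>J k. (\<Prod>i\<in>UNIV. real (j i choose \<alpha> i)) * L (\<beta> k j))
      = (\<Prod>i\<in>UNIV. real (k choose \<alpha> i)) * L (\<Prod>i\<in>UNIV. u i ^ \<alpha> i)" for k \<alpha>
  proof -
    have "of_nat (\<Prod>i\<in>UNIV. k choose \<alpha> i) * (\<Prod>i\<in>UNIV. u i ^ \<alpha> i)
       = (\<Prod>i\<in>UNIV. of_nat (k choose \<alpha> i) * u i ^ \<alpha> i)"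
      by (simp add: prod.distrib)
    also have "\<dots> = (\<Prod>i\<in>UNIV. \<Sum>m\<le>k. of_nat (m choose \<alpha> i) * (of_nat (k choose m) * u i ^ m * (1 - u i) ^ (k - m)))"
      by (simp only: binomial_moment_Bernstein)
    also have "\<dots> = (\<Sum>j\<in>J k. \<Prod>i\<in>UNIV. of_nat (j i choose \<alpha> i) * (of_nat (k choose j i) * u i ^ j i * (1 - u i) ^ (k - j i)))"
      unfolding J_def by (rule prod_sum_PiE) auto
    also have "\<dots> = (\<Sum>j\<in>J k. of_nat (\<Prod>i\<in>UNIV. j i choose \<alpha> i) * \<beta> k j)"
      by (simp add: prod.distrib \<beta>_def)
    finally have "L (of_nat (\<Prod>i\<in>UNIV. k choose \<alpha> i) * (\<Prod>i\<in>UNIV. u i ^ \<alpha> i))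
       = L (\<Sum>j\<in>J k. of_nat (\<Prod>i\<in>UNIV. j i choose \<alpha> i) * \<beta> k j)"
      by simp
    then show ?thesis unfolding nat sum by simp
  qed
  have tot: "(\<Sum>j\<in>J k. L (\<beta> k j)) = L 1" for k
    using quad[where k = k and \<alpha> = "\<lambda>_. 0"] by simp
  define approx where "approx k \<alpha> = (\<Sum>j\<in>J k. (\<Prod>i\<in>UNIV. (real (j i) / real k) ^ \<alpha> i) * L (\<beta> k j))"
    for k and \<alpha> :: "'v \<Rightarrow> nat"
  have approx: "(\<lambda>k. approx k \<alpha>) \<longlonglongrightarrow> L (\<Prod>i\<in>UNIV. u i ^ \<alpha> i)" for \<alpha>
  proof -
    define D where "D k = (\<Sum>i\<in>UNIV. real (\<alpha> i) * (real (\<alpha> i) / (real k - real (\<alpha> i)))) * L 1" for k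
    have "(\<lambda>k. real (\<alpha> i) * (real (\<alpha> i) / (real k - real (\<alpha> i)))) \<longlonglongrightarrow> real (\<alpha> i) * 0" for i
    proof (intro tendsto_mult tendsto_const tendsto_divide_0[OF tendsto_const] filterlim_at_top_imp_at_infinity)
      have "filterlim (\<lambda>k. - real (\<alpha> i) + real k) at_top sequentially"
        by (rule filterlim_tendsto_add_at_top[OF tendsto_const filterlim_real_sequentially])
      then show "filterlim (\<lambda>k. real k - real (\<alpha> i)) at_top sequentially" by simp
    qed
    then have D0: "D \<longlonglongrightarrow> (\<Sum>i\<in>(UNIV::'v set). 0) * L 1"
      unfolding D_def by (intro tendsto_mult tendsto_sum tendsto_const) simp
    \<comment> \<open>From this index on, \<open>2 * \<alpha> i < k\<close> holds for all
      \<open>i\<close>, as \<open>binomial_ratio_approx\<close> requires.\<close>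
    define m where "m = 2 * (\<Sum>i\<in>UNIV. \<alpha> i) + 1"
    have "norm (approx k \<alpha> - L (\<Prod>i\<in>UNIV. u i ^ \<alpha> i)) \<le> D k" if k: "k \<ge> m" for k
    proof -
      have ai: "2 * \<alpha> i < k" for i
      proof -
        have "\<alpha> i \<le> (\<Sum>i\<in>UNIV. \<alpha> i)" by (rule member_le_sum) auto
        then show ?thesis using k unfolding m_def by linarith
      qed
      have nz: "real (k choose \<alpha> i) \<noteq> 0" for i using ai[of i] by simp
      then have nzp: "(\<Prod>i\<in>UNIV. real (k choose \<alpha> i)) \<noteq> 0" by simp
      have "L (\<Prod>i\<in>UNIV. u i ^ \<alpha> i)
         = (\<Sum>j\<in>J k. (\<Prod>i\<in>UNIV. real (j i choose \<alpha> i)) * L (\<beta> k j)) / (\<Prod>i\<in>UNIV. real (k choose \<alpha> i))"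
        using quad[of \<alpha> k] nzp by (simp add: field_simps)
      also have "\<dots> = (\<Sum>j\<in>J k. (\<Prod>i\<in>UNIV. real (j i choose \<alpha> i) / real (k choose \<alpha> i)) * L (\<beta> k j))"
        by (simp add: sum_divide_distrib prod_dividef)
      finally have "approx k \<alpha> - L (\<Prod>i\<in>UNIV. u i ^ \<alpha> i)
        = (\<Sum>j\<in>J k. ((\<Prod>i\<in>UNIV. (real (j i) / real k) ^ \<alpha> i) - (\<Prod>i\<in>UNIV. real (j i choose \<alpha> i) / real (k choose \<alpha> i))) * L (\<beta> k j))"
        by (simp add: approx_def sum_subtractf[symmetric] algebra_simps)
      also have "norm \<dots> \<le> (\<Sum>j\<in>J k. (\<Sum>i\<in>UNIV. real (\<alpha> i) * (real (\<alpha> i) / (real k - real (\<alpha> i)))) * L (\<beta> k j))"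
      proof (rule sum_norm_le)
        fix j assume "j \<in> J k"
        then have j: "j i \<le> k" for i by (auto simp: J_def)
        have "norm ((\<Prod>i\<in>UNIV. (real (j i) / real k) ^ \<alpha> i) - (\<Prod>i\<in>UNIV. real (j i choose \<alpha> i) / real (k choose \<alpha> i)))
          \<le> (\<Sum>i\<in>UNIV. norm ((real (j i) / real k) ^ \<alpha> i - real (j i choose \<alpha> i) / real (k choose \<alpha> i)))"
        proof (rule norm_prod_diff)
          fix i
          show "norm ((real (j i) / real k) ^ \<alpha> i) \<le> 1"
            using j[of i] by (auto simp: power_abs divide_le_eq intro!: power_le_one)
          show "norm (real (j i choose \<alpha> i) / real (k choose \<alpha> i)) \<le> 1"
            using j[of i] nz[of i] binomial_right_mono[of "j i" k "\<alpha> i"] by (auto simp: divide_le_eq)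
        qed
        also have "\<dots> \<le> (\<Sum>i\<in>UNIV. real (\<alpha> i) * (real (\<alpha> i) / (real k - real (\<alpha> i))))"
        proof (rule sum_mono)
          fix i
          show "norm ((real (j i) / real k) ^ \<alpha> i - real (j i choose \<alpha> i) / real (k choose \<alpha> i))
            \<le> real (\<alpha> i) * (real (\<alpha> i) / (real k - real (\<alpha> i)))"
            using binomial_ratio_approx[OF j[of i] ai[of i]] by (simp only: real_norm_def abs_minus_commute)
        qed
        finally show "norm (((\<Prod>i\<in>UNIV. (real (j i) / real k) ^ \<alpha> i) - (\<Prod>i\<in>UNIV. real (j i choose \<alpha> i) / real (k choose \<alpha> i))) * L (\<beta> k j))
          \<le> (\<Sum>i\<in>UNIV. real (\<alpha> i) * (real (\<alpha> i) / (real k - real (\<alpha> i)))) * L (\<beta> k j)"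
          using \<beta>pos[of k j] by (simp only: real_norm_def abs_mult abs_of_nonneg mult_right_mono)
      qed
      also have "\<dots> = D k"
        by (simp only: D_def tot sum_distrib_left[symmetric])
      finally show ?thesis .
    qed
    then have "\<forall>\<^sub>F k in sequentially. norm (approx k \<alpha> - L (\<Prod>i\<in>UNIV. u i ^ \<alpha> i)) \<le> D k"
      by (rule eventually_sequentiallyI)
    moreover have "D \<longlonglongrightarrow> 0" using D0 by simp
    ultimately have "(\<lambda>k. approx k \<alpha> - L (\<Prod>i\<in>UNIV. u i ^ \<alpha> i)) \<longlonglongrightarrow> 0"
      by (rule Lim_null_comparison)
    then show ?thesis by (rule LIM_zero_cancel)
  qed
  show ?thesis
  \<comment> \<open>The weights have total mass \<open>L 1\<close> and must be normalized to
    probabilities. If this mass is 0, all weights vanish and the null measure does.\<close>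
  proof (cases "L 1 = 0")
    case True
    have "approx k \<alpha> = 0" for k \<alpha>
    proof -
      have "L (\<beta> k j) = 0" if "j \<in> J k" for j
        using tot[of k] True sum_nonneg_eq_0_iff[OF finJ, of k "\<lambda>j. L (\<beta> k j)"] \<beta>pos that by auto
      then show ?thesis by (simp add: approx_def)
    qed
    then have "L (\<Prod>i\<in>UNIV. u i ^ \<alpha> i) = 0" for \<alpha>
      using approx[of \<alpha>] by (simp add: LIMSEQ_const_iff)
    moreover have "AE x in null_measure borel. \<forall>i. (x :: real^'v) $ i \<in> {0..1}"
      by (rule AE_I'[of UNIV]) (auto simp: null_sets_def)
    ultimately show ?thesis
      by (intro exI[of _ "null_measure borel"]) (auto intro!: finite_measureI)
  next
    case False
    have L1: "L 1 > 0" using pos[of "\<lambda>_. 0" "\<lambda>_. 0"] False by simp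
    have "\<exists>r \<mu>. strict_mono (r :: nat \<Rightarrow> nat) \<and> prob_space \<mu> \<and> sets \<mu> = sets borel \<and>
     (AE x in \<mu>. \<forall>i. x $ i \<in> {0..1}) \<and>
     (\<forall>h :: real^'v \<Rightarrow> real. continuous_on UNIV h \<longrightarrow>
        (\<lambda>k. \<Sum>j\<in>J (r k). (L (\<beta> (r k) j) / L 1) * h (\<chi> i. real (j i) / real (r k))) \<longlonglongrightarrow> (\<integral>x. h x \<partial>\<mu>))"
    proof (rule discrete_measures_on_cube_compact)
      show "finite (J k)" for k by (rule finJ)
      show "0 \<le> L (\<beta> k j) / L 1" for k j using \<beta>pos L1 by simp
      show "(\<Sum>j\<in>J k. L (\<beta> k j) / L 1) = 1" for k
        using tot[of k] L1 by (simp add: sum_divide_distrib[symmetric])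
      show "(\<chi> i. real (j i) / real k) $ i \<in> {0..1}" if "j \<in> J k" for k j and i :: 'v
      proof -
        have "j i \<le> k" using that by (auto simp: J_def)
        then show ?thesis by (auto simp: divide_le_eq)
      qed
    qed
    then obtain r :: "nat \<Rightarrow> nat" and \<mu> :: "(real^'v) measure"
      where r: "strict_mono r" and \<mu>: "prob_space \<mu>" "sets \<mu> = sets borel" "AE x in \<mu>. \<forall>i. x $ i \<in> {0..1}"
      and lim: "\<And>h :: real^'v \<Rightarrow> real. continuous_on UNIV h \<Longrightarrow>
        (\<lambda>k. \<Sum>j\<in>J (r k). (L (\<beta> (r k) j) / L 1) * h (\<chi> i. real (j i) / real (r k))) \<longlonglongrightarrow> (\<integral>x. h x \<partial>\<mu>)"
      by blast
    interpret \<mu>: prob_space \<mu> by (rule \<mu>)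
    have eq: "L (\<Prod>i\<in>UNIV. u i ^ \<alpha> i) / L 1 = (\<integral>x. (\<Prod>i\<in>UNIV. (x $ i) ^ \<alpha> i) \<partial>\<mu>)" for \<alpha>
    proof (rule LIMSEQ_unique)
      have "continuous_on UNIV (\<lambda>x::real^'v. \<Prod>i\<in>UNIV. (x $ i) ^ \<alpha> i)"
        by (intro continuous_intros)
      from lim[OF this] show "(\<lambda>k. approx (r k) \<alpha> / L 1) \<longlonglongrightarrow> (\<integral>x. (\<Prod>i\<in>UNIV. (x $ i) ^ \<alpha> i) \<partial>\<mu>)"
        by (simp add: approx_def sum_divide_distrib mult.commute)
      show "(\<lambda>k. approx (r k) \<alpha> / L 1) \<longlonglongrightarrow> L (\<Prod>i\<in>UNIV. u i ^ \<alpha> i) / L 1"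
        using LIMSEQ_subseq_LIMSEQ[OF approx r] L1 by (intro tendsto_divide tendsto_const) (auto simp: o_def)
    qed
    \<comment> \<open>This undoes the normalization by \<open>L 1\<close>.\<close>
    define \<nu> where "\<nu> = density \<mu> (\<lambda>_. ennreal (L 1))"
    have "finite_measure \<nu>"
      by (rule finite_measureI) (simp add: \<nu>_def emeasure_density \<mu>.emeasure_space_1 ennreal_mult_less_top)
    moreover have "AE x in \<nu>. \<forall>i. x $ i \<in> {0..1}"
      unfolding \<nu>_def using \<mu>(3) by (subst AE_density) auto
    moreover have "L (\<Prod>i\<in>UNIV. u i ^ \<alpha> i) = (\<integral>x. (\<Prod>i\<in>UNIV. (x $ i) ^ \<alpha> i) \<partial>\<nu>)" for \<alpha>
    proof -
      have "(\<lambda>x::real^'v. \<Prod>i\<in>UNIV. (x $ i) ^ \<alpha> i) \<in> borel_measurable \<mu>"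
        using \<mu>(2) by (subst measurable_cong_sets[OF \<mu>(2) refl]) (intro borel_measurable_continuous_onI continuous_intros)
      then have "(\<integral>x. (\<Prod>i\<in>UNIV. (x $ i) ^ \<alpha> i) \<partial>\<nu>) = (\<integral>x. L 1 *\<^sub>R (\<Prod>i\<in>UNIV. (x $ i) ^ \<alpha> i) \<partial>\<mu>)"
        unfolding \<nu>_def using L1 by (intro integral_density) auto
      then show ?thesis using eq[of \<alpha>] L1 by (simp add: field_simps)
    qed
    ultimately show ?thesis
      using \<mu>(2) by (intro exI[of _ \<nu>]) (auto simp: \<nu>_def)
  qed
qed

subsection \<open>Multivariate polynomials\<close>

text \<open>Finitely supported maps on exponents carry the convolution product and so form a
  commutative ring, which \<open>moment_measure_on_cube\<close> and the ring calculations need; on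
  plain coefficient functions such as \<open>rpoly\<close>, the product of the function algebra
  would be pointwise.\<close>

type_synonym 'v mpoly = "('v \<Rightarrow> nat) \<Rightarrow>\<^sub>0 real"

definition mconst :: "real \<Rightarrow> 'v mpoly" where
  "mconst c = Poly_Mapping.single 0 c"

abbreviation mmono :: "('v \<Rightarrow> nat) \<Rightarrow> 'v mpoly" where
  "mmono \<alpha> \<equiv> Poly_Mapping.single \<alpha> 1"

definition mvar :: "'v \<Rightarrow> 'v mpoly" where
  "mvar i = mmono (\<lambda>k. if k = i then 1 else 0)"

lemma poly_mapping_single_add_induct [case_names single add]:
  fixes p :: "'k \<Rightarrow>\<^sub>0 'c::comm_monoid_add"
  assumes "\<And>\<alpha> c. P (Poly_Mapping.single \<alpha> c)" and "\<And>p q. P p \<Longrightarrow> P q \<Longrightarrow> P (p + q)"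
  shows "P p"
proof (induction p rule: update_induct)
  case const
  show ?case using assms(1)[of undefined 0] by simp
next
  case (update p a b)
  have "Poly_Mapping.update a b p = p + Poly_Mapping.single a b"
    using update(1) by (intro poly_mapping_eqI) (auto simp: lookup_update lookup_add lookup_single in_keys_iff when_def)
  then show ?case using assms update by simp
qed

lemma mvar_power: "mvar i ^ n = mmono (\<lambda>k. if k = i then n else 0)"
  by (induction n) (auto simp: mvar_def mult_single fun_eq_iff simp flip: single_one intro!: arg_cong2[where f = Poly_Mapping.single])

lemma mmono_eq_prod: "mmono \<alpha> = (\<Prod>i\<in>UNIV. mvar i ^ \<alpha> i)" for \<alpha> :: "'v::finite \<Rightarrow> nat"
proof -
  have "(\<Prod>i\<in>A. mvar i ^ \<alpha> i) = mmono (\<lambda>k. if k \<in> A then \<alpha> k else 0)" for A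
  proof (induction A rule: infinite_finite_induct)
    case (insert i A)
    then show ?case
      by (auto simp: mvar_power mult_single fun_eq_iff intro!: arg_cong2[where f = Poly_Mapping.single])
  qed (auto simp: zero_fun_def simp flip: single_one)
  then show ?thesis by simp
qed

text \<open>Multiplying by one variable at a time is the form of induction that suits a change of
  variables; see \<open>archimedean_moment_measure\<close>.\<close>

lemma mpoly_induct [case_names const add mult]:
  fixes p :: "'v::finite mpoly"
  assumes const: "\<And>c. P (mconst c)" and add: "\<And>p q. P p \<Longrightarrow> P q \<Longrightarrow> P (p + q)"
    and mult: "\<And>p i. P p \<Longrightarrow> P (p * mvar i)"
  shows "P p"
proof (induction p rule: poly_mapping_single_add_induct)
  case (single \<alpha> c)
  have pw: "P (p * mvar i ^ n)" if "P p" for p i n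
    by (induction n) (use that mult in \<open>auto simp: power_Suc2 mult.assoc[symmetric] simp del: power_Suc\<close>)
  have "P (mconst c * (\<Prod>i\<in>A. mvar i ^ \<alpha> i))" for A
  proof (induction A rule: infinite_finite_induct)
    case (insert i A)
    then show ?case using pw[of "mconst c * (\<Prod>i\<in>A. mvar i ^ \<alpha> i)" i "\<alpha> i"]
      by (simp add: ac_simps)
  qed (use const in auto)
  then have "P (mconst c * mmono \<alpha>)" by (simp only: mmono_eq_prod)
  then show ?case by (simp add: mult_single mconst_def)
qed (rule add)

lemma mconst_mult: "mconst a * mconst b = (mconst (a * b) :: 'v mpoly)"
  by (simp add: mult_single mconst_def)

lemma mconst_1: "mconst 1 = 1"
  by (simp add: mconst_def)

lemma mconst_add: "mconst (a + b) = mconst a + mconst b"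
  by (simp add: mconst_def single_add)

lemma mconst_uminus: "mconst (- a) = - mconst a"
  by (simp add: mconst_def single_uminus)

definition meval :: "real^'v::finite \<Rightarrow> 'v mpoly \<Rightarrow> real" where
  "meval x p = (\<Sum>\<alpha>\<in>Poly_Mapping.keys p. Poly_Mapping.lookup p \<alpha> * (\<Prod>i\<in>UNIV. (x $ i) ^ \<alpha> i))"

lemma sum_keys_add:
  fixes h :: "'k \<Rightarrow> real" and p q :: "'k \<Rightarrow>\<^sub>0 real"
  shows "(\<Sum>\<alpha>\<in>Poly_Mapping.keys (p + q). Poly_Mapping.lookup (p + q) \<alpha> * h \<alpha>)
     = (\<Sum>\<alpha>\<in>Poly_Mapping.keys p. Poly_Mapping.lookup p \<alpha> * h \<alpha>) + (\<Sum>\<alpha>\<in>Poly_Mapping.keys q. Poly_Mapping.lookup q \<alpha> * h \<alpha>)"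
  by (rule setsum_keys_plus_distrib) (auto simp: algebra_simps)

lemma meval_add [simp]: "meval x (p + q) = meval x p + meval x q"
  unfolding meval_def by (rule sum_keys_add)

lemma meval_single [simp]: "meval x (Poly_Mapping.single \<alpha> c) = c * (\<Prod>i\<in>UNIV. (x $ i) ^ \<alpha> i)"
  by (cases "c = 0") (auto simp: meval_def)

lemma meval_mconst [simp]: "meval x (mconst c) = c"
  by (simp add: mconst_def)

lemma meval_mult [simp]: "meval x (p * q) = meval x p * meval x q"
proof (induction p rule: poly_mapping_single_add_induct)
  case (single \<alpha> c)
  show ?case
    by (induction q rule: poly_mapping_single_add_induct)
      (auto simp: mult_single distrib_left power_add prod.distrib)
qed (auto simp: algebra_simps)

lemma meval_mvar [simp]: "meval x (mvar i) = x $ i"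
proof -
  have "(\<Prod>k\<in>UNIV. (x $ k) ^ (if k = i then 1 else 0)) = (\<Prod>k\<in>UNIV. if k = i then x $ i else 1)"
    by (rule prod.cong) auto
  then show ?thesis by (simp add: mvar_def)
qed

lemma meval_uminus [simp]: "meval x (- p) = - meval x p"
proof -
  have "- p = mconst (-1) * p" by (simp add: mconst_uminus mconst_1)
  then show ?thesis by (simp only: meval_mult meval_mconst mult_minus1)
qed

lemma meval_diff [simp]: "meval x (p - q) = meval x p - meval x q"
  using meval_add[of x p "- q"] by (simp del: meval_add)

lemma meval_0 [simp]: "meval x 0 = 0"
  by (simp add: meval_def)

lemma meval_sum [simp]: "meval x (sum h A) = (\<Sum>a\<in>A. meval x (h a))"
  by (induction A rule: infinite_finite_induct) auto

lemma meval_1 [simp]: "meval x 1 = 1"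
  using meval_mconst[of x 1] by (simp only: mconst_1)

lemma meval_power [simp]: "meval x (p ^ n) = meval x p ^ n"
  by (induction n) auto

lemma continuous_on_meval [continuous_intros]:
  "continuous_on S h \<Longrightarrow> continuous_on S (\<lambda>x. meval (h x) p)"
  unfolding meval_def by (intro continuous_intros)

subsection \<open>Functionals nonnegative on a quadratic module\<close>

lemma quadratic_nonneg_imp_discriminant:
  fixes A B D :: real
  assumes "\<And>c. 0 \<le> c\<^sup>2 * A + 2 * c * B + D"
  shows "B\<^sup>2 \<le> A * D"
proof (cases "A = 0")
  case True
  have "B = 0"
  proof (rule ccontr)
    assume "B \<noteq> 0"
    \<comment> \<open>At this \<open>c\<close> the expression, linear when \<open>A = 0\<close>,
      equals -1.\<close>
    then show False using assms[of "- (D + 1) / (2 * B)"] True by (simp add: field_simps)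
  qed
  then show ?thesis using True by simp
next
  case False
  have "A \<ge> 0"
  proof (rule ccontr)
    assume "\<not> A \<ge> 0"
    then have neg: "A < 0" by simp
    \<comment> \<open>Large enough for the negative quadratic term to beat the rest; the final 1
      ensures \<open>c \<ge> 1\<close>, so that the constant term may be multiplied by
      \<open>c\<close> too.\<close>
    define c where "c = (\<bar>B\<bar> * 2 + \<bar>D\<bar> + 1) / - A + 1"
    have c1: "c \<ge> 1" and cA: "c * - A \<ge> \<bar>B\<bar> * 2 + \<bar>D\<bar> + 1"
      using neg by (auto simp: c_def field_simps)
    have "c * (c * - A) \<ge> c * (\<bar>B\<bar> * 2 + \<bar>D\<bar> + 1)"
      using c1 cA by (intro mult_left_mono) auto
    moreover have "c * (\<bar>B\<bar> * 2 + \<bar>D\<bar> + 1) \<ge> 2 * c * B + 1 * (\<bar>D\<bar> + 1)"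
    proof -
      have "c * B \<le> c * \<bar>B\<bar>" using c1 by (intro mult_left_mono) auto
      moreover have "1 * (\<bar>D\<bar> + 1) \<le> c * (\<bar>D\<bar> + 1)" using c1 by (intro mult_right_mono) auto
      ultimately show ?thesis by (simp add: algebra_simps)
    qed
    ultimately show False using assms[of c] by (simp add: power2_eq_square)
  qed
  with False have "A > 0" by simp
  \<comment> \<open>The minimizer of the parabola.\<close>
  then show ?thesis using assms[of "- B / A"] by (simp add: field_simps power2_eq_square)
qed

locale mpoly_functional =
  fixes L :: "'v::finite mpoly \<Rightarrow> real"
  assumes L_add: "L (p + q) = L p + L q" and L_scale: "L (mconst c * p) = c * L p"
begin

lemma L_uminus: "L (- p) = - L p"
  using L_scale[of "-1" p] by (simp add: mconst_uminus mconst_1)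

lemma L_diff: "L (p - q) = L p - L q"
  using L_add[of p "- q"] L_uminus by simp

lemma L_zero: "L 0 = 0"
  using L_add[of 0 0] by simp

lemma L_sum: "L (sum h A) = (\<Sum>a\<in>A. L (h a))"
  by (induction A rule: infinite_finite_induct) (auto simp: L_zero L_add)

text \<open>The localizing condition for the weight \<open>w\<close> at all orders at once, in a
  form that does not refer to matrices; \<open>loc_psd_iff_square_nonneg\<close> links the
  two.\<close>

definition square_nonneg :: "'v mpoly \<Rightarrow> bool" where
  "square_nonneg w \<longleftrightarrow> (\<forall>q. 0 \<le> L (w * q\<^sup>2))"

lemma Cauchy_Schwarz:
  assumes "square_nonneg w"
  shows "(L (w * (p * q)))\<^sup>2 \<le> L (w * p\<^sup>2) * L (w * q\<^sup>2)"
proof (rule quadratic_nonneg_imp_discriminant)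
  fix c
  have "w * (mconst c * p + q)\<^sup>2
     = mconst c * (mconst c * (w * p\<^sup>2)) + (mconst c * (w * (p * q)) + mconst c * (w * (p * q))) + w * q\<^sup>2"
    by (simp add: algebra_simps power2_eq_square)
  then have "L (w * (mconst c * p + q)\<^sup>2) = c\<^sup>2 * L (w * p\<^sup>2) + 2 * c * L (w * (p * q)) + L (w * q\<^sup>2)"
    by (simp only: L_add L_scale) (simp add: power2_eq_square)
  then show "0 \<le> c\<^sup>2 * L (w * p\<^sup>2) + 2 * c * L (w * (p * q)) + L (w * q\<^sup>2)"
    using assms by (metis square_nonneg_def)
qed

text \<open>By \<open>bd\<close>, multiplication by a variable enlarges the seminorm
  \<open>q \<mapsto> sqrt (L (q^2))\<close> by a factor of at most \<open>R\<close>. Starting from 1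
  this bounds \<open>L ((mmono \<alpha>)^2)\<close>, and Cauchy-Schwarz against 1 bounds
  \<open>L (mmono \<alpha>)\<close>.\<close>

lemma moment_bound:
  assumes pos: "square_nonneg 1" and bd: "\<And>i q. L ((mvar i)\<^sup>2 * q\<^sup>2) \<le> R\<^sup>2 * L (q\<^sup>2)" and R: "0 \<le> R"
  shows "\<bar>L (mmono \<alpha>)\<bar> \<le> L 1 * R ^ mdeg \<alpha>"
proof -
  have pw: "L ((q * mvar i ^ n)\<^sup>2) \<le> (R ^ n)\<^sup>2 * L (q\<^sup>2)" for q i n
  proof (induction n)
    case (Suc n)
    have "L ((q * mvar i ^ Suc n)\<^sup>2) = L ((mvar i)\<^sup>2 * (q * mvar i ^ n)\<^sup>2)"
      by (simp add: power_mult_distrib ac_simps)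
    also have "\<dots> \<le> R\<^sup>2 * L ((q * mvar i ^ n)\<^sup>2)" by (rule bd)
    also have "\<dots> \<le> R\<^sup>2 * ((R ^ n)\<^sup>2 * L (q\<^sup>2))" by (intro mult_left_mono Suc) auto
    finally show ?case by (simp add: power_mult_distrib mult.assoc)
  qed simp
  have "L ((\<Prod>i\<in>A. mvar i ^ \<alpha> i)\<^sup>2) \<le> (R ^ (\<Sum>i\<in>A. \<alpha> i))\<^sup>2 * L 1" for A
  proof (induction A rule: infinite_finite_induct)
    case (insert i A)
    have "L ((\<Prod>i\<in>insert i A. mvar i ^ \<alpha> i)\<^sup>2) = L (((\<Prod>i\<in>A. mvar i ^ \<alpha> i) * mvar i ^ \<alpha> i)\<^sup>2)"
      using insert by (simp add: mult.commute)
    also have "\<dots> \<le> (R ^ \<alpha> i)\<^sup>2 * L ((\<Prod>i\<in>A. mvar i ^ \<alpha> i)\<^sup>2)" by (rule pw)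
    also have "\<dots> \<le> (R ^ \<alpha> i)\<^sup>2 * ((R ^ (\<Sum>i\<in>A. \<alpha> i))\<^sup>2 * L 1)"
      by (intro mult_left_mono insert) auto
    finally show ?case using insert by (simp add: power_add power_mult_distrib mult.assoc)
  qed auto
  then have sq: "L ((mmono \<alpha>)\<^sup>2) \<le> (R ^ mdeg \<alpha>)\<^sup>2 * L 1"
    unfolding mmono_eq_prod mdeg_def .
  have L1: "0 \<le> L 1" using pos[unfolded square_nonneg_def, rule_format, of 1] by simp
  have "(L (mmono \<alpha>))\<^sup>2 \<le> L 1 * L ((mmono \<alpha>)\<^sup>2)"
    using Cauchy_Schwarz[OF pos, of 1 "mmono \<alpha>"] by simp
  also have "\<dots> \<le> L 1 * ((R ^ mdeg \<alpha>)\<^sup>2 * L 1)"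
    by (intro mult_left_mono sq L1)
  also have "\<dots> = (L 1 * R ^ mdeg \<alpha>)\<^sup>2" by (simp add: power2_eq_square ac_simps)
  finally have "\<bar>L (mmono \<alpha>)\<bar> \<le> \<bar>L 1 * R ^ mdeg \<alpha>\<bar>" by (simp only: abs_le_square_iff)
  then show ?thesis using L1 R by simp
qed

text \<open>Only the rate \<open>R\<close> is uniform, while \<open>C\<close> depends on
  \<open>Q\<close>. As \<open>Q\<close> is arbitrary, it may later contain any weight.\<close>

lemma geometric_growth:
  assumes bd: "\<And>\<alpha>. \<bar>L (mmono \<alpha>)\<bar> \<le> M * R ^ mdeg \<alpha>"
  shows "\<exists>C. \<forall>n. \<bar>L (Q * mvar i ^ n)\<bar> \<le> C * R ^ n"
proof (induction Q rule: poly_mapping_single_add_induct)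
  case (single \<alpha> c)
  have "\<bar>L (Poly_Mapping.single \<alpha> c * mvar i ^ n)\<bar> \<le> (\<bar>c\<bar> * (M * R ^ mdeg \<alpha>)) * R ^ n" for n
  proof -
    let ?\<beta> = "\<alpha> + (\<lambda>k. if k = i then n else 0)"
    have "Poly_Mapping.single \<alpha> c * mvar i ^ n = mconst c * mmono ?\<beta>"
      by (simp add: mvar_power mult_single mconst_def)
    then have "\<bar>L (Poly_Mapping.single \<alpha> c * mvar i ^ n)\<bar> = \<bar>c\<bar> * \<bar>L (mmono ?\<beta>)\<bar>"
      by (simp only: L_scale abs_mult)
    also have "\<dots> \<le> \<bar>c\<bar> * (M * R ^ mdeg ?\<beta>)" by (intro mult_left_mono bd) auto
    also have "mdeg ?\<beta> = mdeg \<alpha> + n" by (simp add: mdeg_def sum.distrib)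
    finally show ?thesis by (simp add: power_add ac_simps)
  qed
  then show ?case by blast
next
  case (add p q)
  then obtain C D where "\<And>n. \<bar>L (p * mvar i ^ n)\<bar> \<le> C * R ^ n" "\<And>n. \<bar>L (q * mvar i ^ n)\<bar> \<le> D * R ^ n" by blast
  then have "\<bar>L ((p + q) * mvar i ^ n)\<bar> \<le> (C + D) * R ^ n" for n
    unfolding distrib_right L_add using order.trans[OF abs_triangle_ineq add_mono] by blast
  then show ?case by blast
qed

text \<open>If \<open>a\<^sub>1 > R\<^sup>2 a\<^sub>0\<close> for \<open>a\<^sub>k = L (w q\<^sup>2 x\<^sub>i\<^bsup>2k\<^esup>)\<close>, then iterating \<open>a\<^sub>k\<^sup>2 \<le> a\<^sub>0 a\<^sub>2\<^sub>k\<close> along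
  powers of two makes \<open>a\<^sub>k\<close> grow faster than \<open>R\<^bsup>2k\<^esup>\<close>.\<close>

lemma mvar_square_bound:
  assumes pos: "square_nonneg w" and growth: "\<And>Q. \<exists>C. \<forall>n. \<bar>L (Q * mvar i ^ n)\<bar> \<le> C * R ^ n" and R: "0 < R"
  shows "L (w * (mvar i * q)\<^sup>2) \<le> R\<^sup>2 * L (w * q\<^sup>2)"
proof (rule ccontr)
  assume neg: "\<not> ?thesis"
  define a where "a k = L (w * q\<^sup>2 * mvar i ^ (2 * k))" for k
  have a_sq: "(a k)\<^sup>2 \<le> a 0 * a (2 * k)" for k
  proof -
    have "(L (w * (q * (q * mvar i ^ (2 * k)))))\<^sup>2 \<le> L (w * q\<^sup>2) * L (w * (q * mvar i ^ (2 * k))\<^sup>2)"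
      by (rule Cauchy_Schwarz[OF pos])
    moreover have "w * (q * mvar i ^ (2 * k))\<^sup>2 = w * q\<^sup>2 * mvar i ^ (2 * (2 * k))"
      by (simp add: power_mult_distrib power_mult[symmetric] ac_simps)
    moreover have "w * (q * (q * mvar i ^ (2 * k))) = w * q\<^sup>2 * mvar i ^ (2 * k)"
      by (simp add: power2_eq_square ac_simps)
    ultimately show ?thesis
      by (simp add: a_def)
  qed
  have a0: "0 \<le> a 0" using pos by (simp add: a_def square_nonneg_def)
  have a1: "a 1 > R\<^sup>2 * a 0"
    using neg by (simp add: a_def power_mult_distrib power2_eq_square ac_simps)
  \<comment> \<open>Otherwise \<open>a_sq\<close> at 1 would give \<open>a 1 = 0\<close>, against
    \<open>a1\<close>.\<close>
  have "a 0 \<noteq> 0"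
    using a_sq[of 1] a1 by auto
  with a0 have a0: "0 < a 0" by simp
  define \<rho> where "\<rho> = a 1 / a 0"
  have \<rho>: "\<rho> > R\<^sup>2" using a1 a0 by (simp add: \<rho>_def field_simps)
  have \<rho>0: "\<rho> > 0" using \<rho> R by (meson less_trans zero_less_power)
  have grow: "a 0 * \<rho> ^ (2 ^ k) \<le> a (2 ^ k)" for k
  proof (induction k)
    case 0
    show ?case using a0 by (simp add: \<rho>_def)
  next
    case (Suc k)
    have "a 0 * (a 0 * \<rho> ^ (2 ^ Suc k)) = (a 0 * \<rho> ^ (2 ^ k))\<^sup>2"
      by (simp add: power_mult_distrib power_mult[symmetric] power2_eq_square[of "a 0"] mult.commute[of 2])
    also have "\<dots> \<le> (a (2 ^ k))\<^sup>2"
      using Suc a0 \<rho>0 by (intro power_mono) auto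
    also have "\<dots> \<le> a 0 * a (2 ^ Suc k)" using a_sq[of "2 ^ k"] by simp
    finally show ?case using a0 by simp
  qed
  \<comment> \<open>Here the weight enters the growth bound: \<open>Q\<close> is \<open>w\<close>
    times the square of \<open>q\<close>, and the rate is still \<open>R\<close>.\<close>
  obtain C where C: "\<And>n. \<bar>L (w * q\<^sup>2 * mvar i ^ n)\<bar> \<le> C * R ^ n" using growth by blast
  define \<sigma> where "\<sigma> = \<rho> / R\<^sup>2"
  have \<sigma>: "\<sigma> > 1" using \<rho> R by (simp add: \<sigma>_def)
  have bound: "a 0 * \<sigma> ^ (2 ^ k) \<le> C" for k
  proof -
    have "a 0 * \<rho> ^ (2 ^ k) \<le> C * R ^ (2 * 2 ^ k)"
      using grow[of k] C[of "2 * 2 ^ k"] by (simp add: a_def)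
    then show ?thesis using R by (simp add: \<sigma>_def power_divide power_mult field_simps)
  qed
  obtain n where n: "C / a 0 < \<sigma> ^ n" using real_arch_pow[OF \<sigma>] by blast
  have "\<sigma> ^ n \<le> \<sigma> ^ (2 ^ n)"
    using \<sigma> by (intro power_increasing) (auto intro: less_imp_le less_exp)
  then have "C < a 0 * \<sigma> ^ (2 ^ n)" using n a0 by (simp add: field_simps) (meson less_le_trans mult_le_cancel_left_pos)
  then show False using bound[of n] by simp
qed

text \<open>With \<open>x\<close> a variable and \<open>s\<close> a sign,
  \<open>2R (R + s x) = (R + s x)^2 + (R^2 - x^2)\<close>. The first term is a square under the
  weight \<open>w\<close>, the second is handled by \<open>mvar_square_bound\<close>.\<close>

lemma square_nonneg_mult_linear:
  assumes pos: "square_nonneg w" and growth: "\<And>Q i. \<exists>C. \<forall>n. \<bar>L (Q * mvar i ^ n)\<bar> \<le> C * R ^ n" and R: "0 < R"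
    and s: "s = 1 \<or> s = - 1"
  shows "square_nonneg (w * (mconst R + mconst s * mvar i))"
  unfolding square_nonneg_def
proof
  fix q
  let ?l = "mconst R + mconst s * mvar i"
  have ss: "mconst s * mconst s = (1 :: 'v mpoly)" using s by (auto simp: mconst_mult mconst_1)
  have x: "(mvar i)\<^sup>2 = (mconst s * mvar i) * (mconst s * mvar i)"
  proof -
    have "(mconst s * mvar i) * (mconst s * mvar i) = (mconst s * mconst s) * (mvar i * mvar i)"
      by (simp only: ac_simps)
    then show ?thesis by (simp only: ss power2_eq_square mult_1)
  qed
  have k: "mconst (2 * R) = mconst R + mconst R" "mconst (R\<^sup>2) = mconst R * mconst R"
    by (simp_all only: mconst_add[symmetric] mconst_mult mult_2 power2_eq_square)
  have "mconst (2 * R) * (w * ?l * q\<^sup>2) = w * (?l * q)\<^sup>2 + (mconst (R\<^sup>2) * (w * q\<^sup>2) - w * (mvar i * q)\<^sup>2)"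
    unfolding power_mult_distrib x k power2_eq_square[of ?l] by (simp add: algebra_simps)
  then have "2 * R * L (w * ?l * q\<^sup>2) = L (w * (?l * q)\<^sup>2) + (R\<^sup>2 * L (w * q\<^sup>2) - L (w * (mvar i * q)\<^sup>2))"
    by (metis L_scale L_add L_diff)
  moreover have "0 \<le> L (w * (?l * q)\<^sup>2)" using pos by (simp add: square_nonneg_def)
  moreover have "L (w * (mvar i * q)\<^sup>2) \<le> R\<^sup>2 * L (w * q\<^sup>2)"
    by (rule mvar_square_bound[OF pos growth R])
  ultimately show "0 \<le> L (w * ?l * q\<^sup>2)"
    using R by (smt (verit) mult_pos_neg)
qed

end

section \<open>Representing measures under a ball constraint, and their supports\<close>

lemma integrable_continuous_AE_compact:
  fixes h :: "'a::{metric_space, second_countable_topology} \<Rightarrow> real"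
  assumes "finite_measure \<mu>" "sets \<mu> = sets borel" "AE x in \<mu>. x \<in> K" "compact K" "continuous_on UNIV h"
  shows "integrable \<mu> h"
proof -
  interpret finite_measure \<mu> by fact
  have "compact (h ` K)"
    using assms by (intro compact_continuous_image) (auto intro: continuous_on_subset)
  then obtain B where B: "\<And>x. x \<in> K \<Longrightarrow> norm (h x) \<le> B"
    using compact_imp_bounded bounded_iff by (metis imageI)
  have "h \<in> borel_measurable \<mu>"
    by (subst measurable_cong_sets[OF assms(2) refl]) (rule borel_measurable_continuous_onI[OF assms(5)])
  then show ?thesis
    using assms(3) B by (intro integrable_const_bound[of h B]) auto
qed

lemma compact_cube: "compact {x :: real^'v::finite. \<forall>i. x $ i \<in> {a..b}}"
proof -
  have "{x :: real^'v. \<forall>i. x $ i \<in> {a..b}} = cbox (\<chi> i. a) (\<chi> i. b)"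
    by (auto simp: mem_box_cart)
  then show ?thesis by simp
qed

text \<open>The dual form of Putinar's theorem: the ball constraint gives moment bounds, these make
  all products of \<open>R + x_i\<close> and \<open>R - x_i\<close> nonnegative under
  \<open>L\<close>, and after rescaling to the unit cube \<open>moment_measure_on_cube\<close>
  applies.\<close>

lemma (in mpoly_functional) archimedean_moment_measure:
  assumes pos: "square_nonneg 1" and ball: "square_nonneg (mconst r - (\<Sum>i\<in>UNIV. (mvar i)\<^sup>2))"
  shows "\<exists>\<mu> R. finite_measure \<mu> \<and> sets \<mu> = sets borel \<and> (AE x in \<mu>. \<forall>i. x $ i \<in> {- R..R}) \<and>
    (\<forall>p. L p = (\<integral>x. meval x p \<partial>\<mu>))"
proof -
  \<comment> \<open>The lower bound 1 gives \<open>r \<le> R^2\<close> also for small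
    \<open>r\<close> and keeps \<open>R\<close> positive.\<close>
  define R where "R = max 1 \<bar>r\<bar>"
  have R: "R \<ge> 1" "R > 0" by (auto simp: R_def)
  have rR: "r \<le> R\<^sup>2"
  proof -
    have "r \<le> R * 1" by (simp add: R_def)
    also have "\<dots> \<le> R * R" using R by (intro mult_left_mono) auto
    finally show ?thesis by (simp add: power2_eq_square)
  qed
  have bd: "L ((mvar i)\<^sup>2 * q\<^sup>2) \<le> R\<^sup>2 * L (q\<^sup>2)" for i q
  proof -
    have nn: "0 \<le> L ((mvar j)\<^sup>2 * q\<^sup>2)" for j
      using pos[unfolded square_nonneg_def, rule_format, of "mvar j * q"] by (simp add: power_mult_distrib)
    have "0 \<le> L ((mconst r - (\<Sum>i\<in>UNIV. (mvar i)\<^sup>2)) * q\<^sup>2)"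
      using ball by (simp only: square_nonneg_def)
    also have "\<dots> = r * L (q\<^sup>2) - (\<Sum>j\<in>UNIV. L ((mvar j)\<^sup>2 * q\<^sup>2))"
      by (simp only: left_diff_distrib L_diff L_scale sum_distrib_right L_sum)
    finally have "(\<Sum>j\<in>UNIV. L ((mvar j)\<^sup>2 * q\<^sup>2)) \<le> r * L (q\<^sup>2)" by simp
    moreover have "L ((mvar i)\<^sup>2 * q\<^sup>2) \<le> (\<Sum>j\<in>UNIV. L ((mvar j)\<^sup>2 * q\<^sup>2))"
      by (rule member_le_sum) (use nn in auto)
    moreover have "r * L (q\<^sup>2) \<le> R\<^sup>2 * L (q\<^sup>2)"
      using pos[unfolded square_nonneg_def, rule_format, of q] rR by (intro mult_right_mono) auto
    ultimately show ?thesis by linarith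
  qed
  have growth: "\<exists>C. \<forall>n. \<bar>L (Q * mvar i ^ n)\<bar> \<le> C * R ^ n" for Q i
    by (rule geometric_growth[OF moment_bound[OF pos bd]]) (use R in auto)
  have scale_nn: "square_nonneg (w * mconst c)" if "square_nonneg w" "0 \<le> c" for w c
  proof -
    have "L (w * mconst c * q\<^sup>2) = c * L (w * q\<^sup>2)" for q
      using L_scale[of c "w * q\<^sup>2"] by (simp add: ac_simps)
    then show ?thesis using that by (simp add: square_nonneg_def)
  qed
  \<comment> \<open>The affine map from \<open>[-R,R]\<close> onto \<open>[0,1]\<close>:
    \<open>u i\<close> is \<open>(R + x_i) / (2R)\<close> and \<open>1 - u i\<close> is
    \<open>(R - x_i) / (2R)\<close>.\<close>
  define u where "u i = mconst (1 / (2 * R)) * (mconst R + mconst 1 * mvar i)" for i :: 'v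
  have u': "1 - u i = mconst (1 / (2 * R)) * (mconst R + mconst (- 1) * mvar i)" for i
  proof -
    have "u i + mconst (1 / (2 * R)) * (mconst R + mconst (- 1) * mvar i) = mconst (1 / (2 * R)) * (mconst R + mconst R)"
      by (simp add: u_def mconst_uminus mconst_1 algebra_simps)
    also have "\<dots> = 1"
      using R by (simp add: mconst_add[symmetric] mconst_mult mconst_1)
    finally show ?thesis by (simp add: algebra_simps)
  qed
  have x: "mvar i = mconst (2 * R) * u i - mconst R" for i
  proof -
    have "mconst (2 * R) * u i = mconst (2 * R) * mconst (1 / (2 * R)) * (mconst R + mconst 1 * mvar i)"
      by (simp only: u_def mult.assoc)
    then show ?thesis using R by (simp add: mconst_mult mconst_1)
  qed
  have nn_u: "square_nonneg (w * u i)" "square_nonneg (w * (1 - u i))" if "square_nonneg w" for w i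
    using square_nonneg_mult_linear[OF scale_nn[OF that, of "1 / (2 * R)"] growth R(2), of 1 i]
      square_nonneg_mult_linear[OF scale_nn[OF that, of "1 / (2 * R)"] growth R(2), of "-1" i] R
    unfolding u' unfolding u_def by (simp_all only: mult.assoc) auto
  have nn_pow: "square_nonneg (w * (u i ^ m * (1 - u i) ^ n))" if "square_nonneg w" for w i m n
  proof -
    have 1: "square_nonneg (w * u i ^ m)" for m
      by (induction m) (use that nn_u in \<open>auto simp: power_Suc2 mult.assoc[symmetric] simp del: power_Suc\<close>)
    have "square_nonneg (w * u i ^ m * (1 - u i) ^ n)"
      by (induction n) (use 1 nn_u in \<open>auto simp: power_Suc2 mult.assoc[symmetric] simp del: power_Suc\<close>)
    then show ?thesis by (simp only: mult.assoc)
  qed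
  \<comment> \<open>Starting from the weight 1, the factors join the weight one by one.\<close>
  have "square_nonneg (\<Prod>i\<in>A. u i ^ a i * (1 - u i) ^ b i)" for A a b
  proof (induction A rule: infinite_finite_induct)
    case (insert i A)
    have "(\<Prod>i\<in>insert i A. u i ^ a i * (1 - u i) ^ b i) = (\<Prod>i\<in>A. u i ^ a i * (1 - u i) ^ b i) * (u i ^ a i * (1 - u i) ^ b i)"
      by (subst prod.insert) (use insert in \<open>simp_all only: mult.commute not_False_eq_True\<close>)
    then show ?case by (simp only: nn_pow[OF insert.IH])
  qed (use pos in auto)
  then have "0 \<le> L ((\<Prod>i\<in>UNIV. u i ^ a i * (1 - u i) ^ b i) * 1\<^sup>2)" for a b
    unfolding square_nonneg_def by blast
  then have "0 \<le> L (\<Prod>i\<in>UNIV. u i ^ a i * (1 - u i) ^ b i)" for a b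
    by (simp only: power_one mult_1_right)
  from moment_measure_on_cube[where L = L and u = u, OF L_add this]
  obtain \<nu> :: "(real^'v) measure" where \<nu>: "finite_measure \<nu>" "sets \<nu> = sets borel" "AE x in \<nu>. \<forall>i. x $ i \<in> {0..1}"
    and mom: "\<And>\<alpha>. L (\<Prod>i\<in>UNIV. u i ^ \<alpha> i) = (\<integral>x. (\<Prod>i\<in>UNIV. (x $ i) ^ \<alpha> i) \<partial>\<nu>)"
    by blast
  interpret \<nu>: finite_measure \<nu> by (rule \<nu>)
  define \<psi> :: "real^'v \<Rightarrow> real^'v" where "\<psi> s = (\<chi> i. 2 * R * s $ i - R)" for s
  have \<psi>: "continuous_on UNIV \<psi>" unfolding \<psi>_def by (intro continuous_intros)
  have int: "integrable \<nu> h" if "continuous_on UNIV h" for h :: "real^'v \<Rightarrow> real"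
    by (rule integrable_continuous_AE_compact[OF \<nu>(1,2) _ compact_cube that]) (use \<nu>(3) in simp)
  \<comment> \<open>The measure \<open>\<nu>\<close> is known to represent \<open>L\<close> on
    monomials in the \<open>u i\<close> only. Replacing a variable \<open>x_i\<close> of
    \<open>p\<close> by \<open>2R u_i - R\<close> raises the exponent \<open>b i\<close>, hence the
    induction over \<open>p\<close> for all \<open>b\<close>.\<close>
  have key: "L (p * (\<Prod>i\<in>UNIV. u i ^ b i)) = (\<integral>s. meval (\<psi> s) p * (\<Prod>i\<in>UNIV. (s $ i) ^ b i) \<partial>\<nu>)" for p b
  proof (induction p arbitrary: b rule: mpoly_induct)
    case (const c)
    show ?case by (simp add: L_scale mom)
  next
    case (add p q)
    show ?case
      unfolding distrib_right L_add add meval_add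
      by (intro Bochner_Integration.integral_add[symmetric] int continuous_intros \<psi>)
  next
    case (mult p i)
    let ?b = "b(i := Suc (b i))"
    have up: "(\<Prod>k\<in>UNIV. h k ^ ?b k) = h i * (\<Prod>k\<in>UNIV. h k ^ b k)" for h :: "'v \<Rightarrow> 'c::comm_monoid_mult"
    proof -
      have "(\<Prod>k\<in>UNIV. h k ^ ?b k) = (\<Prod>k\<in>UNIV. (if k = i then h k else 1) * h k ^ b k)"
        by (rule prod.cong) auto
      then show ?thesis by (simp only: prod.distrib) simp
    qed
    have "p * mvar i * (\<Prod>i\<in>UNIV. u i ^ b i)
       = mconst (2 * R) * (p * (\<Prod>i\<in>UNIV. u i ^ ?b i)) - mconst R * (p * (\<Prod>i\<in>UNIV. u i ^ b i))"
      unfolding up x[of i] by (simp only: algebra_simps)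
    then have "L (p * mvar i * (\<Prod>i\<in>UNIV. u i ^ b i))
      = 2 * R * L (p * (\<Prod>i\<in>UNIV. u i ^ ?b i)) - R * L (p * (\<Prod>i\<in>UNIV. u i ^ b i))"
      by (simp only: L_diff L_scale)
    also have "\<dots> = 2 * R * (\<integral>s. meval (\<psi> s) p * (\<Prod>i\<in>UNIV. (s $ i) ^ ?b i) \<partial>\<nu>)
       - R * (\<integral>s. meval (\<psi> s) p * (\<Prod>i\<in>UNIV. (s $ i) ^ b i) \<partial>\<nu>)"
      by (simp only: mult)
    also have "\<dots> = (\<integral>s. 2 * R * (meval (\<psi> s) p * (\<Prod>i\<in>UNIV. (s $ i) ^ ?b i))
       - R * (meval (\<psi> s) p * (\<Prod>i\<in>UNIV. (s $ i) ^ b i)) \<partial>\<nu>)"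
      by (subst Bochner_Integration.integral_diff)
        (intro int continuous_intros \<psi>, intro int continuous_intros \<psi>, simp only: integral_mult_right_zero)
    also have "\<dots> = (\<integral>s. meval (\<psi> s) (p * mvar i) * (\<Prod>i\<in>UNIV. (s $ i) ^ b i) \<partial>\<nu>)"
      unfolding up by (intro Bochner_Integration.integral_cong) (auto simp: \<psi>_def algebra_simps)
    finally show ?case .
  qed
  define \<mu> where "\<mu> = distr \<nu> borel \<psi>"
  have \<psi>_meas: "\<psi> \<in> borel_measurable \<nu>"
    by (subst measurable_cong_sets[OF \<nu>(2) refl]) (rule borel_measurable_continuous_onI[OF \<psi>])
  have "finite_measure \<mu>" unfolding \<mu>_def by (rule \<nu>.finite_measure_distr[OF \<psi>_meas])
  moreover have "AE x in \<mu>. \<forall>i. x $ i \<in> {- R..R}"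
  proof -
    have "{x :: real^'v. \<forall>i. x $ i \<in> {- R..R}} \<in> sets borel"
      by (intro borel_closed compact_imp_closed compact_cube)
    then show ?thesis
      unfolding \<mu>_def using \<nu>(3)
      by (subst AE_distr_iff[OF \<psi>_meas]) (use R in \<open>auto elim!: eventually_mono simp: \<psi>_def\<close>)
  qed
  moreover have "L p = (\<integral>x. meval x p \<partial>\<mu>)" for p
  proof -
    have "(\<integral>x. meval x p \<partial>\<mu>) = (\<integral>s. meval (\<psi> s) p \<partial>\<nu>)"
      unfolding \<mu>_def by (intro integral_distr \<psi>_meas borel_measurable_continuous_onI continuous_intros)
    then show ?thesis using key[of p "\<lambda>_. 0"] by simp
  qed
  ultimately show ?thesis by (intro exI[of _ \<mu>] exI[of _ R]) (auto simp: \<mu>_def)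
qed

lemma real_polynomial_function_imp_meval:
  fixes q :: "real^'v::finite \<Rightarrow> real"
  assumes "real_polynomial_function q"
  shows "\<exists>p. \<forall>x. q x = meval x p"
  using assms
proof (induction rule: real_polynomial_function.induct)
  case (linear h)
  have "h x = meval x (\<Sum>i\<in>UNIV. mconst (h (axis i 1)) * mvar i)" for x
  proof -
    have "h x = h (\<Sum>i\<in>UNIV. x $ i *\<^sub>R axis i 1)"
      by (simp only: basis_expansion[of x, unfolded scalar_mult_eq_scaleR])
    also have "\<dots> = (\<Sum>i\<in>UNIV. x $ i *\<^sub>R h (axis i 1))"
      using linear by (simp add: linear_sum linear_scale bounded_linear.linear)
    finally show ?thesis by (simp add: mult.commute)
  qed
  then show ?case by blast
next
  case (const c)
  show ?case by (rule exI[of _ "mconst c"]) simp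
next
  case (add f g)
  then show ?case by (metis meval_add)
next
  case (mult f g)
  then show ?case by (metis meval_mult)
qed

text \<open>For the negative part \<open>\<phi>\<close> of \<open>g\<close> one has
  \<open>g \<phi>^2 = - \<phi>^3\<close> pointwise. Approximating \<open>\<phi>\<close> uniformly on
  the cube by polynomials yields that the integral of \<open>\<phi>^3\<close> is at most 0, so
  \<open>\<phi>\<close> vanishes almost everywhere.\<close>

lemma (in mpoly_functional) square_nonneg_imp_AE_nonneg:
  fixes \<mu> :: "(real^'v) measure"
  assumes \<mu>: "finite_measure \<mu>" "sets \<mu> = sets borel" "AE x in \<mu>. \<forall>i. x $ i \<in> {- R..R}"
    and rep: "\<And>p. L p = (\<integral>x. meval x p \<partial>\<mu>)" and g: "square_nonneg g"
  shows "AE x in \<mu>. 0 \<le> meval x g"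
proof -
  let ?K = "{x :: real^'v. \<forall>i. x $ i \<in> {- R..R}}"
  interpret finite_measure \<mu> by (rule \<mu>)
  have K: "compact ?K" by (rule compact_cube)
  have AEK: "AE x in \<mu>. x \<in> ?K" using \<mu>(3) by simp
  note int = integrable_continuous_AE_compact[OF \<mu>(1,2) AEK K]
  have bnd: "\<exists>B. \<forall>x\<in>?K. \<bar>h x\<bar> \<le> B" if "continuous_on UNIV h" for h :: "real^'v \<Rightarrow> real"
  proof -
    have "compact (h ` ?K)"
      by (rule compact_continuous_image[OF continuous_on_subset[OF that subset_UNIV] K])
    then show ?thesis using compact_imp_bounded bounded_iff by (metis imageI real_norm_def)
  qed
  define \<phi> where "\<phi> x = max 0 (- meval x g)" for x
  have \<phi>: "continuous_on UNIV \<phi>" unfolding \<phi>_def by (intro continuous_intros)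
  have "\<exists>p. \<forall>x\<in>?K. \<bar>\<phi> x - meval x p\<bar> < inverse (real (Suc n))" for n
  proof -
    obtain q where "real_polynomial_function q" "\<And>x. x \<in> ?K \<Longrightarrow> \<bar>\<phi> x - q x\<bar> < inverse (real (Suc n))"
      using Stone_Weierstrass_real_polynomial_function[OF K continuous_on_subset[OF \<phi> subset_UNIV], of "inverse (real (Suc n))"]
      by auto
    then show ?thesis using real_polynomial_function_imp_meval by metis
  qed
  then obtain p where p: "\<And>n x. x \<in> ?K \<Longrightarrow> \<bar>\<phi> x - meval x (p n)\<bar> < inverse (real (Suc n))" by metis
  obtain B where B: "\<And>x. x \<in> ?K \<Longrightarrow> \<bar>\<phi> x\<bar> \<le> B" using bnd[OF \<phi>] by blast
  have "continuous_on UNIV (\<lambda>x. meval x g)" by (intro continuous_intros)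
  then obtain G where G: "\<And>x. x \<in> ?K \<Longrightarrow> \<bar>meval x g\<bar> \<le> G" using bnd by blast
  have "(\<lambda>n. \<integral>x. meval x g * (meval x (p n))\<^sup>2 \<partial>\<mu>) \<longlonglongrightarrow> (\<integral>x. meval x g * (\<phi> x)\<^sup>2 \<partial>\<mu>)"
  \<comment> \<open>All approximants stay within distance 1 of \<open>\<phi>\<close>, hence are
    bounded by \<open>B + 1\<close> on the cube.\<close>
  proof (rule integral_dominated_convergence[where w = "\<lambda>_. G * (B + 1)\<^sup>2"])
    show "(\<lambda>x. meval x g * (\<phi> x)\<^sup>2) \<in> borel_measurable \<mu>"
      by (intro borel_measurable_integrable int continuous_intros \<phi>)
    show "(\<lambda>x. meval x g * (meval x (p n))\<^sup>2) \<in> borel_measurable \<mu>" for n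
      by (intro borel_measurable_integrable int continuous_intros)
    show "AE x in \<mu>. (\<lambda>n. meval x g * (meval x (p n))\<^sup>2) \<longlonglongrightarrow> meval x g * (\<phi> x)\<^sup>2"
      using AEK
    proof (rule AE_mp, intro AE_I2 impI)
      fix x assume x: "x \<in> ?K"
      have "(\<lambda>n. meval x (p n) - \<phi> x) \<longlonglongrightarrow> 0"
        by (rule Lim_null_comparison[OF _ LIMSEQ_inverse_real_of_nat])
          (use p[OF x] in \<open>auto intro!: always_eventually less_imp_le simp: abs_minus_commute\<close>)
      then have "(\<lambda>n. meval x (p n)) \<longlonglongrightarrow> \<phi> x" by (rule LIM_zero_cancel)
      then show "(\<lambda>n. meval x g * (meval x (p n))\<^sup>2) \<longlonglongrightarrow> meval x g * (\<phi> x)\<^sup>2"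
        by (intro tendsto_intros)
    qed
    show "AE x in \<mu>. norm (meval x g * (meval x (p n))\<^sup>2) \<le> G * (B + 1)\<^sup>2" for n
      using AEK
    proof (rule AE_mp, intro AE_I2 impI)
      fix x assume x: "x \<in> ?K"
      have "inverse (real (Suc n)) \<le> 1" by (simp add: inverse_le_1_iff)
      then have "\<bar>meval x (p n)\<bar> \<le> B + 1" using p[OF x, of n] B[OF x] by linarith
      then have "\<bar>meval x (p n)\<bar>\<^sup>2 \<le> (B + 1)\<^sup>2" by (intro power_mono) auto
      then show "norm (meval x g * (meval x (p n))\<^sup>2) \<le> G * (B + 1)\<^sup>2"
        using G[OF x] by (simp add: abs_mult) (intro mult_mono, auto)
    qed
  qed simp
  moreover have "0 \<le> (\<integral>x. meval x g * (meval x (p n))\<^sup>2 \<partial>\<mu>)" for n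
    using g[unfolded square_nonneg_def, rule_format, of "p n"] by (simp add: rep)
  ultimately have "0 \<le> (\<integral>x. meval x g * (\<phi> x)\<^sup>2 \<partial>\<mu>)"
    by (blast intro: LIMSEQ_le_const)
  also have "(\<lambda>x. meval x g * (\<phi> x)\<^sup>2) = (\<lambda>x. - (\<phi> x ^ 3))"
    by (auto simp: \<phi>_def max_def fun_eq_iff power2_eq_square power3_eq_cube)
  finally have "(\<integral>x. \<phi> x ^ 3 \<partial>\<mu>) \<le> 0" by simp
  moreover have nn: "0 \<le> \<phi> x ^ 3" for x by (simp add: \<phi>_def)
  ultimately have "(\<integral>x. \<phi> x ^ 3 \<partial>\<mu>) = 0" by (intro antisym integral_nonneg) auto
  moreover have "integrable \<mu> (\<lambda>x. \<phi> x ^ 3)" by (intro int continuous_intros \<phi>)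
  ultimately have "AE x in \<mu>. \<phi> x ^ 3 = 0"
    using integral_nonneg_eq_0_iff_AE[of \<mu> "\<lambda>x. \<phi> x ^ 3"] nn by simp
  then show ?thesis by (rule AE_mp) (auto intro!: AE_I2 simp: \<phi>_def)
qed

subsection \<open>Polynomial approximation of continuously differentiable functions\<close>

lemma is_C1_has_derivative:
  assumes "is_C1 v"
  shows "(v has_derivative frechet_derivative v (at x)) (at x)"
  using assms unfolding is_C1_def
  by (meson differentiable_def frechet_derivative_works)

lemma is_C1_continuous_on_derivative:
  assumes "is_C1 v"
  shows "continuous_on UNIV (\<lambda>x. frechet_derivative v (at x) b)"
proof -
  obtain D where D: "\<And>x. (v has_derivative blinfun_apply (D x)) (at x)" "continuous_on UNIV D"
    using assms unfolding is_C1_def by blast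
  have "frechet_derivative v (at x) = blinfun_apply (D x)" for x
    using frechet_derivative_at[OF D(1)] by metis
  then show ?thesis by (simp only:) (intro continuous_intros D(2))
qed

lemma is_C1_continuous_on: "is_C1 v \<Longrightarrow> continuous_on S v"
  by (meson continuous_at_imp_continuous_on has_derivative_continuous is_C1_has_derivative)

text \<open>In finite dimension, continuity of the derivative in operator norm reduces to continuity
  of the partial derivatives.\<close>

lemma is_C1I:
  fixes v :: "'a::euclidean_space \<Rightarrow> real"
  assumes "\<And>x. (v has_derivative D x) (at x)" "\<And>b. b \<in> Basis \<Longrightarrow> continuous_on UNIV (\<lambda>x. D x b)"
  shows "is_C1 v"
proof -
  have D: "blinfun_apply (Blinfun (D x)) = D x" for x
    by (rule bounded_linear_Blinfun_apply[OF has_derivative_bounded_linear[OF assms(1)]])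
  have "continuous_on UNIV (\<lambda>x. Blinfun (D x))"
    by (rule continuous_on_blinfun_componentwise) (simp add: D assms(2))
  then show ?thesis
    unfolding is_C1_def using assms(1) by (intro exI[of _ "\<lambda>x. Blinfun (D x)"]) (simp add: D)
qed

lemma frechet_derivative_eqI:
  "(v has_derivative D) (at x) \<Longrightarrow> frechet_derivative v (at x) = D"
  by (rule frechet_derivative_at[symmetric])

lemma frechet_derivative_C1_add:
  assumes "is_C1 v" "is_C1 w"
  shows "frechet_derivative (\<lambda>x. v x + w x) (at x) b = frechet_derivative v (at x) b + frechet_derivative w (at x) b"
  by (subst frechet_derivative_eqI[OF has_derivative_add[OF assms[THEN is_C1_has_derivative]]]) simp

lemma frechet_derivative_C1_mult:
  fixes v w :: "'a::real_normed_vector \<Rightarrow> real"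
  assumes "is_C1 v" "is_C1 w"
  shows "frechet_derivative (\<lambda>x. v x * w x) (at x) b
    = v x * frechet_derivative w (at x) b + frechet_derivative v (at x) b * w x"
  by (subst frechet_derivative_eqI[OF has_derivative_mult[OF assms[THEN is_C1_has_derivative]]]) simp

lemma is_C1_add:
  fixes v w :: "'a::euclidean_space \<Rightarrow> real"
  assumes "is_C1 v" "is_C1 w"
  shows "is_C1 (\<lambda>x. v x + w x)"
  by (rule is_C1I[OF has_derivative_add[OF assms[THEN is_C1_has_derivative]]])
    (intro continuous_intros assms[THEN is_C1_continuous_on_derivative])

lemma is_C1_mult:
  fixes v w :: "'a::euclidean_space \<Rightarrow> real"
  assumes "is_C1 v" "is_C1 w"
  shows "is_C1 (\<lambda>x. v x * w x)"
  by (rule is_C1I[OF has_derivative_mult[OF assms[THEN is_C1_has_derivative]]])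
    (intro continuous_intros assms[THEN is_C1_continuous_on_derivative] assms[THEN is_C1_continuous_on])

lemma is_C1_const: "is_C1 (\<lambda>x::'a::euclidean_space. c :: real)"
  by (rule is_C1I[OF has_derivative_const]) auto

lemma is_C1_real_polynomial_function:
  fixes q :: "'a::euclidean_space \<Rightarrow> real"
  assumes "real_polynomial_function q"
  shows "is_C1 q"
  using assms
proof (induction rule: real_polynomial_function.induct)
  case (linear f)
  show ?case by (rule is_C1I[OF bounded_linear_imp_has_derivative[OF linear]]) auto
qed (auto intro: is_C1_const is_C1_add is_C1_mult)

lemma is_C1_sum:
  fixes v :: "'i \<Rightarrow> 'a::euclidean_space \<Rightarrow> real"
  assumes "\<And>i. i \<in> I \<Longrightarrow> is_C1 (v i)"
  shows "is_C1 (\<lambda>x. \<Sum>i\<in>I. v i x)"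
  using assms by (induction I rule: infinite_finite_induct) (auto intro: is_C1_const is_C1_add)

lemma has_derivative_C1_compose_affine:
  assumes "is_C1 v" "bounded_linear A"
  shows "((\<lambda>x. v (a + A x)) has_derivative (\<lambda>d. frechet_derivative v (at (a + A x)) (A d))) (at x)"
proof -
  have "((\<lambda>x. a + A x) has_derivative A) (at x)"
    using has_derivative_add[OF has_derivative_const[of a] bounded_linear_imp_has_derivative[OF assms(2)]] by simp
  from has_derivative_compose[OF this is_C1_has_derivative[OF assms(1)]] show ?thesis .
qed

lemma is_C1_compose_affine:
  fixes v :: "'a::euclidean_space \<Rightarrow> real" and A :: "'b::euclidean_space \<Rightarrow> 'a"
  assumes "is_C1 v" "bounded_linear A"
  shows "is_C1 (\<lambda>x. v (a + A x))"
proof (rule is_C1I[OF has_derivative_C1_compose_affine[OF assms]])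
  fix b :: 'b
  show "continuous_on UNIV (\<lambda>x. frechet_derivative v (at (a + A x)) (A b))"
    by (rule continuous_on_compose2[OF is_C1_continuous_on_derivative[OF assms(1)]])
      (use linear_continuous_on[OF assms(2)] in \<open>auto intro!: continuous_on_add\<close>)
qed

text \<open>The derivatives are those of functions on the whole space, so \<open>K\<close> may have
  empty interior; basis directions suffice by linearity.\<close>

definition C1_close :: "'a::euclidean_space set \<Rightarrow> real \<Rightarrow> ('a \<Rightarrow> real) \<Rightarrow> ('a \<Rightarrow> real) \<Rightarrow> bool" where
  "C1_close K e v w \<longleftrightarrow> (\<forall>x\<in>K. \<bar>v x - w x\<bar> \<le> e \<and>
     (\<forall>b\<in>Basis. \<bar>frechet_derivative v (at x) b - frechet_derivative w (at x) b\<bar> \<le> e))"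

definition C1_approx :: "'a::euclidean_space set \<Rightarrow> ('a \<Rightarrow> real) \<Rightarrow> bool" where
  "C1_approx K v \<longleftrightarrow> (\<forall>e>0. \<exists>q. real_polynomial_function q \<and> C1_close K e v q)"

text \<open>Closedness of the class of approximable functions. It allows one coordinate at a time to
  be made polynomial without ever composing error estimates of several operators.\<close>

lemma C1_approx_limit:
  assumes "\<And>e. e > 0 \<Longrightarrow> \<exists>w. C1_approx K w \<and> C1_close K e v w"
  shows "C1_approx K v"
  unfolding C1_approx_def
proof (intro allI impI)
  fix e :: real assume "e > 0"
  then obtain w where w: "C1_approx K w" "C1_close K (e / 2) v w" using assms[of "e / 2"] by auto
  then obtain q where q: "real_polynomial_function q" "C1_close K (e / 2) w q"
    using \<open>e > 0\<close> unfolding C1_approx_def by (meson half_gt_zero)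
  have tri: "\<bar>r - s\<bar> \<le> e / 2 \<Longrightarrow> \<bar>s - t\<bar> \<le> e / 2 \<Longrightarrow> \<bar>r - t\<bar> \<le> e" for r s t :: real by linarith
  have "C1_close K e v q"
    using w(2) q(2) unfolding C1_close_def by (meson tri)
  then show "\<exists>q. real_polynomial_function q \<and> C1_close K e v q" using q(1) by blast
qed

lemma C1_approx_add:
  fixes v w :: "'a::euclidean_space \<Rightarrow> real"
  assumes "is_C1 v" "is_C1 w" "C1_approx K v" "C1_approx K w"
  shows "C1_approx K (\<lambda>x. v x + w x)"
  unfolding C1_approx_def
proof (intro allI impI)
  fix e :: real assume "e > 0"
  then have "e / 2 > 0" by simp
  then obtain p q where p: "real_polynomial_function p" "C1_close K (e / 2) v p"
    and q: "real_polynomial_function q" "C1_close K (e / 2) w q"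
    using assms(3,4) unfolding C1_approx_def by meson
  note pq = is_C1_real_polynomial_function[OF p(1)] is_C1_real_polynomial_function[OF q(1)]
  have tri: "\<bar>r - s\<bar> \<le> e / 2 \<Longrightarrow> \<bar>r' - s'\<bar> \<le> e / 2 \<Longrightarrow> \<bar>(r + r') - (s + s')\<bar> \<le> e" for r s r' s' :: real
    by linarith
  have "C1_close K e (\<lambda>x. v x + w x) (\<lambda>x. p x + q x)"
    using p(2) q(2) unfolding C1_close_def
      frechet_derivative_C1_add[OF assms(1,2)] frechet_derivative_C1_add[OF pq] by (meson tri)
  then show "\<exists>q. real_polynomial_function q \<and> C1_close K e (\<lambda>x. v x + w x) q"
    using p(1) q(1) by (blast intro: real_polynomial_function.intros(3))
qed

lemma C1_approx_polynomial: "real_polynomial_function q \<Longrightarrow> C1_approx K q"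
  unfolding C1_approx_def C1_close_def by force

lemma C1_approx_sum:
  fixes v :: "'i \<Rightarrow> 'a::euclidean_space \<Rightarrow> real"
  assumes "\<And>i. i \<in> I \<Longrightarrow> is_C1 (v i) \<and> C1_approx K (v i)"
  shows "C1_approx K (\<lambda>x. \<Sum>i\<in>I. v i x)"
  using assms
proof (induction I rule: infinite_finite_induct)
  case (insert i I)
  then have "C1_approx K (\<lambda>x. v i x + (\<Sum>i\<in>I. v i x))"
    by (intro C1_approx_add is_C1_sum) auto
  then show ?case using insert by simp
qed (auto intro!: C1_approx_polynomial real_polynomial_function.intros(2))

lemma C1_approx_mult_polynomial:
  fixes v :: "'a::euclidean_space \<Rightarrow> real"
  assumes v: "is_C1 v" "C1_approx K v" and q: "real_polynomial_function q" and K: "compact K"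
  shows "C1_approx K (\<lambda>x. v x * q x)"
  unfolding C1_approx_def
proof (intro allI impI)
  fix e :: real assume e: "e > 0"
  have q1: "is_C1 q" by (rule is_C1_real_polynomial_function[OF q])
  have bnd: "\<exists>B. \<forall>x\<in>K. \<bar>h x\<bar> \<le> B" if "continuous_on UNIV h" for h :: "'a \<Rightarrow> real"
  proof -
    have "compact (h ` K)"
      by (rule compact_continuous_image[OF continuous_on_subset[OF that subset_UNIV] K])
    then show ?thesis using compact_imp_bounded bounded_iff by (metis imageI real_norm_def)
  qed
  obtain B0 where B0: "\<And>x. x \<in> K \<Longrightarrow> \<bar>q x\<bar> \<le> B0"
    using bnd[OF is_C1_continuous_on[OF q1]] by blast
  have "\<forall>b. \<exists>B. \<forall>x\<in>K. \<bar>frechet_derivative q (at x) b\<bar> \<le> B"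
    using bnd[OF is_C1_continuous_on_derivative[OF q1]] by blast
  then obtain B1 where B1: "\<And>b x. x \<in> K \<Longrightarrow> \<bar>frechet_derivative q (at x) b\<bar> \<le> B1 b" by metis
  \<comment> \<open>One bound on \<open>K\<close> for \<open>q\<close> and all its partial
    derivatives; the 1 makes it positive, so that \<open>e / (2 * M)\<close> is a valid
    accuracy.\<close>
  define M where "M = 1 + \<bar>B0\<bar> + (\<Sum>b\<in>Basis. \<bar>B1 b\<bar>)"
  have M: "M > 0" unfolding M_def by (intro add_pos_nonneg sum_nonneg) auto
  have Mq: "\<bar>q x\<bar> \<le> M" if "x \<in> K" for x
    using B0[OF that] sum_nonneg[of Basis "\<lambda>b. \<bar>B1 b\<bar>", OF abs_ge_zero] unfolding M_def by linarith
  have Md: "\<bar>frechet_derivative q (at x) b\<bar> \<le> M" if "x \<in> K" "b \<in> Basis" for x b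
    using B1[OF that(1), of b] member_le_sum[OF that(2), of "\<lambda>b. \<bar>B1 b\<bar>"] unfolding M_def by auto
  obtain p where p: "real_polynomial_function p" "C1_close K (e / (2 * M)) v p"
    using v(2) e M unfolding C1_approx_def by (meson divide_pos_pos mult_pos_pos zero_less_numeral)
  have p1: "is_C1 p" by (rule is_C1_real_polynomial_function[OF p(1)])
  have est: "\<bar>r * s\<bar> \<le> e / 2" if "\<bar>r\<bar> \<le> e / (2 * M)" "\<bar>s\<bar> \<le> M" for r s
  proof -
    have "\<bar>r\<bar> * \<bar>s\<bar> \<le> e / (2 * M) * M" using that e M by (intro mult_mono) auto
    then show ?thesis using M by (simp add: abs_mult)
  qed
  have "C1_close K e (\<lambda>x. v x * q x) (\<lambda>x. p x * q x)"
    unfolding C1_close_def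
  proof (intro ballI conjI)
    fix x assume x: "x \<in> K"
    have vp: "\<bar>v x - p x\<bar> \<le> e / (2 * M)" using p(2) x by (auto simp: C1_close_def)
    show "\<bar>v x * q x - p x * q x\<bar> \<le> e"
      using est[OF vp Mq[OF x]] e by (simp add: left_diff_distrib)
    fix b :: 'a assume b: "b \<in> Basis"
    have dvp: "\<bar>frechet_derivative v (at x) b - frechet_derivative p (at x) b\<bar> \<le> e / (2 * M)"
      using p(2) x b by (auto simp: C1_close_def)
    have "frechet_derivative (\<lambda>x. v x * q x) (at x) b - frechet_derivative (\<lambda>x. p x * q x) (at x) b
      = (v x - p x) * frechet_derivative q (at x) b
        + (frechet_derivative v (at x) b - frechet_derivative p (at x) b) * q x"
      unfolding frechet_derivative_C1_mult[OF v(1) q1] frechet_derivative_C1_mult[OF p1 q1]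
      by (simp add: algebra_simps)
    then show "\<bar>frechet_derivative (\<lambda>x. v x * q x) (at x) b - frechet_derivative (\<lambda>x. p x * q x) (at x) b\<bar> \<le> e"
      using est[OF vp Md[OF x b]] est[OF dvp Mq[OF x]] by linarith
  qed
  then show "\<exists>q'. real_polynomial_function q' \<and> C1_close K e (\<lambda>x. v x * q x) q'"
    using p(1) q by (blast intro: real_polynomial_function.intros(4))
qed

section \<open>Bernstein polynomials in one variable\<close>

lemma Bernstein_variance:
  assumes "n > 0"
  shows "(\<Sum>k\<le>n. (real k / real n - x)\<^sup>2 * Bernstein n k x) = x * (1 - x) / real n"
proof -
  have *: "\<And>a b x::real. (a - b)\<^sup>2 * x = a * (a - 1) * x + (1 - 2 * b) * a * x + b * b * x"
    by (simp add: algebra_simps power2_eq_square)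
  have "(\<Sum>k\<le>n. (real k - real n * x)\<^sup>2 * Bernstein n k x)
     = real n * (real n - 1) * x\<^sup>2 + (1 - 2 * (real n * x)) * (real n * x) + real n * x * (real n * x) * 1"
    unfolding * sum.distrib sum_kk_Bernstein mult.assoc[of "1 - 2 * (real n * x)"] sum_distrib_left[symmetric]
      sum_k_Bernstein sum_Bernstein by simp
  also have "\<dots> = real n * x * (1 - x)"
    by (simp add: algebra_simps power2_eq_square)
  finally have "(\<Sum>k\<le>n. (real k - real n * x)\<^sup>2 * Bernstein n k x) / (real n)\<^sup>2 = x * (1 - x) / real n"
    using assms by (simp add: power2_eq_square)
  moreover have "(real k / real n - x)\<^sup>2 = (real k - real n * x)\<^sup>2 / (real n)\<^sup>2" for k
  proof -
    have "real k / real n - x = (real k - real n * x) / real n"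
      using assms by (simp add: diff_divide_distrib)
    then show ?thesis by (simp only: power_divide)
  qed
  ultimately show ?thesis by (simp add: sum_divide_distrib)
qed

text \<open>A quadratic error in the distance from the node to \<open>t\<close> averages to the
  variance \<open>t (1 - t) / n\<close>, which is at most \<open>1 / n\<close>.\<close>

lemma Bernstein_average_bound:
  assumes t: "0 \<le> t" "t \<le> 1" and n: "n > 0" and M: "0 \<le> M"
    and F: "\<And>j. j \<le> n \<Longrightarrow> \<bar>F j\<bar> \<le> e + M * (real j / real n - t)\<^sup>2"
  shows "\<bar>\<Sum>j\<le>n. F j * Bernstein n j t\<bar> \<le> e + M / real n"
proof -
  have "\<bar>\<Sum>j\<le>n. F j * Bernstein n j t\<bar> \<le> (\<Sum>j\<le>n. \<bar>F j * Bernstein n j t\<bar>)"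
    by (rule sum_abs)
  also have "\<dots> \<le> (\<Sum>j\<le>n. (e + M * (real j / real n - t)\<^sup>2) * Bernstein n j t)"
    using F Bernstein_nonneg[OF t] by (intro sum_mono) (auto simp: abs_mult intro!: mult_right_mono)
  also have "\<dots> = e * (\<Sum>j\<le>n. Bernstein n j t) + M * (\<Sum>j\<le>n. (real j / real n - t)\<^sup>2 * Bernstein n j t)"
    by (simp add: distrib_right sum.distrib sum_distrib_left mult.assoc del: sum_Bernstein)
  also have "\<dots> = e + M * (t * (1 - t) / real n)"
    by (simp add: Bernstein_variance[OF n])
  also have "\<dots> \<le> e + M * (1 / real n)"
  proof -
    have "t * (1 - t) \<le> 1 * 1" using t by (intro mult_mono) auto
    then show ?thesis using M n by (intro add_left_mono mult_left_mono divide_right_mono) auto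
  qed
  finally show ?thesis by simp
qed

text \<open>Uniform continuity in the form that \<open>Bernstein_average_bound\<close> consumes.
  Points closer than \<open>d\<close> are covered by \<open>e\<close>; farther apart, the trivial
  bound \<open>2B\<close> is at most \<open>2B / d^2\<close> times the squared distance.\<close>

lemma uniform_quadratic_modulus:
  fixes f :: "'a::metric_space \<Rightarrow> real"
  assumes K: "compact K" and f: "continuous_on K f" and e: "e > 0"
  shows "\<exists>M\<ge>0. \<forall>x\<in>K. \<forall>y\<in>K. \<bar>f x - f y\<bar> \<le> e + M * (dist x y)\<^sup>2"
proof -
  obtain d where d: "d > 0" "\<And>x y. x \<in> K \<Longrightarrow> y \<in> K \<Longrightarrow> dist y x < d \<Longrightarrow> dist (f y) (f x) < e"
    using compact_uniformly_continuous[OF f K] e unfolding uniformly_continuous_on_def by metis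
  obtain B where B: "\<And>x. x \<in> K \<Longrightarrow> \<bar>f x\<bar> \<le> B"
    using compact_imp_bounded[OF compact_continuous_image[OF f K]] unfolding bounded_iff by (metis imageI real_norm_def)
  show ?thesis
  proof (intro exI[of _ "2 * \<bar>B\<bar> / d\<^sup>2"] conjI ballI)
    fix x y assume x: "x \<in> K" and y: "y \<in> K"
    show "\<bar>f x - f y\<bar> \<le> e + 2 * \<bar>B\<bar> / d\<^sup>2 * (dist x y)\<^sup>2"
    proof (cases "dist x y < d")
      case True
      then have "\<bar>f x - f y\<bar> < e" using d(2)[OF y x] by (simp add: dist_real_def)
      moreover have "0 \<le> 2 * \<bar>B\<bar> / d\<^sup>2 * (dist x y)\<^sup>2" by simp
      ultimately show ?thesis by linarith
    next
      case False
      then have "d\<^sup>2 \<le> (dist x y)\<^sup>2" using d(1) by (intro power_mono) auto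
      then have "1 \<le> (dist x y)\<^sup>2 / d\<^sup>2" using d(1) by simp
      then have "2 * \<bar>B\<bar> * 1 \<le> 2 * \<bar>B\<bar> * ((dist x y)\<^sup>2 / d\<^sup>2)" by (intro mult_left_mono) auto
      moreover have "\<bar>f x - f y\<bar> \<le> 2 * \<bar>B\<bar>" using B[OF x] B[OF y] by linarith
      ultimately show ?thesis using e by simp
    qed
  qed simp
qed

text \<open>The derivative of a Bernstein basis polynomial of degree \<open>m + 1\<close> is
  \<open>m + 1\<close> times the difference of two neighbours of degree \<open>m\<close>; an index
  shift moves this difference to the coefficients.\<close>

lemma DERIV_Bernstein_sum:
  fixes a :: "nat \<Rightarrow> real"
  shows "((\<lambda>t. \<Sum>j\<le>Suc m. a j * Bernstein (Suc m) j t) has_real_derivative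
     (\<Sum>j\<le>m. real (Suc m) * (a (Suc j) - a j) * Bernstein m j t)) (at t)"
proof -
  \<comment> \<open>The explicit 0 matters here: \<open>j - 1\<close> is truncated at
    \<open>j = 0\<close>, where the left neighbour is absent.\<close>
  define P where "P j t = (if j = 0 then 0 else Bernstein m (j - 1) t)" for j and t :: real
  define Q where "Q j t = (if j = Suc m then 0 else Bernstein m j t)" for j and t :: real
  have d: "(Bernstein (Suc m) j has_real_derivative real (Suc m) * (P j t - Q j t)) (at t)" if "j \<le> Suc m" for j
  proof -
    have A: "real j * real (Suc m choose j) = real (Suc m) * real (m choose (j - 1))" if "j > 0"
      using that Suc_times_binomial_eq[of m "j - 1"] by (metis Suc_pred' mult.commute of_nat_mult)
    have B: "real (Suc m - j) * real (Suc m choose j) = real (Suc m) * real (m choose j)"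
      using binomial_absorb_comp[of "Suc m" j] by (metis diff_Suc_1 of_nat_mult)
    have "((\<lambda>t. real (Suc m choose j) * t ^ j * (1 - t) ^ (Suc m - j)) has_real_derivative
       (real (Suc m choose j) * (real j * t ^ (j - 1)) * (1 - t) ^ (Suc m - j)
        + real (Suc m choose j) * t ^ j * (real (Suc m - j) * (1 - t) ^ (Suc m - j - 1) * (- 1)))) (at t)"
      by (auto intro!: derivative_eq_intros)
    moreover have "real (Suc m choose j) * (real j * t ^ (j - 1)) * (1 - t) ^ (Suc m - j) = real (Suc m) * P j t"
    proof (cases "j = 0")
      case False
      have "real (Suc m choose j) * (real j * t ^ (j - 1)) * (1 - t) ^ (Suc m - j)
        = (real j * real (Suc m choose j)) * (t ^ (j - 1) * (1 - t) ^ (Suc m - j))" by (simp only: ac_simps)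
      also have "\<dots> = real (Suc m) * (real (m choose (j - 1)) * t ^ (j - 1) * (1 - t) ^ (m - (j - 1)))"
        using A False by (simp add: ac_simps Suc_diff_le[symmetric])
      finally show ?thesis using False by (simp only: P_def Bernstein_def if_False)
    qed (simp add: P_def)
    moreover have "real (Suc m choose j) * t ^ j * (real (Suc m - j) * (1 - t) ^ (Suc m - j - 1) * (- 1)) = - real (Suc m) * Q j t"
    proof (cases "j = Suc m")
      case False
      have "real (Suc m choose j) * t ^ j * (real (Suc m - j) * (1 - t) ^ (Suc m - j - 1) * (- 1))
        = - (real (Suc m - j) * real (Suc m choose j)) * (t ^ j * (1 - t) ^ (Suc m - j - 1))" by (simp only: ac_simps mult_minus_left mult_minus_right mult_1_right)
      also have "\<dots> = - real (Suc m) * (real (m choose j) * t ^ j * (1 - t) ^ (m - j))"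
        unfolding B by (simp add: algebra_simps)
      finally show ?thesis using False by (simp only: Q_def Bernstein_def if_False)
    qed (simp add: Q_def)
    ultimately show ?thesis
      unfolding Bernstein_def[abs_def] by (simp only: mult_minus_left mult_minus_right diff_conv_add_uminus distrib_left)
  qed
  have "((\<lambda>t. \<Sum>j\<le>Suc m. a j * Bernstein (Suc m) j t) has_real_derivative
     (\<Sum>j\<le>Suc m. a j * (real (Suc m) * (P j t - Q j t)))) (at t)"
    by (intro DERIV_sum DERIV_cmult d) auto
  moreover have "(\<Sum>j\<le>Suc m. a j * (real (Suc m) * (P j t - Q j t)))
     = (\<Sum>j\<le>m. real (Suc m) * (a (Suc j) - a j) * Bernstein m j t)"
  proof -
    have "(\<Sum>j\<le>Suc m. a j * (real (Suc m) * (P j t - Q j t)))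
       = (\<Sum>j\<le>Suc m. real (Suc m) * a j * P j t) - (\<Sum>j\<le>Suc m. real (Suc m) * a j * Q j t)"
      by (simp only: sum_subtractf[symmetric]) (simp add: algebra_simps)
    also have "(\<Sum>j\<le>Suc m. real (Suc m) * a j * P j t) = (\<Sum>j\<le>m. real (Suc m) * a (Suc j) * Bernstein m j t)"
      by (subst sum.atMost_Suc_shift) (simp add: P_def)
    also have "(\<Sum>j\<le>Suc m. real (Suc m) * a j * Q j t) = (\<Sum>j\<le>m. real (Suc m) * a j * Bernstein m j t)"
      by (simp add: Q_def)
    finally show ?thesis
      by (simp only: right_diff_distrib left_diff_distrib sum_subtractf)
  qed
  ultimately show ?thesis by (simp only:)
qed

section \<open>Bernstein operators in one coordinate\<close>

definition set_coord :: "'a::euclidean_space \<Rightarrow> real \<Rightarrow> 'a \<Rightarrow> 'a" where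
  "set_coord i s x = s *\<^sub>R i + (x - (x \<bullet> i) *\<^sub>R i)"

text \<open>The classical Bernstein operator applied along \<open>i\<close>, with the remaining
  coordinates as parameters. Every summand is a function independent of coordinate \<open>i\<close>
  times a polynomial in it.\<close>

definition Bernstein_op :: "'a::euclidean_space \<Rightarrow> nat \<Rightarrow> ('a \<Rightarrow> real) \<Rightarrow> 'a \<Rightarrow> real" where
  "Bernstein_op i n h x = (\<Sum>j\<le>n. h (set_coord i (real j / real n) x) * Bernstein n j (x \<bullet> i))"

lemma bounded_linear_drop_coord: "bounded_linear (\<lambda>x::'a::euclidean_space. x - (x \<bullet> i) *\<^sub>R i)"
  by (intro bounded_linear_intros)

lemma dist_set_coord:
  assumes "i \<in> Basis"
  shows "dist (set_coord i s x) x = \<bar>s - x \<bullet> i\<bar>"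
proof -
  have "set_coord i s x - x = (s - x \<bullet> i) *\<^sub>R i" by (simp add: set_coord_def algebra_simps)
  then show ?thesis using assms by (simp add: dist_norm)
qed

lemma set_coord_inner:
  assumes "i \<in> Basis" "b \<in> Basis"
  shows "set_coord i s x \<bullet> b = (if b = i then s else x \<bullet> b)"
  using assms by (auto simp: set_coord_def inner_simps inner_Basis)

lemma set_coord_in_cube:
  assumes "i \<in> Basis" "x \<in> cbox 0 One" "0 \<le> s" "s \<le> 1"
  shows "set_coord i s x \<in> cbox 0 One"
  using assms by (auto simp: mem_box set_coord_inner)

lemma has_real_derivative_along_coord:
  assumes "is_C1 h" "i \<in> Basis"
  shows "((\<lambda>s. h (set_coord i s x)) has_real_derivative frechet_derivative h (at (set_coord i s x)) i) (at s)"
proof -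
  have lin: "bounded_linear (\<lambda>s. s *\<^sub>R i)" by (intro bounded_linear_intros)
  have "((\<lambda>s. h ((x - (x \<bullet> i) *\<^sub>R i) + s *\<^sub>R i)) has_derivative
      (\<lambda>d. frechet_derivative h (at ((x - (x \<bullet> i) *\<^sub>R i) + s *\<^sub>R i)) (d *\<^sub>R i))) (at s)"
    by (rule has_derivative_C1_compose_affine[OF assms(1) lin])
  moreover have "linear (frechet_derivative h (at y))" for y
    using has_derivative_bounded_linear[OF is_C1_has_derivative[OF assms(1)]] bounded_linear.linear by blast
  ultimately show ?thesis
    by (simp add: has_field_derivative_def set_coord_def add.commute linear_scale mult.commute[of _ "frechet_derivative _ _ _"])
qed

lemma is_C1_compose_set_coord: "is_C1 h \<Longrightarrow> is_C1 (\<lambda>x. h (set_coord i s x))"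
  unfolding set_coord_def by (intro is_C1_compose_affine bounded_linear_drop_coord)

lemma real_polynomial_function_Bernstein: "real_polynomial_function (\<lambda>x::'a::euclidean_space. Bernstein n j (x \<bullet> i))"
proof -
  have "real_polynomial_function (\<lambda>x::'a. x \<bullet> i)"
    by (intro real_polynomial_function.intros(1) bounded_linear_intros)
  then show ?thesis
    unfolding Bernstein_def
    by (intro real_polynomial_function.intros(2,4) real_polynomial_function_power real_polynomial_function_diff)
qed

lemma Bernstein_op_derivative:
  assumes h: "is_C1 h" and i: "i \<in> Basis"
  shows "(Bernstein_op i (Suc m) h has_derivative
     (\<lambda>d. (\<Sum>j\<le>Suc m. frechet_derivative h (at (set_coord i (real j / real (Suc m)) x)) (d - (d \<bullet> i) *\<^sub>R i)
              * Bernstein (Suc m) j (x \<bullet> i))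
        + (\<Sum>j\<le>m. real (Suc m) * (h (set_coord i (real (Suc j) / real (Suc m)) x) - h (set_coord i (real j / real (Suc m)) x))
              * Bernstein m j (x \<bullet> i)) * (d \<bullet> i))) (at x)"
proof -
  let ?n = "Suc m"
  let ?s = "\<lambda>j. real j / real ?n"
  define B' where "B' j = deriv (Bernstein ?n j) (x \<bullet> i)" for j
  have B': "(Bernstein ?n j has_real_derivative B' j) (at (x \<bullet> i))" for j
    unfolding B'_def DERIV_deriv_iff_field_differentiable Bernstein_def[abs_def]
    by (intro derivative_intros field_differentiable_power)
  have "((\<lambda>x. x \<bullet> i) has_derivative (\<lambda>d. d \<bullet> i)) (at x)"
    by (intro bounded_linear_imp_has_derivative bounded_linear_intros)
  from has_derivative_compose[OF this B'[unfolded has_field_derivative_def]]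
  have dB: "((\<lambda>x. Bernstein ?n j (x \<bullet> i)) has_derivative (\<lambda>d. B' j * (d \<bullet> i))) (at x)" for j .
  have dh: "((\<lambda>x. h (set_coord i s x)) has_derivative
      (\<lambda>d. frechet_derivative h (at (set_coord i s x)) (d - (d \<bullet> i) *\<^sub>R i))) (at x)" for s
    unfolding set_coord_def by (rule has_derivative_C1_compose_affine[OF h bounded_linear_drop_coord])
  have "((\<lambda>x. \<Sum>j\<le>?n. h (set_coord i (?s j) x) * Bernstein ?n j (x \<bullet> i)) has_derivative
     (\<lambda>d. \<Sum>j\<le>?n. h (set_coord i (?s j) x) * (B' j * (d \<bullet> i))
        + frechet_derivative h (at (set_coord i (?s j) x)) (d - (d \<bullet> i) *\<^sub>R i) * Bernstein ?n j (x \<bullet> i))) (at x)"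
    by (intro has_derivative_sum has_derivative_mult dB dh)
  \<comment> \<open>With the coefficients frozen at \<open>x\<close>, the left side is the
    derivative of a one-variable Bernstein sum. Uniqueness of derivatives turns it into forward
    differences.\<close>
  moreover have "(\<Sum>j\<le>?n. h (set_coord i (?s j) x) * B' j)
     = (\<Sum>j\<le>m. real ?n * (h (set_coord i (?s (Suc j)) x) - h (set_coord i (?s j) x)) * Bernstein m j (x \<bullet> i))"
  proof (rule DERIV_unique)
    show "((\<lambda>t. \<Sum>j\<le>?n. h (set_coord i (?s j) x) * Bernstein ?n j t) has_real_derivative
       (\<Sum>j\<le>?n. h (set_coord i (?s j) x) * B' j)) (at (x \<bullet> i))"
      by (intro DERIV_sum DERIV_cmult B')
    show "((\<lambda>t. \<Sum>j\<le>?n. h (set_coord i (?s j) x) * Bernstein ?n j t) has_real_derivative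
       (\<Sum>j\<le>m. real ?n * (h (set_coord i (?s (Suc j)) x) - h (set_coord i (?s j) x)) * Bernstein m j (x \<bullet> i))) (at (x \<bullet> i))"
      by (rule DERIV_Bernstein_sum)
  qed
  moreover have "(\<Sum>j\<le>?n. h (set_coord i (?s j) x) * (B' j * (d \<bullet> i))
        + frechet_derivative h (at (set_coord i (?s j) x)) (d - (d \<bullet> i) *\<^sub>R i) * Bernstein ?n j (x \<bullet> i))
     = (\<Sum>j\<le>?n. frechet_derivative h (at (set_coord i (?s j) x)) (d - (d \<bullet> i) *\<^sub>R i) * Bernstein ?n j (x \<bullet> i))
       + (\<Sum>j\<le>?n. h (set_coord i (?s j) x) * B' j) * (d \<bullet> i)" for d
    unfolding sum.distrib sum_distrib_right mult.assoc by (rule add.commute)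
  ultimately show ?thesis
    unfolding Bernstein_op_def[abs_def] by (simp only:)
qed

text \<open>Since Bernstein weights sum to 1, the error is the average of \<open>f\<close> at the
  node minus \<open>f x\<close>. Mere continuity of \<open>f\<close> is assumed because the lemma is
  applied to partial derivatives as well.\<close>

lemma Bernstein_op_uniform:
  fixes f :: "'a::euclidean_space \<Rightarrow> real"
  assumes f: "continuous_on (cbox 0 One) f" and i: "i \<in> Basis" and e: "e > 0"
  shows "\<forall>\<^sub>F n in sequentially. \<forall>x\<in>cbox 0 One. \<bar>f x - Bernstein_op i n f x\<bar> \<le> e"
proof -
  obtain M where M: "M \<ge> 0" "\<And>x y. x \<in> cbox 0 One \<Longrightarrow> y \<in> cbox 0 One \<Longrightarrow> \<bar>f x - f y\<bar> \<le> e / 2 + M * (dist x y)\<^sup>2"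
    using uniform_quadratic_modulus[OF compact_cbox f, of "e / 2"] e by auto
  obtain N where N: "2 * M / e < real N" using reals_Archimedean2 by blast
  have "\<bar>f x - Bernstein_op i n f x\<bar> \<le> e" if n: "n \<ge> Suc N" and x: "x \<in> cbox 0 One" for n x
  proof -
    have t: "0 \<le> x \<bullet> i" "x \<bullet> i \<le> 1" using x i by (auto simp: mem_box)
    have "\<bar>\<Sum>j\<le>n. (f (set_coord i (real j / real n) x) - f x) * Bernstein n j (x \<bullet> i)\<bar> \<le> e / 2 + M / real n"
    proof (rule Bernstein_average_bound[OF t])
      fix j assume "j \<le> n"
      then have "set_coord i (real j / real n) x \<in> cbox 0 One"
        using n by (intro set_coord_in_cube i x) (auto simp: divide_le_eq)
      from M(2)[OF this x] show "\<bar>f (set_coord i (real j / real n) x) - f x\<bar> \<le> e / 2 + M * (real j / real n - x \<bullet> i)\<^sup>2"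
        by (simp add: dist_set_coord[OF i])
    qed (use n M in auto)
    also have "(\<Sum>j\<le>n. (f (set_coord i (real j / real n) x) - f x) * Bernstein n j (x \<bullet> i)) = Bernstein_op i n f x - f x"
      unfolding left_diff_distrib sum_subtractf sum_distrib_left[symmetric] sum_Bernstein by (simp add: Bernstein_op_def)
    finally have "\<bar>f x - Bernstein_op i n f x\<bar> \<le> e / 2 + M / real n" by (simp add: abs_minus_commute)
    moreover have "M / real n \<le> e / 2"
    proof -
      have "2 * M / e < real n" using N n by linarith
      then show ?thesis using e n by (simp add: field_simps)
    qed
    ultimately show ?thesis by linarith
  qed
  then show ?thesis unfolding eventually_sequentially by blast
qed

text \<open>By the mean value theorem the derivative of the operator along \<open>i\<close> is again a Bernstein average
  of the partial derivative, at nodes that differ from the grid points by at most \<open>1/m\<close>.\<close>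

lemma Bernstein_op_coord_derivative_uniform:
  fixes h :: "'a::euclidean_space \<Rightarrow> real"
  assumes h: "is_C1 h" and i: "i \<in> Basis" and e: "e > 0"
  shows "\<forall>\<^sub>F m in sequentially. \<forall>x\<in>cbox 0 One.
     \<bar>frechet_derivative h (at x) i - frechet_derivative (Bernstein_op i (Suc m) h) (at x) i\<bar> \<le> e"
proof -
  define f where "f x = frechet_derivative h (at x) i" for x
  have "continuous_on (cbox 0 One) f"
    unfolding f_def by (rule continuous_on_subset[OF is_C1_continuous_on_derivative[OF h]]) auto
  then obtain M where M: "M \<ge> 0" "\<And>x y. x \<in> cbox 0 One \<Longrightarrow> y \<in> cbox 0 One \<Longrightarrow> \<bar>f x - f y\<bar> \<le> e / 2 + M * (dist x y)\<^sup>2"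
    using uniform_quadratic_modulus[OF compact_cbox, of 0 One f "e / 2"] e by auto
  \<comment> \<open>The error exceeds \<open>e / 2\<close> by at most \<open>4 * M / m\<close>, half
    of which comes from shifting nodes and half from the variance.\<close>
  obtain N where N: "8 * M / e < real N" using reals_Archimedean2 by blast
  have "\<bar>f x - frechet_derivative (Bernstein_op i (Suc m) h) (at x) i\<bar> \<le> e" if m: "m \<ge> Suc N" and x: "x \<in> cbox 0 One" for m x
  proof -
    let ?n = "Suc m"
    have t: "0 \<le> x \<bullet> i" "x \<bullet> i \<le> 1" using x i by (auto simp: mem_box)
    have m0: "m > 0" using m by simp
    define H where "H s = h (set_coord i s x)" for s
    have dH: "(H has_real_derivative f (set_coord i s x)) (at s)" for s
      unfolding H_def[abs_def] f_def by (rule has_real_derivative_along_coord[OF h i])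
    have "frechet_derivative h (at y) 0 = 0" for y
      using has_derivative_bounded_linear[OF is_C1_has_derivative[OF h]] by (simp add: linear_0 bounded_linear.linear)
    then have D: "frechet_derivative (Bernstein_op i ?n h) (at x) i
      = (\<Sum>j\<le>m. real ?n * (H (real (Suc j) / real ?n) - H (real j / real ?n)) * Bernstein m j (x \<bullet> i))"
      unfolding frechet_derivative_eqI[OF Bernstein_op_derivative[OF h i]] using i by (simp add: H_def)
    have "\<bar>\<Sum>j\<le>m. (real ?n * (H (real (Suc j) / real ?n) - H (real j / real ?n)) - f x) * Bernstein m j (x \<bullet> i)\<bar>
      \<le> (e / 2 + 2 * M / real m) + 2 * M / real m"
    proof (rule Bernstein_average_bound[OF t m0])
      fix j assume j: "j \<le> m"
      have "real j / real ?n < real (Suc j) / real ?n" by (simp add: divide_strict_right_mono)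
      from MVT2[OF this dH] obtain \<xi> where \<xi>: "real j / real ?n < \<xi>" "\<xi> < real (Suc j) / real ?n"
        and eq: "H (real (Suc j) / real ?n) - H (real j / real ?n) = (real (Suc j) / real ?n - real j / real ?n) * f (set_coord i \<xi> x)"
        by blast
      have "real (Suc j) / real ?n - real j / real ?n = 1 / real ?n" by (simp add: diff_divide_distrib[symmetric])
      then have eq': "real ?n * (H (real (Suc j) / real ?n) - H (real j / real ?n)) = f (set_coord i \<xi> x)"
        unfolding eq by simp
      have \<xi>01: "0 \<le> \<xi>" "\<xi> \<le> 1"
      proof -
        have "0 \<le> real j / real ?n" by simp
        then show "0 \<le> \<xi>" using \<xi>(1) by linarith
        have "real (Suc j) / real ?n \<le> 1" using j by simp
        then show "\<xi> \<le> 1" using \<xi>(2) by linarith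
      qed
      \<comment> \<open>The operator samples at multiples of \<open>1 / (m + 1)\<close>, whereas the
        differentiated sum is an average of degree \<open>m\<close> with nodes \<open>j / m\<close>.
        Both \<open>\<xi>\<close> and \<open>j / m\<close> lie between \<open>j / (m + 1)\<close>
        and \<open>(j + 1) / (m + 1)\<close>.\<close>
      have near: "\<bar>\<xi> - real j / real m\<bar> \<le> 1 / real m"
      proof -
        have "real j / real ?n \<le> real j / real m" using m0 by (intro divide_left_mono) auto
        moreover have "real j / real m \<le> real (Suc j) / real ?n"
          using m0 j by (simp add: field_simps)
        moreover have "real (Suc j) / real ?n - real j / real ?n \<le> 1 / real m"
          using m0 by (simp add: diff_divide_distrib[symmetric] frac_le)
        ultimately show ?thesis using \<xi> by linarith
      qed
      have sq: "(\<xi> - x \<bullet> i)\<^sup>2 \<le> 2 / real m + 2 * (real j / real m - x \<bullet> i)\<^sup>2"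
      proof -
        have "(\<xi> - x \<bullet> i)\<^sup>2 \<le> 2 * (\<xi> - real j / real m)\<^sup>2 + 2 * (real j / real m - x \<bullet> i)\<^sup>2"
        proof -
          have "(a + b)\<^sup>2 \<le> 2 * a\<^sup>2 + 2 * b\<^sup>2" for a b :: real
            using sum_squares_bound[of a b] by (simp add: power2_sum)
          from this[of "\<xi> - real j / real m" "real j / real m - x \<bullet> i"] show ?thesis by simp
        qed
        moreover have "(\<xi> - real j / real m)\<^sup>2 \<le> 1 / real m"
        proof -
          have "\<bar>\<xi> - real j / real m\<bar>\<^sup>2 \<le> (1 / real m)\<^sup>2" using near by (intro power_mono) auto
          also have "\<dots> \<le> 1 / real m" using m0 by (simp add: power2_eq_square divide_le_eq field_simps)
          finally show ?thesis by simp
        qed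
        ultimately show ?thesis by simp
      qed
      have "\<bar>f (set_coord i \<xi> x) - f x\<bar> \<le> e / 2 + M * (\<xi> - x \<bullet> i)\<^sup>2"
        using M(2)[OF set_coord_in_cube[OF i x \<xi>01] x] by (simp add: dist_set_coord[OF i])
      also have "\<dots> \<le> e / 2 + M * (2 / real m + 2 * (real j / real m - x \<bullet> i)\<^sup>2)"
        by (intro add_left_mono mult_left_mono sq M)
      finally show "\<bar>real ?n * (H (real (Suc j) / real ?n) - H (real j / real ?n)) - f x\<bar>
         \<le> (e / 2 + 2 * M / real m) + 2 * M * (real j / real m - x \<bullet> i)\<^sup>2"
        unfolding eq' by (simp add: algebra_simps)
    qed (use M in auto)
    also have "(\<Sum>j\<le>m. (real ?n * (H (real (Suc j) / real ?n) - H (real j / real ?n)) - f x) * Bernstein m j (x \<bullet> i))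
       = frechet_derivative (Bernstein_op i ?n h) (at x) i - f x"
      unfolding left_diff_distrib sum_subtractf sum_distrib_left[symmetric] sum_Bernstein D[unfolded left_diff_distrib] by simp
    finally have "\<bar>f x - frechet_derivative (Bernstein_op i ?n h) (at x) i\<bar> \<le> e / 2 + 4 * M / real m"
      by (simp add: abs_minus_commute)
    moreover have "4 * M / real m \<le> e / 2"
    proof -
      have "8 * M / e < real m" using N m by linarith
      then show ?thesis using e m0 by (simp add: field_simps)
    qed
    ultimately show ?thesis by linarith
  qed
  then show ?thesis unfolding eventually_sequentially f_def by blast
qed

text \<open>In directions other than \<open>i\<close>, differentiation commutes with the operator,
  so \<open>Bernstein_op_uniform\<close> applies to the partial derivative; direction
  \<open>i\<close> is the separate lemma. Finiteness of the basis gives one degree for all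
  directions.\<close>

lemma Bernstein_op_C1_close:
  fixes h :: "'a::euclidean_space \<Rightarrow> real"
  assumes h: "is_C1 h" and i: "i \<in> Basis" and e: "e > 0"
  shows "\<exists>n. C1_close (cbox 0 One) e h (Bernstein_op i n h)"
proof -
  have 1: "\<forall>\<^sub>F m in sequentially. \<forall>x\<in>cbox 0 One. \<bar>h x - Bernstein_op i (Suc m) h x\<bar> \<le> e"
    using Bernstein_op_uniform[OF is_C1_continuous_on[OF h] i e]
    by (rule eventually_sequentially_Suc[THEN iffD2])
  have 2: "\<forall>\<^sub>F m in sequentially. \<forall>x\<in>cbox 0 One.
     \<bar>frechet_derivative h (at x) b - frechet_derivative (Bernstein_op i (Suc m) h) (at x) b\<bar> \<le> e" if b: "b \<in> Basis" for b
  proof (cases "b = i")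
    case True
    then show ?thesis using Bernstein_op_coord_derivative_uniform[OF h i e] by simp
  next
    case False
    have "b \<bullet> i = 0" using False b i by (simp add: inner_Basis)
    then have "frechet_derivative (Bernstein_op i (Suc m) h) (at x) b = Bernstein_op i (Suc m) (\<lambda>x. frechet_derivative h (at x) b) x" for m x
      unfolding frechet_derivative_eqI[OF Bernstein_op_derivative[OF h i]] by (simp add: Bernstein_op_def)
    moreover have "\<forall>\<^sub>F n in sequentially. \<forall>x\<in>cbox 0 One. \<bar>frechet_derivative h (at x) b - Bernstein_op i n (\<lambda>x. frechet_derivative h (at x) b) x\<bar> \<le> e"
      by (rule Bernstein_op_uniform[OF continuous_on_subset[OF is_C1_continuous_on_derivative[OF h]] i e]) auto
    ultimately show ?thesis by (simp add: eventually_sequentially_Suc[of "\<lambda>n. \<forall>x\<in>cbox 0 One. \<bar>frechet_derivative h (at x) b - Bernstein_op i n (\<lambda>x. frechet_derivative h (at x) b) x\<bar> \<le> e"])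
  qed
  have "\<forall>\<^sub>F m in sequentially. \<forall>b\<in>Basis. \<forall>x\<in>cbox 0 One.
     \<bar>frechet_derivative h (at x) b - frechet_derivative (Bernstein_op i (Suc m) h) (at x) b\<bar> \<le> e"
    by (rule eventually_ball_finite) (use 2 in auto)
  with 1 have "\<forall>\<^sub>F m in sequentially. C1_close (cbox 0 One) e h (Bernstein_op i (Suc m) h)"
    by eventually_elim (auto simp: C1_close_def)
  then show ?thesis by (auto simp: eventually_sequentially)
qed

text \<open>Induction on the set \<open>S\<close> of coordinates on which the function depends.
  Applying the operator along \<open>i\<close> leaves functions that no longer depend on
  \<open>i\<close>, to which the induction hypothesis applies, multiplied by polynomials.\<close>

lemma C1_approx_unit_cube:
  fixes v :: "'a::euclidean_space \<Rightarrow> real"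
  assumes "is_C1 v"
  shows "C1_approx (cbox 0 One) v"
proof -
  \<comment> \<open>Projection onto the span of \<open>S\<close>; \<open>h x = h (P S x)\<close>
    says that \<open>h\<close> depends only on the coordinates in \<open>S\<close>.\<close>
  define P :: "'a set \<Rightarrow> 'a \<Rightarrow> 'a" where "P S x = (\<Sum>b\<in>S. (x \<bullet> b) *\<^sub>R b)" for S x
  have "C1_approx (cbox 0 One) h" if "S \<subseteq> Basis" "is_C1 h" "\<And>x. h x = h (P S x)" for S h
    using finite_subset[OF that(1) finite_Basis] that
  proof (induction S arbitrary: h rule: finite_induct)
    case empty
    then have "h = (\<lambda>x. h 0)" by (auto simp: P_def)
    then show ?case by (metis C1_approx_polynomial real_polynomial_function.intros(2))
  next
    case (insert i S)
    have i: "i \<in> Basis" and S: "S \<subseteq> Basis" using insert by auto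
    \<comment> \<open>Coordinate \<open>i\<close> is overwritten by \<open>s\<close>, so discarding
      it beforehand changes nothing.\<close>
    have PP: "P (insert i S) (set_coord i s (P S x)) = P (insert i S) (set_coord i s x)" for s x
    proof -
      have "set_coord i s (P S x) \<bullet> b = set_coord i s x \<bullet> b" if "b \<in> insert i S" for b
      proof -
        have b: "b \<in> Basis" using that S i by auto
        have "P S x \<bullet> b = x \<bullet> b" if "b \<in> S"
        proof -
          have "P S x \<bullet> b = (\<Sum>c\<in>S. (x \<bullet> c) * (if c = b then 1 else 0))"
            unfolding P_def inner_sum_left inner_scaleR_left
            using S b by (intro sum.cong) (auto simp: inner_Basis)
          then show ?thesis using that insert.hyps by (simp add: if_distrib cong: if_cong)
        qed
        then show ?thesis using that by (auto simp: set_coord_inner[OF i b])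
      qed
      then show ?thesis unfolding P_def by (intro sum.cong) auto
    qed
    show ?case
    proof (rule C1_approx_limit)
      fix e :: real assume "e > 0"
      then obtain n where n: "C1_close (cbox 0 One) e h (Bernstein_op i n h)"
        using Bernstein_op_C1_close[OF insert.prems(2) i] by blast
      have "C1_approx (cbox 0 One) (Bernstein_op i n h)"
        unfolding Bernstein_op_def[abs_def]
      proof (intro C1_approx_sum conjI)
        fix j
        have C1: "is_C1 (\<lambda>x. h (set_coord i (real j / real n) x))"
          by (rule is_C1_compose_set_coord[OF insert.prems(2)])
        then show "is_C1 (\<lambda>x. h (set_coord i (real j / real n) x) * Bernstein n j (x \<bullet> i))"
          by (rule is_C1_mult[OF _ is_C1_real_polynomial_function[OF real_polynomial_function_Bernstein]])
        have "h (set_coord i (real j / real n) x) = h (set_coord i (real j / real n) (P S x))" for x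
          by (metis PP insert.prems(3))
        then have "C1_approx (cbox 0 One) (\<lambda>x. h (set_coord i (real j / real n) x))"
          using insert.IH[OF S C1] by blast
        then show "C1_approx (cbox 0 One) (\<lambda>x. h (set_coord i (real j / real n) x) * Bernstein n j (x \<bullet> i))"
          by (intro C1_approx_mult_polynomial C1 real_polynomial_function_Bernstein compact_cbox)
      qed
      then show "\<exists>w. C1_approx (cbox 0 One) w \<and> C1_close (cbox 0 One) e h w" using n by blast
    qed
  qed
  from this[of Basis v] show ?thesis
    using assms by (simp add: P_def euclidean_representation)
qed

lemma C1_polynomial_approximation:
  fixes v :: "'a::euclidean_space \<Rightarrow> real"
  assumes v: "is_C1 v" and K: "bounded K"
  shows "C1_approx K v"
  unfolding C1_approx_def
proof (intro allI impI)
  fix e :: real assume e: "e > 0"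
  obtain c0 where c0: "\<And>x. x \<in> K \<Longrightarrow> norm x \<le> c0" using K unfolding bounded_iff by blast
  \<comment> \<open>\<open>K\<close> lies in the cube \<open>[-c,c]\<close>, the image of the unit
    cube under \<open>y \<mapsto> - a + 2c y\<close>. The scaling \<open>2c\<close> is at least 1,
    so returning to \<open>K\<close> does not enlarge the error of the derivative.\<close>
  define c where "c = \<bar>c0\<bar> + 1"
  have cK: "norm x \<le> c" if "x \<in> K" for x
    using c0[OF that] by (auto simp: c_def)
  have c: "c \<ge> 1" "c > 0" by (auto simp: c_def)
  define a :: 'a where "a = c *\<^sub>R One"
  have lin: "bounded_linear (\<lambda>x::'a. k *\<^sub>R x)" for k by (intro bounded_linear_intros)
  have v': "is_C1 (\<lambda>y. v (- a + (2 * c) *\<^sub>R y))" by (rule is_C1_compose_affine[OF v lin])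
  then obtain q where q: "real_polynomial_function q" "C1_close (cbox 0 One) e (\<lambda>y. v (- a + (2 * c) *\<^sub>R y)) q"
    using C1_approx_unit_cube[OF v'] e unfolding C1_approx_def by blast
  define y where "y x = (1 / (2 * c)) *\<^sub>R a + (1 / (2 * c)) *\<^sub>R x" for x :: 'a
  have yinv: "- a + (2 * c) *\<^sub>R y x = x" for x using c by (simp add: y_def scaleR_add_right)
  have lin_fd: "linear (frechet_derivative w (at x))" if "is_C1 w" for w :: "'a \<Rightarrow> real" and x
    using has_derivative_bounded_linear[OF is_C1_has_derivative[OF that]] bounded_linear.linear by blast
  have q1: "is_C1 q" by (rule is_C1_real_polynomial_function[OF q(1)])
  have dv: "frechet_derivative (\<lambda>y. v (- a + (2 * c) *\<^sub>R y)) (at (y x)) b = (2 * c) * frechet_derivative v (at x) b" for x b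
    unfolding frechet_derivative_eqI[OF has_derivative_C1_compose_affine[OF v lin]] yinv
    by (simp add: linear_scale[OF lin_fd[OF v]])
  have dq: "frechet_derivative (\<lambda>x. q (y x)) (at x) b = (1 / (2 * c)) * frechet_derivative q (at (y x)) b" for x b
    unfolding y_def frechet_derivative_eqI[OF has_derivative_C1_compose_affine[OF q1 lin]]
    by (simp add: linear_scale[OF lin_fd[OF q1]])
  have yK: "y x \<in> cbox 0 One" if "x \<in> K" for x
  proof -
    have "\<bar>x \<bullet> b\<bar> \<le> c" if "b \<in> Basis" for b
      using Basis_le_norm[OF that, of x] cK[OF \<open>x \<in> K\<close>] by linarith
    then have "0 \<le> c + x \<bullet> b \<and> c + x \<bullet> b \<le> 2 * c" if "b \<in> Basis" for b
      using that by (smt (verit))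
    then show ?thesis using c by (auto simp: mem_box y_def a_def inner_simps field_simps)
  qed
  have "C1_close K e v (\<lambda>x. q (y x))"
    unfolding C1_close_def
  proof (intro ballI conjI)
    fix x assume x: "x \<in> K"
    show "\<bar>v x - q (y x)\<bar> \<le> e"
      using q(2) yK[OF x] unfolding C1_close_def by (metis yinv)
    fix b :: 'a assume b: "b \<in> Basis"
    have "\<bar>(2 * c) * frechet_derivative v (at x) b - frechet_derivative q (at (y x)) b\<bar> \<le> e"
      using q(2) yK[OF x] b unfolding C1_close_def by (metis dv)
    then have "\<bar>(2 * c) * (frechet_derivative v (at x) b - frechet_derivative (\<lambda>x. q (y x)) (at x) b)\<bar> \<le> e"
      using c by (simp add: dq right_diff_distrib)
    moreover have "1 * \<bar>frechet_derivative v (at x) b - frechet_derivative (\<lambda>x. q (y x)) (at x) b\<bar>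
      \<le> (2 * c) * \<bar>frechet_derivative v (at x) b - frechet_derivative (\<lambda>x. q (y x)) (at x) b\<bar>"
      using c by (intro mult_right_mono) auto
    ultimately show "\<bar>frechet_derivative v (at x) b - frechet_derivative (\<lambda>x. q (y x)) (at x) b\<bar> \<le> e"
      using c by (simp add: abs_mult)
  qed
  moreover have "real_polynomial_function (\<lambda>x. q (y x))"
  proof -
    have "polynomial_function y"
      unfolding y_def by (intro polynomial_function_add polynomial_function_const polynomial_function_bounded_linear lin)
    from real_polynomial_function_compose[OF this q(1)] show ?thesis by (simp add: o_def)
  qed
  ultimately show "\<exists>q. real_polynomial_function q \<and> C1_close K e v q" by blast
qed

subsection \<open>Moment sequences and localizing matrices\<close>

definition mpoly_of :: "'v rpoly \<Rightarrow> 'v mpoly" where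
  "mpoly_of P = Poly_Mapping.Abs_poly_mapping P"

lemma lookup_mpoly_of: "is_poly P \<Longrightarrow> Poly_Mapping.lookup (mpoly_of P) = P"
  by (simp add: mpoly_of_def is_poly_def)

lemma keys_mpoly_of: "is_poly P \<Longrightarrow> Poly_Mapping.keys (mpoly_of P) = {\<alpha>. P \<alpha> \<noteq> 0}"
  by (auto simp: in_keys_iff lookup_mpoly_of)

lemma peval_eq_meval: "is_poly P \<Longrightarrow> peval P x = meval x (mpoly_of P)"
  by (simp add: peval_def meval_def monom_eval_def lookup_mpoly_of keys_mpoly_of)

definition moment_functional :: "('v expo \<Rightarrow> real) \<Rightarrow> 'v mpoly \<Rightarrow> real" where
  "moment_functional z p = (\<Sum>\<alpha>\<in>Poly_Mapping.keys p. Poly_Mapping.lookup p \<alpha> * z \<alpha>)"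

lemma lz_eq_moment_functional: "is_poly P \<Longrightarrow> lz z P = moment_functional z (mpoly_of P)"
  by (simp add: lz_def moment_functional_def lookup_mpoly_of keys_mpoly_of)

lemma moment_functional_single: "moment_functional z (Poly_Mapping.single \<alpha> c) = c * z \<alpha>"
  by (cases "c = 0") (auto simp: moment_functional_def)

interpretation moment_functional: mpoly_functional "moment_functional (z :: ('v::finite) expo \<Rightarrow> real)" for z
proof
  show add: "moment_functional z (p + q) = moment_functional z p + moment_functional z q" for p q :: "'v mpoly"
    unfolding moment_functional_def by (rule sum_keys_add)
  show "moment_functional z (mconst c * p) = c * moment_functional z p" for c and p :: "'v mpoly"
    by (induction p rule: poly_mapping_single_add_induct)
      (simp_all add: mconst_def mult_single moment_functional_single distrib_left add)
qed

text \<open>Together with \<open>is_polyI\<close> this transfers a coefficient function to the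
  polynomial ring: a ring element with these coefficients yields both finite support and the value
  of \<open>mpoly_of\<close>.\<close>

lemma mpoly_of_eqI: "Poly_Mapping.lookup p = P \<Longrightarrow> mpoly_of P = p"
  unfolding mpoly_of_def by (metis lookup_inverse)

lemma is_polyI: "Poly_Mapping.lookup p = P \<Longrightarrow> is_poly P"
  unfolding is_poly_def by (metis finite_lookup)

lemma lookup_pmonom: "Poly_Mapping.lookup (Poly_Mapping.single \<beta> c) = pmonom c \<beta>"
  by (auto simp: pmonom_def fun_eq_iff lookup_single when_def)

lemma lookup_pconst: "Poly_Mapping.lookup (mconst c) = pconst c"
  by (auto simp: pconst_def mconst_def fun_eq_iff lookup_single when_def zero_fun_def)

lemma lookup_pmult:
  assumes "is_poly P" "is_poly Q"
  shows "Poly_Mapping.lookup (mpoly_of P * mpoly_of Q) = pmult P Q"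
proof
  fix k
  let ?A = "{(a, b). P a \<noteq> 0 \<and> Q b \<noteq> 0 \<and> (\<lambda>i. a i + b i) = k}"
  have fin: "finite {a. P a \<noteq> 0}" "finite {b. Q b \<noteq> 0}" using assms by (auto simp: is_poly_def)
  have finA: "finite ?A"
    by (rule finite_subset[OF _ finite_cartesian_product[OF fin]]) auto
  have "Poly_Mapping.lookup (mpoly_of P * mpoly_of Q) k = prod_fun P Q k"
    by (simp add: lookup_mult prod_fun_def lookup_mpoly_of assms)
  also have "\<dots> = (\<Sum>(a, b). P a * Q b when k = a + b)"
    by (rule prod_fun_unfold_prod[OF fin])
  also have "\<dots> = (\<Sum>(a, b)\<in>?A. P a * Q b when k = a + b)"
    by (rule Sum_any.expand_superset[OF finA]) (auto simp: plus_fun_def)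
  also have "\<dots> = (\<Sum>(a, b)\<in>?A. P a * Q b)"
    by (rule sum.cong) (auto simp: plus_fun_def)
  finally show "Poly_Mapping.lookup (mpoly_of P * mpoly_of Q) k = pmult P Q k"
    by (simp add: pmult_def)
qed

lemma lookup_ball_poly:
  "Poly_Mapping.lookup (mconst r - (\<Sum>i\<in>UNIV. (mvar i)\<^sup>2)) = (ball_poly r :: 'v::finite rpoly)"
proof
  fix \<alpha> :: "'v \<Rightarrow> nat"
  show "Poly_Mapping.lookup (mconst r - (\<Sum>i\<in>UNIV. (mvar i)\<^sup>2)) \<alpha> = ball_poly r \<alpha>"
    unfolding ball_poly_def lookup_minus lookup_sum lookup_pconst mvar_power lookup_pmonom
    by (simp add: pconst_def pmonom_def)
qed

lemma finite_mdeg_le: "finite {\<alpha> :: 'v::finite expo. mdeg \<alpha> \<le> d}"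
proof (rule finite_subset)
  show "{\<alpha> :: 'v expo. mdeg \<alpha> \<le> d} \<subseteq> PiE UNIV (\<lambda>_. {..d})"
  proof
    fix \<alpha> :: "'v expo" assume "\<alpha> \<in> {\<alpha>. mdeg \<alpha> \<le> d}"
    moreover have "\<alpha> i \<le> mdeg \<alpha>" for i unfolding mdeg_def by (rule member_le_sum) auto
    ultimately show "\<alpha> \<in> PiE UNIV (\<lambda>_. {..d})" by (auto intro: order.trans)
  qed
qed (auto intro: finite_PiE)

text \<open>The quadratic form of the localizing matrix at a vector \<open>c\<close> is the
  functional at \<open>g q^2\<close>, where \<open>q\<close> is the polynomial with coefficients
  \<open>c\<close>.\<close>

lemma localizing_form_eq:
  fixes g :: "'v::finite rpoly"
  assumes "is_poly g" "finite I"
  shows "(\<Sum>\<alpha>\<in>I. \<Sum>\<beta>\<in>I. c \<alpha> * locmat g z \<alpha> \<beta> * c \<beta>)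
    = moment_functional z (mpoly_of g * (\<Sum>\<alpha>\<in>I. Poly_Mapping.single \<alpha> (c \<alpha>))\<^sup>2)"
proof -
  have loc: "locmat g z \<alpha> \<beta> = moment_functional z (mpoly_of g * mmono (\<alpha> + \<beta>))" for \<alpha> \<beta>
  proof -
    have pl: "(\<lambda>i. \<alpha> i + \<beta> i) = \<alpha> + \<beta>" by (simp add: fun_eq_iff)
    have m: "is_poly (pmonom 1 (\<alpha> + \<beta>))" "mpoly_of (pmonom 1 (\<alpha> + \<beta>)) = mmono (\<alpha> + \<beta>)"
      by (rule is_polyI[OF lookup_pmonom], rule mpoly_of_eqI[OF lookup_pmonom])
    have "locmat g z \<alpha> \<beta> = moment_functional z (mpoly_of (pmult g (pmonom 1 (\<alpha> + \<beta>))))"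
      unfolding locmat_def pl
      by (rule lz_eq_moment_functional[OF is_polyI[OF lookup_pmult[OF assms(1) m(1)]]])
    then show ?thesis
      by (simp only: mpoly_of_eqI[OF lookup_pmult[OF assms(1) m(1)]] m(2))
  qed
  have "c \<alpha> * locmat g z \<alpha> \<beta> * c \<beta>
     = moment_functional z (mpoly_of g * (Poly_Mapping.single \<alpha> (c \<alpha>) * Poly_Mapping.single \<beta> (c \<beta>)))" for \<alpha> \<beta>
  proof -
    have "mpoly_of g * (Poly_Mapping.single \<alpha> (c \<alpha>) * Poly_Mapping.single \<beta> (c \<beta>))
      = mconst (c \<alpha> * c \<beta>) * (mpoly_of g * mmono (\<alpha> + \<beta>))"
    proof -
      have "Poly_Mapping.single \<alpha> (c \<alpha>) * Poly_Mapping.single \<beta> (c \<beta>) = mconst (c \<alpha> * c \<beta>) * mmono (\<alpha> + \<beta>)"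
        by (simp add: mconst_def mult_single)
      then show ?thesis by (simp only: mult.left_commute)
    qed
    then show ?thesis by (simp only: moment_functional.L_scale loc) (simp only: mult.assoc mult.commute[of _ "c \<beta>"])
  qed
  moreover have "mpoly_of g * (\<Sum>\<alpha>\<in>I. Poly_Mapping.single \<alpha> (c \<alpha>))\<^sup>2
     = (\<Sum>\<alpha>\<in>I. \<Sum>\<beta>\<in>I. mpoly_of g * (Poly_Mapping.single \<alpha> (c \<alpha>) * Poly_Mapping.single \<beta> (c \<beta>)))"
    unfolding power2_eq_square sum_product by (simp only: sum_distrib_left)
  ultimately show ?thesis
    by (simp only: moment_functional.L_sum)
qed

lemma poly_mapping_sum_single:
  assumes "Poly_Mapping.keys q \<subseteq> I" "finite I"
  shows "(\<Sum>\<alpha>\<in>I. Poly_Mapping.single \<alpha> (Poly_Mapping.lookup q \<alpha>)) = q"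
proof (rule poly_mapping_eqI)
  fix k
  have "Poly_Mapping.lookup (\<Sum>\<alpha>\<in>I. Poly_Mapping.single \<alpha> (Poly_Mapping.lookup q \<alpha>)) k
     = (\<Sum>\<alpha>\<in>I. if \<alpha> = k then Poly_Mapping.lookup q \<alpha> else 0)"
    by (auto simp: lookup_sum lookup_single when_def intro!: sum.cong)
  also have "\<dots> = Poly_Mapping.lookup q k"
    using assms by (auto simp: in_keys_iff)
  finally show "Poly_Mapping.lookup (\<Sum>\<alpha>\<in>I. Poly_Mapping.single \<alpha> (Poly_Mapping.lookup q \<alpha>)) k = Poly_Mapping.lookup q k" .
qed

lemma loc_psd_iff_square_nonneg:
  fixes g :: "'v::finite rpoly"
  assumes "is_poly g"
  shows "(\<forall>d. loc_psd d g z) \<longleftrightarrow> moment_functional.square_nonneg z (mpoly_of g)"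
proof
  assume "moment_functional.square_nonneg z (mpoly_of g)"
  then show "\<forall>d. loc_psd d g z"
    unfolding loc_psd_def psd_on_def localizing_form_eq[OF assms finite_mdeg_le] moment_functional.square_nonneg_def by blast
next
  assume psd: "\<forall>d. loc_psd d g z"
  show "moment_functional.square_nonneg z (mpoly_of g)"
    unfolding moment_functional.square_nonneg_def
  proof
    fix q :: "'v mpoly"
    \<comment> \<open>Every \<open>q\<close> is captured by some finite order;
      \<open>insert 0\<close> keeps the maximum defined for \<open>q = 0\<close>.\<close>
    let ?I = "{\<alpha> :: 'v expo. mdeg \<alpha> \<le> Max (insert 0 (mdeg ` Poly_Mapping.keys q))}"
    have "Poly_Mapping.keys q \<subseteq> ?I" by (auto intro: Max_ge)
    then have "(\<Sum>\<alpha>\<in>?I. Poly_Mapping.single \<alpha> (Poly_Mapping.lookup q \<alpha>)) = q"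
      by (rule poly_mapping_sum_single[OF _ finite_mdeg_le])
    then show "0 \<le> moment_functional z (mpoly_of g * q\<^sup>2)"
      using psd unfolding loc_psd_def psd_on_def localizing_form_eq[OF assms finite_mdeg_le] by metis
  qed
qed

lemma deg_le_mono: "deg_le P k \<Longrightarrow> k \<le> m \<Longrightarrow> deg_le P m"
  by (auto simp: deg_le_def)

text \<open>Here the condition that the order is at least \<open>d_0\<close> enters: the truncated
  cost sum loses no monomial of the cost.\<close>

lemma sum_mdeg_eq_lz:
  fixes P :: "'v::finite rpoly"
  assumes "deg_le P k"
  shows "(\<Sum>\<beta>\<in>{\<beta>. mdeg \<beta> \<le> k}. P \<beta> * z \<beta>) = lz z P"
  unfolding lz_def using assms
  by (intro sum.mono_neutral_right finite_mdeg_le) (auto simp: deg_le_def)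

text \<open>The smaller matrix is a principal submatrix; test vectors are extended by 0.\<close>

lemma loc_psd_mono:
  fixes g :: "'v::finite rpoly"
  assumes "loc_psd d g z" "d' \<le> d"
  shows "loc_psd d' g z"
  unfolding loc_psd_def psd_on_def
proof
  fix c :: "'v expo \<Rightarrow> real"
  let ?c = "\<lambda>\<alpha>. if mdeg \<alpha> \<le> d' then c \<alpha> else 0"
  let ?I = "\<lambda>d. {\<alpha> :: 'v expo. mdeg \<alpha> \<le> d}"
  have sub: "?I d' \<subseteq> ?I d" using assms(2) by auto
  have "0 \<le> (\<Sum>\<alpha>\<in>?I d. \<Sum>\<beta>\<in>?I d. ?c \<alpha> * locmat g z \<alpha> \<beta> * ?c \<beta>)"
    using assms(1) unfolding loc_psd_def psd_on_def by (rule allE)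
  also have "\<dots> = (\<Sum>\<alpha>\<in>?I d'. \<Sum>\<beta>\<in>?I d. ?c \<alpha> * locmat g z \<alpha> \<beta> * ?c \<beta>)"
    by (rule sum.mono_neutral_right[OF finite_mdeg_le sub]) auto
  also have "\<dots> = (\<Sum>\<alpha>\<in>?I d'. \<Sum>\<beta>\<in>?I d'. ?c \<alpha> * locmat g z \<alpha> \<beta> * ?c \<beta>)"
    by (rule sum.cong[OF refl], rule sum.mono_neutral_right[OF finite_mdeg_le sub]) auto
  also have "\<dots> = (\<Sum>\<alpha>\<in>?I d'. \<Sum>\<beta>\<in>?I d'. c \<alpha> * locmat g z \<alpha> \<beta> * c \<beta>)"
    by (intro sum.cong) auto
  finally show "0 \<le> \<dots>" .
qed

lemma is_poly_homog: "is_poly h \<Longrightarrow> is_poly (homog p h)"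
proof -
  assume h: "is_poly h"
  have "{\<gamma>. homog p h \<gamma> \<noteq> 0} \<subseteq> hexp p ` {\<beta>. h \<beta> \<noteq> 0}"
  proof
    fix \<gamma> assume "\<gamma> \<in> {\<gamma>. homog p h \<gamma> \<noteq> 0}"
    then have "{\<beta>. h \<beta> \<noteq> 0 \<and> hexp p \<beta> = \<gamma>} \<noteq> {}" unfolding homog_def by force
    then show "\<gamma> \<in> hexp p ` {\<beta>. h \<beta> \<noteq> 0}" by auto
  qed
  then show ?thesis using h unfolding is_poly_def by (meson finite_imageI finite_subset)
qed

lemma is_poly_imp_deg_le: "is_poly P \<Longrightarrow> \<exists>k. deg_le P k"
  unfolding is_poly_def deg_le_def using Max_ge[of "mdeg ` {\<alpha>. P \<alpha> \<noteq> 0}"] by blast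

lemma deg_le_dzero:
  assumes l: "is_poly l" and f: "\<forall>j. is_poly (f j)" and g: "\<forall>i\<le>nG. is_poly (g i)"
    and d: "dzero p l f nG g \<le> d"
  shows "deg_le (homog p l) (2 * d)"
proof -
  obtain kl where kl: "deg_le (homog p l) kl" using is_poly_imp_deg_le[OF is_poly_homog[OF l]] by blast
  have "\<forall>j. \<exists>k. deg_le (homog p (f j)) k" using f is_poly_imp_deg_le is_poly_homog by blast
  then obtain kf where kf: "\<And>j. deg_le (homog p (f j)) (kf j)" by metis
  have "\<forall>i. \<exists>k. i \<le> nG \<longrightarrow> deg_le (g i) k" using g is_poly_imp_deg_le by blast
  then obtain kg where kg: "\<And>i. i \<le> nG \<Longrightarrow> deg_le (g i) (kg i)" by metis
  \<comment> \<open>A crude common degree bound, showing that the least number in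
    \<open>dzero\<close> is taken over a nonempty set.\<close>
  define D where "D = kl + (\<Sum>j\<in>UNIV. kf j) + (\<Sum>i\<le>nG. kg i)"
  have "deg_le (homog p l) (2 * D)" by (rule deg_le_mono[OF kl]) (simp add: D_def)
  moreover have "deg_le (homog p (f j)) (2 * D)" for j
    using member_le_sum[of j UNIV kf] by (intro deg_le_mono[OF kf]) (simp add: D_def)
  moreover have "deg_le (g i) (2 * D)" if "i \<le> nG" for i
    using member_le_sum[of i "{..nG}" kg] that by (intro deg_le_mono[OF kg]) (auto simp: D_def)
  ultimately have "\<exists>d. deg_le (homog p l) (2*d) \<and> (\<forall>j. deg_le (homog p (f j)) (2*d)) \<and> (\<forall>i\<le>nG. deg_le (g i) (2*d))"
    by blast
  from LeastI_ex[OF this] have "deg_le (homog p l) (2 * dzero p l f nG g)" unfolding dzero_def by blast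
  then show ?thesis using d by (auto intro: deg_le_mono)
qed

subsection \<open>The dynamics constraint\<close>

lemma prod_UNIV_sum: "(\<Prod>v\<in>UNIV. h v) = (\<Prod>a\<in>UNIV. h (Inl a)) * (\<Prod>b\<in>UNIV. h (Inr b))"
  for h :: "'a::finite + 'b::finite \<Rightarrow> 'c::comm_monoid_mult"
  using prod.Plus[of "UNIV :: 'a set" "UNIV :: 'b set" h] by (simp add: UNIV_Plus_UNIV o_def)

lemma vmon_eq_prod:
  "vmon \<alpha> t y = (\<Prod>v\<in>UNIV. (case v of Inl _ \<Rightarrow> t | Inr j \<Rightarrow> y $ j) ^ \<alpha> v)"
  by (simp add: prod_UNIV_sum vmon_def UNIV_unit)

lemma meval_tyemb:
  fixes x :: "real^(('n::finite,'m::finite) var)"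
  shows "meval x (Poly_Mapping.single (tyemb \<alpha>) c) = c * vmon \<alpha> (tc x) (yc x)"
  by (simp add: prod_UNIV_sum vmon_def tyemb_def tc_def yc_def UNIV_unit)

lemma meval_w0exp:
  fixes x :: "real^(('n::finite,'m::finite) var)"
  shows "meval x (Poly_Mapping.single (w0exp p) c) = c * w0c x ^ p"
  by (simp add: prod_UNIV_sum w0exp_def w0c_def UNIV_unit)

lemma dyn_poly_mpoly:
  fixes f :: "'n::finite \<Rightarrow> (('n,'m::finite) ovar) rpoly"
  assumes f: "\<forall>j. is_poly (f j)"
  shows "is_poly (dyn_poly p f \<alpha>)" and "mpoly_of (dyn_poly p f \<alpha>) =
    Poly_Mapping.single (tyemb (\<alpha>(Inl () := \<alpha> (Inl ()) - 1))) (real (\<alpha> (Inl ()))) * mmono (w0exp p)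
    + (\<Sum>j\<in>UNIV. Poly_Mapping.single (tyemb (\<alpha>(Inr j := \<alpha> (Inr j) - 1))) (real (\<alpha> (Inr j))) * mpoly_of (homog p (f j)))"
    (is "_ = ?R")
proof -
  have "Poly_Mapping.lookup ?R = dyn_poly p f \<alpha>"
  proof
    fix \<gamma>
    have m: "Poly_Mapping.single (tyemb (\<alpha>(Inr j := \<alpha> (Inr j) - 1))) (real (\<alpha> (Inr j))) * mpoly_of (homog p (f j))
      = mpoly_of (pmonom (real (\<alpha> (Inr j))) (tyemb (\<alpha>(Inr j := \<alpha> (Inr j) - 1)))) * mpoly_of (homog p (f j))" for j
      by (simp only: mpoly_of_eqI[OF lookup_pmonom])
    have w: "Poly_Mapping.single (tyemb (\<alpha>(Inl () := \<alpha> (Inl ()) - 1))) (real (\<alpha> (Inl ()))) * mmono (w0exp p)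
      = Poly_Mapping.single (\<lambda>v. tyemb (\<alpha>(Inl () := \<alpha> (Inl ()) - 1)) v + w0exp p v) (real (\<alpha> (Inl ())))"
      by (simp add: mult_single plus_fun_def)
    show "Poly_Mapping.lookup ?R \<gamma> = dyn_poly p f \<alpha> \<gamma>"
      unfolding m w lookup_add lookup_sum dyn_poly_def padd_def lookup_pmonom
        lookup_pmult[OF is_polyI[OF lookup_pmonom] is_poly_homog[OF f[rule_format]]] by (rule refl)
  qed
  then show "is_poly (dyn_poly p f \<alpha>)" "mpoly_of (dyn_poly p f \<alpha>) = ?R"
    by (rule is_polyI, rule mpoly_of_eqI)
qed

text \<open>The truncated exponents \<open>\<alpha> v - 1\<close> are harmless: where
  \<open>\<alpha> v = 0\<close>, so is the coefficient in front.\<close>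

lemma vmon_has_derivative:
  fixes \<alpha> :: "(unit + 'n::finite) expo"
  shows "((\<lambda>z. vmon \<alpha> (fst z) (snd z)) has_derivative
    (\<lambda>d. real (\<alpha> (Inl ())) * vmon (\<alpha>(Inl () := \<alpha> (Inl ()) - 1)) t y * fst d
       + (\<Sum>j\<in>UNIV. real (\<alpha> (Inr j)) * vmon (\<alpha>(Inr j := \<alpha> (Inr j) - 1)) t y * snd d $ j))) (at (t, y))"
proof -
  have sndc: "((\<lambda>z::real \<times> (real^'n). snd z $ j) has_derivative (\<lambda>d. snd d $ j)) (at (t, y))" for j
    by (intro bounded_linear_imp_has_derivative bounded_linear_compose[OF bounded_linear_vec_nth bounded_linear_snd, unfolded o_def])
  have p1: "((\<lambda>z::real \<times> (real^'n). fst z ^ n) has_derivative (\<lambda>d. real n * t ^ (n - 1) * fst d)) (at (t, y))" for n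
    using has_derivative_power[OF bounded_linear_imp_has_derivative[OF bounded_linear_fst], of n "(t, y)" UNIV] by (simp add: ac_simps)
  have p2: "((\<lambda>z::real \<times> (real^'n). (snd z $ j) ^ n) has_derivative (\<lambda>d. real n * (y $ j) ^ (n - 1) * snd d $ j)) (at (t, y))" for j n
    using has_derivative_power[OF sndc[of j], of n] by (simp add: ac_simps)
  have dv: "((\<lambda>z. fst z ^ \<alpha> (Inl ()) * (\<Prod>j\<in>UNIV. (snd z $ j) ^ \<alpha> (Inr j))) has_derivative
    (\<lambda>d. fst (t, y) ^ \<alpha> (Inl ()) * (\<Sum>j\<in>UNIV. (real (\<alpha> (Inr j)) * (y $ j) ^ (\<alpha> (Inr j) - 1) * snd d $ j) * (\<Prod>k\<in>UNIV - {j}. (snd (t, y) $ k) ^ \<alpha> (Inr k)))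
      + (real (\<alpha> (Inl ())) * t ^ (\<alpha> (Inl ()) - 1) * fst d) * (\<Prod>j\<in>UNIV. (snd (t, y) $ j) ^ \<alpha> (Inr j)))) (at (t, y))"
    by (intro has_derivative_mult has_derivative_prod p1 p2)
  have v1: "vmon (\<alpha>(Inr j := \<alpha> (Inr j) - 1)) t y
     = t ^ \<alpha> (Inl ()) * ((y $ j) ^ (\<alpha> (Inr j) - 1) * (\<Prod>k\<in>UNIV - {j}. (y $ k) ^ \<alpha> (Inr k)))" for j
  proof -
    have "(\<Prod>k\<in>UNIV. (y $ k) ^ (\<alpha>(Inr j := \<alpha> (Inr j) - 1)) (Inr k))
      = (y $ j) ^ (\<alpha> (Inr j) - 1) * (\<Prod>k\<in>UNIV - {j}. (y $ k) ^ (\<alpha>(Inr j := \<alpha> (Inr j) - 1)) (Inr k))"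
      by (subst prod.remove[of UNIV j]) auto
    also have "(\<Prod>k\<in>UNIV - {j}. (y $ k) ^ (\<alpha>(Inr j := \<alpha> (Inr j) - 1)) (Inr k)) = (\<Prod>k\<in>UNIV - {j}. (y $ k) ^ \<alpha> (Inr k))"
      by (rule prod.cong) auto
    finally show ?thesis by (simp add: vmon_def)
  qed
  have v2: "vmon (\<alpha>(Inl () := \<alpha> (Inl ()) - 1)) t y = t ^ (\<alpha> (Inl ()) - 1) * (\<Prod>j\<in>UNIV. (y $ j) ^ \<alpha> (Inr j))"
    by (simp add: vmon_def)
  show ?thesis
    unfolding v1 v2 unfolding vmon_def using dv by (simp add: sum_distrib_left ac_simps)
qed

lemma real_polynomial_function_vmon:
  "real_polynomial_function (\<lambda>z :: real \<times> (real^'n::finite). vmon \<alpha> (fst z) (snd z))"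
proof -
  have "real_polynomial_function (\<lambda>z :: real \<times> (real^'n). snd z $ j)" for j
    by (intro real_polynomial_function.intros(1) bounded_linear_compose[OF bounded_linear_vec_nth bounded_linear_snd, unfolded o_def])
  moreover have "real_polynomial_function (\<lambda>z :: real \<times> (real^'n). fst z)"
    by (intro real_polynomial_function.intros(1) bounded_linear_fst)
  ultimately show ?thesis
    unfolding vmon_def
    by (intro real_polynomial_function.intros(4) real_polynomial_function_power real_polynomial_function_prod) auto
qed

lemma real_polynomial_function_span_vmon:
  fixes q :: "real \<times> (real^'n::finite) \<Rightarrow> real"
  assumes "real_polynomial_function q"
  shows "\<exists>A c. finite A \<and> (\<forall>z. q z = (\<Sum>\<alpha>\<in>A. c \<alpha> * vmon \<alpha> (fst z) (snd z)))"
proof -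
  \<comment> \<open>The pair of time and state is relabelled as one vector indexed by
    \<open>unit + 'n\<close>; monomials in it are exactly the functions \<open>vmon\<close>.\<close>
  define J :: "real \<times> (real^'n) \<Rightarrow> real^(unit + 'n)" where "J z = (\<chi> v. case v of Inl _ \<Rightarrow> fst z | Inr j \<Rightarrow> snd z $ j)" for z
  have "\<exists>p. \<forall>z. q z = meval (J z) p"
    using assms
  proof (induction rule: real_polynomial_function.induct)
    case (linear h)
    have lin: "linear h" using linear by (rule bounded_linear.linear)
    have "h z = meval (J z) (mconst (h (1, 0)) * mvar (Inl ()) + (\<Sum>j\<in>UNIV. mconst (h (0, axis j 1)) * mvar (Inr j)))" for z
    proof -
      have "(\<Sum>j\<in>UNIV. snd z $ j *\<^sub>R (0 :: real, axis j (1 :: real))) = (0, \<Sum>j\<in>UNIV. snd z $ j *\<^sub>R axis j 1)"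
        by (simp add: prod_eq_iff fst_sum snd_sum)
      then have "z = fst z *\<^sub>R (1, 0) + (\<Sum>j\<in>UNIV. snd z $ j *\<^sub>R (0, axis j 1))"
        by (simp add: prod_eq_iff basis_expansion[of "snd z", unfolded scalar_mult_eq_scaleR])
      then have "h z = h (fst z *\<^sub>R (1, 0) + (\<Sum>j\<in>UNIV. snd z $ j *\<^sub>R (0, axis j 1)))" by (rule arg_cong)
      then show ?thesis
        by (simp only: linear_add[OF lin] linear_scale[OF lin] linear_sum[OF lin]) (simp add: J_def mult.commute)
    qed
    then show ?case by blast
  next
    case (const c)
    show ?case by (rule exI[of _ "mconst c"]) simp
  next
    case (add f g)
    then show ?case by (metis meval_add)
  next
    case (mult f g)
    then show ?case by (metis meval_mult)
  qed
  then obtain p where p: "\<And>z. q z = meval (J z) p" by blast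
  show ?thesis
    by (rule exI[of _ "Poly_Mapping.keys p"], rule exI[of _ "Poly_Mapping.lookup p"])
      (simp add: p meval_def J_def vmon_eq_prod)
qed

lemma meval_dyn_poly:
  fixes f :: "'n::finite \<Rightarrow> (('n,'m::finite) ovar) rpoly" and x :: "real^(('n,'m) var)"
  assumes f: "\<forall>j. is_poly (f j)"
  shows "meval x (mpoly_of (dyn_poly p f \<alpha>))
    = frechet_derivative (\<lambda>z. vmon \<alpha> (fst z) (snd z)) (at (tc x, yc x)) (w0c x ^ p, \<chi> j. peval (homog p (f j)) x)"
  unfolding frechet_derivative_eqI[OF vmon_has_derivative] dyn_poly_mpoly(2)[OF f] meval_add meval_sum meval_mult meval_tyemb meval_w0exp
  by (simp add: peval_eq_meval is_poly_homog f)

lemma continuous_on_var_projections: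
  "continuous_on UNIV (tc :: real^(('n::finite,'m::finite) var) \<Rightarrow> real)"
  "continuous_on UNIV (yc :: real^(('n,'m) var) \<Rightarrow> real^'n)"
  "continuous_on UNIV (w0c :: real^(('n,'m) var) \<Rightarrow> real)"
  unfolding tc_def[abs_def] yc_def[abs_def] w0c_def[abs_def] by (intro continuous_intros)+

text \<open>By linearity the identity extends from monomials to polynomials. Both sides are
  continuous under uniform convergence of values and derivatives on a bounded set, so
  \<open>C1_polynomial_approximation\<close> carries it to all test functions.\<close>

lemma C1_identity_of_monomial_identities:
  fixes f :: "'n::finite \<Rightarrow> (('n,'m::finite) ovar) rpoly" and \<gamma> :: "(real^(('n,'m) var)) measure"
  assumes f: "\<forall>j. is_poly (f j)"
    and \<gamma>: "finite_measure \<gamma>" "sets \<gamma> = sets borel" "AE x in \<gamma>. x \<in> K" "compact K"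
    and mono: "\<And>\<alpha>. (\<integral>x. meval x (mpoly_of (dyn_poly p f \<alpha>)) \<partial>\<gamma>) = bval t0 tf y0 yf \<alpha>"
    and v: "is_C1 (v :: real \<times> (real^'n) \<Rightarrow> real)"
  shows "(\<integral>x. frechet_derivative v (at (tc x, yc x)) (w0c x ^ p, \<chi> j. peval (homog p (f j)) x) \<partial>\<gamma>)
    = v (tf, yf) - v (t0, y0)"
proof -
  interpret finite_measure \<gamma> by (rule \<gamma>)
  define F :: "real^(('n,'m) var) \<Rightarrow> real \<times> (real^'n)"
    where "F x = (w0c x ^ p, \<chi> j. meval x (mpoly_of (homog p (f j))))" for x
  have F_eq: "(w0c x ^ p, \<chi> j. peval (homog p (f j)) x) = F x" for x
    by (simp add: F_def peval_eq_meval is_poly_homog f)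
  have F: "continuous_on UNIV F"
    unfolding F_def by (intro continuous_intros continuous_on_var_projections)
  define Z where "Z x = (tc x, yc x)" for x :: "real^(('n,'m) var)"
  have Z: "continuous_on UNIV Z"
    unfolding Z_def by (intro continuous_intros continuous_on_var_projections)
  define I where "I v x = frechet_derivative v (at (Z x)) (F x)" for v :: "real \<times> (real^'n) \<Rightarrow> real" and x
  have I_sum: "I v x = (\<Sum>b\<in>Basis. (F x \<bullet> b) * frechet_derivative v (at (Z x)) b)" if "is_C1 v" for v x
  proof -
    have lin: "linear (frechet_derivative v (at (Z x)))"
      using has_derivative_bounded_linear[OF is_C1_has_derivative[OF that]] bounded_linear.linear by blast
    have "I v x = frechet_derivative v (at (Z x)) (\<Sum>b\<in>Basis. (F x \<bullet> b) *\<^sub>R b)"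
      by (simp add: I_def euclidean_representation)
    then show ?thesis by (simp add: linear_sum[OF lin] linear_scale[OF lin])
  qed
  have I_cont: "continuous_on UNIV (I v)" if "is_C1 v" for v
  proof -
    have "continuous_on UNIV (\<lambda>x. frechet_derivative v (at (Z x)) b)" for b
      by (rule continuous_on_compose2[OF is_C1_continuous_on_derivative[OF that] Z]) auto
    then show ?thesis
      unfolding I_sum[OF that, abs_def] by (intro continuous_intros F)
  qed
  note int = integrable_continuous_AE_compact[OF \<gamma>]
  have C1_vmon: "is_C1 (\<lambda>z. vmon \<alpha> (fst z) (snd z) :: real)" for \<alpha> :: "(unit + 'n) expo"
    by (rule is_C1_real_polynomial_function[OF real_polynomial_function_vmon])
  define \<Delta> where "\<Delta> v = v (tf, yf) - v (t0, y0)" for v :: "real \<times> (real^'n) \<Rightarrow> real"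
  have vmon: "(\<integral>x. I (\<lambda>z. vmon \<alpha> (fst z) (snd z)) x \<partial>\<gamma>) = \<Delta> (\<lambda>z. vmon \<alpha> (fst z) (snd z))" for \<alpha>
    using mono[of \<alpha>] by (simp add: meval_dyn_poly[OF f] I_def F_eq Z_def bval_def \<Delta>_def)
  have poly: "(\<integral>x. I q x \<partial>\<gamma>) = \<Delta> q" if q: "real_polynomial_function q" for q
  proof -
    obtain A c where A: "finite A" and qA: "\<And>z. q z = (\<Sum>\<alpha>\<in>A. c \<alpha> * vmon \<alpha> (fst z) (snd z))"
      using real_polynomial_function_span_vmon[OF q] by blast
    have dq: "(q has_derivative (\<lambda>d. \<Sum>\<alpha>\<in>A. c \<alpha> * frechet_derivative (\<lambda>z. vmon \<alpha> (fst z) (snd z)) (at z) d)) (at z)" for z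
      unfolding qA[abs_def]
      by (intro has_derivative_sum has_derivative_mult_right is_C1_has_derivative C1_vmon)
    have Iq: "I q x = (\<Sum>\<alpha>\<in>A. c \<alpha> * I (\<lambda>z. vmon \<alpha> (fst z) (snd z)) x)" for x
      unfolding I_def frechet_derivative_eqI[OF dq] by (rule refl)
    have "(\<integral>x. I q x \<partial>\<gamma>) = (\<Sum>\<alpha>\<in>A. c \<alpha> * (\<integral>x. I (\<lambda>z. vmon \<alpha> (fst z) (snd z)) x \<partial>\<gamma>))"
      unfolding Iq by (subst Bochner_Integration.integral_sum) (auto intro!: int I_cont C1_vmon)
    then show ?thesis
      by (simp add: vmon \<Delta>_def qA sum_subtractf right_diff_distrib)
  qed
  \<comment> \<open>The two boundary points are added because they need not lie in the projection of
    \<open>K\<close>.\<close>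
  define S where "S = Z ` K \<union> {(tf, yf), (t0, y0)}"
  have "bounded S"
    unfolding S_def using compact_imp_bounded[OF compact_continuous_image[OF continuous_on_subset[OF Z subset_UNIV] \<gamma>(4)]]
    by simp
  then have approx: "C1_approx S v" by (rule C1_polynomial_approximation[OF v])
  \<comment> \<open>The integral of the \<open>l^1\<close> norm of the velocity \<open>F\<close>: an
    error \<open>e\<close> in the partial derivatives costs at most \<open>e * N\<close>, and the
    two boundary values cost \<open>2 * e\<close> more.\<close>
  define N where "N = (\<integral>x. (\<Sum>b\<in>Basis. \<bar>F x \<bullet> b\<bar>) \<partial>\<gamma>)"
  have N_int: "integrable \<gamma> (\<lambda>x. \<Sum>b\<in>Basis. \<bar>F x \<bullet> b\<bar>)" by (intro int continuous_intros F)
  have N0: "N \<ge> 0" unfolding N_def by (intro Bochner_Integration.integral_nonneg sum_nonneg) auto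
  have bound: "\<bar>(\<integral>x. I v x \<partial>\<gamma>) - \<Delta> v\<bar> \<le> e * (N + 2)" if e: "e > 0" for e
  proof -
    obtain q where q: "real_polynomial_function q" and close: "C1_close S e v q"
      using approx e unfolding C1_approx_def by blast
    have q1: "is_C1 q" by (rule is_C1_real_polynomial_function[OF q])
    have "norm (\<integral>x. I v x - I q x \<partial>\<gamma>) \<le> (\<integral>x. norm (I v x - I q x) \<partial>\<gamma>)"
      by (rule integral_norm_bound)
    also have "\<dots> \<le> (\<integral>x. e * (\<Sum>b\<in>Basis. \<bar>F x \<bullet> b\<bar>) \<partial>\<gamma>)"
    proof (rule integral_mono_AE)
      show "integrable \<gamma> (\<lambda>x. norm (I v x - I q x))" by (intro int continuous_intros I_cont v q1)
      show "integrable \<gamma> (\<lambda>x. e * (\<Sum>b\<in>Basis. \<bar>F x \<bullet> b\<bar>))" using N_int by simp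
      show "AE x in \<gamma>. norm (I v x - I q x) \<le> e * (\<Sum>b\<in>Basis. \<bar>F x \<bullet> b\<bar>)"
        using \<gamma>(3)
      proof (rule AE_mp, intro AE_I2 impI)
        fix x assume "x \<in> K"
        then have d: "\<bar>frechet_derivative v (at (Z x)) b - frechet_derivative q (at (Z x)) b\<bar> \<le> e" if "b \<in> Basis" for b
          using close that unfolding C1_close_def S_def by blast
        have "I v x - I q x = (\<Sum>b\<in>Basis. (F x \<bullet> b) * (frechet_derivative v (at (Z x)) b - frechet_derivative q (at (Z x)) b))"
          by (simp only: I_sum[OF v] I_sum[OF q1] sum_subtractf right_diff_distrib)
        also have "norm \<dots> \<le> (\<Sum>b\<in>Basis. \<bar>F x \<bullet> b\<bar> * e)"
          by (rule sum_norm_le) (use d in \<open>auto simp: abs_mult intro!: mult_left_mono\<close>)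
        finally show "norm (I v x - I q x) \<le> e * (\<Sum>b\<in>Basis. \<bar>F x \<bullet> b\<bar>)"
          by (simp add: sum_distrib_left mult.commute)
      qed
    qed
    also have "\<dots> = e * N" by (simp add: N_def)
    also have "(\<integral>x. I v x - I q x \<partial>\<gamma>) = (\<integral>x. I v x \<partial>\<gamma>) - \<Delta> q"
      unfolding poly[OF q, symmetric] by (intro Bochner_Integration.integral_diff int I_cont v q1)
    finally have "\<bar>(\<integral>x. I v x \<partial>\<gamma>) - \<Delta> q\<bar> \<le> e * N" by simp
    moreover have "\<bar>v (tf, yf) - q (tf, yf)\<bar> \<le> e" "\<bar>v (t0, y0) - q (t0, y0)\<bar> \<le> e"
      using close unfolding C1_close_def S_def by blast+
    ultimately show ?thesis unfolding \<Delta>_def distrib_left by linarith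
  qed
  have "\<bar>(\<integral>x. I v x \<partial>\<gamma>) - \<Delta> v\<bar> \<le> 0"
  proof (rule field_le_epsilon)
    fix e :: real assume "e > 0"
    then show "\<bar>(\<integral>x. I v x \<partial>\<gamma>) - \<Delta> v\<bar> \<le> 0 + e"
      using bound[of "e / (N + 2)"] N0 by simp
  qed
  then show ?thesis by (simp add: F_eq I_def Z_def \<Delta>_def)
qed

section \<open>Comparison of the values of the relaxations\<close>

lemma pd_antimono:
  assumes d: "d \<le> d'" and l: "deg_le (homog p l) (2 * d)"
  shows "pd d t0 tf y0 yf p l f nG g \<le> pd d' t0 tf y0 yf p l f nG g"
proof -
  have l': "deg_le (homog p l) (2 * d')" using l d by (auto intro: deg_le_mono)
  \<comment> \<open>The sequence \<open>z\<close> is total at every order, so one and the same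
    \<open>z\<close> serves both problems and only inclusion of the feasible sets remains.\<close>
  show ?thesis
    unfolding pd_def sum_mdeg_eq_lz[OF l] sum_mdeg_eq_lz[OF l']
    by (rule Inf_superset_mono) (use d in \<open>auto 4 4 intro: deg_le_mono loc_psd_mono mult_le_mono2\<close>)
qed

lemma pd_le_pinf:
  assumes l: "deg_le (homog p l) (2 * d)"
  shows "pd d t0 tf y0 yf p l f nG g \<le> pinf t0 tf y0 yf p l f nG g"
  unfolding pd_def pinf_def sum_mdeg_eq_lz[OF l] by (rule Inf_superset_mono) auto

lemma ball_poly_nonneg_imp_cube:
  fixes x :: "real^'v::finite"
  assumes "0 \<le> peval (ball_poly r) x"
  shows "\<forall>i. x $ i \<in> {- (\<bar>r\<bar> + 1)..\<bar>r\<bar> + 1}"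
proof
  fix i
  have "peval (ball_poly r) x = r - (\<Sum>i\<in>UNIV. (x $ i)\<^sup>2)"
    unfolding peval_eq_meval[OF is_polyI[OF lookup_ball_poly]] mpoly_of_eqI[OF lookup_ball_poly] by simp
  moreover have "(x $ i)\<^sup>2 \<le> (\<Sum>i\<in>UNIV. (x $ i)\<^sup>2)" by (rule member_le_sum) auto
  ultimately have "(x $ i)\<^sup>2 \<le> r" using assms by linarith
  \<comment> \<open>The summand 1 covers radii below 1, for which \<open>r\<close> may exceed its
    own square.\<close>
  also have "r \<le> (\<bar>r\<bar> + 1)\<^sup>2"
    using self_le_power[of "\<bar>r\<bar> + 1" 2] by auto
  finally have "\<bar>x $ i\<bar> \<le> \<bar>r\<bar> + 1" by (rule abs_le_square_iff[THEN iffD2, of "x $ i" "\<bar>r\<bar> + 1", simplified])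
  then show "x $ i \<in> {- (\<bar>r\<bar> + 1)..\<bar>r\<bar> + 1}" by auto
qed

text \<open>Since \<open>emeasure\<close> is 0 on non-measurable sets by convention, the null
  condition in \<open>pos_measures\<close> has its intended meaning only for measurable complements;
  closedness of \<open>G\<close> provides this.\<close>

lemma pos_measures_iff_AE:
  assumes "closed G"
  shows "\<gamma> \<in> pos_measures G \<longleftrightarrow> sets \<gamma> = sets borel \<and> finite_measure \<gamma> \<and> (AE x in \<gamma>. x \<in> G)"
proof (cases "sets \<gamma> = sets borel")
  case True
  have "UNIV - G \<in> sets \<gamma>" unfolding True using borel_closed[OF assms] by auto
  moreover have "{x \<in> space \<gamma>. \<not> x \<in> G} = UNIV - G" using sets_eq_imp_space_eq[OF True] by auto
  ultimately show ?thesis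
    unfolding pos_measures_def using AE_iff_measurable[of "UNIV - G" \<gamma> "\<lambda>x. x \<in> G"] by auto
qed (simp add: pos_measures_def)

lemma moments_of_measure:
  fixes \<gamma> :: "(real^'v::finite) measure"
  assumes \<gamma>: "finite_measure \<gamma>" "sets \<gamma> = sets borel" "AE x in \<gamma>. x \<in> K" "compact K"
  shows "moment_functional (\<lambda>\<beta>. \<integral>x. monom_eval \<beta> x \<partial>\<gamma>) q = (\<integral>x. meval x q \<partial>\<gamma>)"
proof -
  have "integrable \<gamma> (\<lambda>x. c * (\<Prod>i\<in>UNIV. (x $ i) ^ \<alpha> i))" for c \<alpha>
    by (intro integrable_continuous_AE_compact[OF \<gamma>] continuous_intros)
  then show ?thesis
    unfolding moment_functional_def meval_def monom_eval_def
    by (subst Bochner_Integration.integral_sum) auto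
qed

text \<open>For the equality, \<open>to_measure\<close> and \<open>to_moments\<close> turn feasible
  points of either problem into feasible points of the other with the same cost. The two infima thus
  agree even if both problems are infeasible.\<close>

theorem theorem4p2:
  fixes t0 tf :: real and p :: nat
    and y0 yf :: "real^'n::finite"
    and l :: "(('n,'m::finite) ovar) rpoly"
    and f :: "'n \<Rightarrow> (('n,'m) ovar) rpoly"
    and nY :: nat and gY :: "nat \<Rightarrow> 'n rpoly"
    and nG :: nat and g :: "nat \<Rightarrow> (('n,'m) var) rpoly"
  assumes "0 \<le> t0" and "t0 < tf" and "even p"
    and "is_poly l" and "\<forall>\<beta>. l \<beta> \<noteq> 0 \<longrightarrow> udeg \<beta> \<le> p"
    and "\<forall>j. is_poly (f j)" and "\<forall>j \<beta>. f j \<beta> \<noteq> 0 \<longrightarrow> udeg \<beta> \<le> p"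
    and "\<forall>i<nY. is_poly (gY i)"
    and "compact (semialg nY gY)"
    and "\<exists>i<nY. \<exists>r. gY i = ball_poly r"
    and "\<forall>i\<le>nG. is_poly (g i)"
    and "g 0 = pconst 1"
    and "{x. \<forall>i\<le>nG. peval (g i) x \<ge> 0} = Gset t0 tf (semialg nY gY) p"
    and "\<exists>i\<le>nG. \<exists>r. g i = ball_poly r"
  shows "(\<forall>d\<ge>dzero p l f nG g. pd d t0 tf y0 yf p l f nG g \<le> pd (Suc d) t0 tf y0 yf p l f nG g)
       \<and> (\<forall>d\<ge>dzero p l f nG g. pd d t0 tf y0 yf p l f nG g \<le> pinf t0 tf y0 yf p l f nG g)
       \<and> pinf t0 tf y0 yf p l f nG g = pF t0 tf y0 yf p l f (semialg nY gY)"
proof -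
  let ?G = "Gset t0 tf (semialg nY gY) p :: (real^(('n,'m) var)) set"
  note l = \<open>is_poly l\<close> and f = \<open>\<forall>j. is_poly (f j)\<close> and g = \<open>\<forall>i\<le>nG. is_poly (g i)\<close>
    and G = \<open>{x. \<forall>i\<le>nG. peval (g i) x \<ge> 0} = ?G\<close>
  have deg: "deg_le (homog p l) (2 * d)" if "dzero p l f nG g \<le> d" for d
    by (rule deg_le_dzero[OF l f g that])
  obtain i0 r where i0: "i0 \<le> nG" "g i0 = ball_poly r"
    using \<open>\<exists>i\<le>nG. \<exists>r. g i = ball_poly r\<close> by blast
  \<comment> \<open>A compact box around \<open>G\<close>, on which continuous integrands are
    integrable and test functions are approximated.\<close>
  define K :: "(real^(('n,'m) var)) set" where "K = {x. \<forall>i. x $ i \<in> {- (\<bar>r\<bar> + 1)..\<bar>r\<bar> + 1}}"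
  have K: "compact K" unfolding K_def by (rule compact_cube)
  have GK: "?G \<subseteq> K"
    unfolding G[symmetric] K_def using i0 ball_poly_nonneg_imp_cube by force
  have ev: "peval (g i) x = meval x (mpoly_of (g i))" if "i \<le> nG" for i x
    using g that by (simp add: peval_eq_meval)
  have "closed ?G"
  proof -
    have "?G = (\<Inter>i\<in>{..nG}. {x. 0 \<le> meval x (mpoly_of (g i))})" unfolding G[symmetric] using ev by auto
    then show ?thesis by (auto intro!: closed_INT closed_Collect_le continuous_intros)
  qed
  note pos_iff = pos_measures_iff_AE[OF this]
  have ev_l: "peval (homog p l) = (\<lambda>x. meval x (mpoly_of (homog p l)))"
    using peval_eq_meval[OF is_poly_homog[OF l]] by blast
  have val: "lz z (homog p l) = (\<integral>x. peval (homog p l) x \<partial>\<gamma>)"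
    if "\<And>q. moment_functional z q = (\<integral>x. meval x q \<partial>\<gamma>)" for z \<gamma>
    by (simp add: ev_l lz_eq_moment_functional is_poly_homog l that)
  have to_measure: "\<exists>\<gamma>. lz z (homog p l) = (\<integral>x. peval (homog p l) x \<partial>\<gamma>) \<and> \<gamma> \<in> pos_measures ?G \<and>
      (\<forall>v :: real \<times> (real^'n) \<Rightarrow> real. is_C1 v \<longrightarrow>
         (\<integral>x. frechet_derivative v (at (tc x, yc x)) (w0c x ^ p, \<chi> j. peval (homog p (f j)) x) \<partial>\<gamma>)
           = v (tf, yf) - v (t0, y0))"
    if dyn: "\<forall>\<alpha>. lz z (dyn_poly p f \<alpha>) = bval t0 tf y0 yf \<alpha>" and psd: "\<forall>i\<le>nG. \<forall>d. loc_psd d (g i) z" for z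
  proof -
    have nn: "moment_functional.square_nonneg z (mpoly_of (g i))" if "i \<le> nG" for i
      using loc_psd_iff_square_nonneg g psd that by blast
    have nn1: "moment_functional.square_nonneg z 1"
      using nn[of 0] \<open>g 0 = pconst 1\<close> by (simp add: mpoly_of_eqI[OF lookup_pconst] mconst_1)
    have nnb: "moment_functional.square_nonneg z (mconst r - (\<Sum>i\<in>UNIV. (mvar i)\<^sup>2))"
      using nn[OF i0(1)] by (simp only: i0(2) mpoly_of_eqI[OF lookup_ball_poly])
    \<comment> \<open>The representing measure first lives on some box with its own
      \<open>R\<close>; the remaining constraints then confine it to \<open>G\<close>, hence to
      \<open>K\<close>.\<close>
    obtain \<gamma> R where \<gamma>: "finite_measure \<gamma>" "sets \<gamma> = sets borel" "AE x in \<gamma>. \<forall>i. x $ i \<in> {- R..R}"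
      and rep: "\<And>q. moment_functional z q = (\<integral>x. meval x q \<partial>\<gamma>)"
      using moment_functional.archimedean_moment_measure[OF nn1 nnb] by blast
    have "AE x in \<gamma>. \<forall>i\<in>{..nG}. 0 \<le> meval x (mpoly_of (g i))"
      by (rule AE_ball_countable') (auto intro: moment_functional.square_nonneg_imp_AE_nonneg[OF \<gamma> rep nn])
    then have AEG: "AE x in \<gamma>. x \<in> ?G"
      unfolding G[symmetric] by (rule AE_mp) (auto intro!: AE_I2 simp: ev)
    then have AEK: "AE x in \<gamma>. x \<in> K" by (rule AE_mp) (use GK in \<open>auto intro!: AE_I2\<close>)
    have "(\<integral>x. meval x (mpoly_of (dyn_poly p f \<alpha>)) \<partial>\<gamma>) = bval t0 tf y0 yf \<alpha>" for \<alpha>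
      using dyn by (simp add: rep[symmetric] lz_eq_moment_functional dyn_poly_mpoly(1)[OF f])
    note C1_identity_of_monomial_identities[OF f \<gamma>(1,2) AEK K this]
    then show ?thesis using val[OF rep] \<gamma> AEG unfolding pos_iff by blast
  qed
  have to_moments: "\<exists>z. lz z (homog p l) = (\<integral>x. peval (homog p l) x \<partial>\<gamma>) \<and>
      (\<forall>\<alpha>. lz z (dyn_poly p f \<alpha>) = bval t0 tf y0 yf \<alpha>) \<and> (\<forall>i\<le>nG. \<forall>d. loc_psd d (g i) z)"
    if \<gamma>_pos: "\<gamma> \<in> pos_measures ?G" and C1: "\<forall>v :: real \<times> (real^'n) \<Rightarrow> real. is_C1 v \<longrightarrow>
         (\<integral>x. frechet_derivative v (at (tc x, yc x)) (w0c x ^ p, \<chi> j. peval (homog p (f j)) x) \<partial>\<gamma>)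
           = v (tf, yf) - v (t0, y0)" for \<gamma>
  proof -
    have \<gamma>: "finite_measure \<gamma>" "sets \<gamma> = sets borel" and AEG: "AE x in \<gamma>. x \<in> ?G"
      using \<gamma>_pos unfolding pos_iff by auto
    have AEK: "AE x in \<gamma>. x \<in> K" using AEG by (rule AE_mp) (use GK in \<open>auto intro!: AE_I2\<close>)
    \<comment> \<open>The moments of the measure; \<open>moments_of_measure\<close> makes the
      functional of \<open>z\<close> integration against it.\<close>
    define z where "z \<beta> = (\<integral>x. monom_eval \<beta> x \<partial>\<gamma>)" for \<beta>
    have rep: "moment_functional z q = (\<integral>x. meval x q \<partial>\<gamma>)" for q
      unfolding z_def by (rule moments_of_measure[OF \<gamma> AEK K])
    have "lz z (dyn_poly p f \<alpha>) = bval t0 tf y0 yf \<alpha>" for \<alpha>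
      using C1[rule_format, OF is_C1_real_polynomial_function[OF real_polynomial_function_vmon[of \<alpha>]]]
      by (simp add: lz_eq_moment_functional dyn_poly_mpoly(1)[OF f] rep meval_dyn_poly[OF f] bval_def)
    moreover have "moment_functional.square_nonneg z (mpoly_of (g i))" if "i \<le> nG" for i
      unfolding moment_functional.square_nonneg_def rep
    proof (intro allI Bochner_Integration.integral_nonneg_AE)
      fix q
      show "AE x in \<gamma>. 0 \<le> meval x (mpoly_of (g i) * q\<^sup>2)"
        using AEG by (rule AE_mp) (use that in \<open>auto intro!: AE_I2 mult_nonneg_nonneg simp: G[symmetric] ev\<close>)
    qed
    ultimately show ?thesis
      using val[OF rep] loc_psd_iff_square_nonneg g by blast
  qed
  have "pinf t0 tf y0 yf p l f nG g = pF t0 tf y0 yf p l f (semialg nY gY)"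
  proof (rule antisym)
    show "pinf t0 tf y0 yf p l f nG g \<le> pF t0 tf y0 yf p l f (semialg nY gY)"
      unfolding pF_def
    proof (rule Inf_greatest, elim CollectE exE conjE)
      fix e \<gamma> assume e: "e = ereal (\<integral>x. peval (homog p l) x \<partial>\<gamma>)" and feas: "\<gamma> \<in> pos_measures ?G"
        "\<forall>v :: real \<times> (real^'n) \<Rightarrow> real. is_C1 v \<longrightarrow>
         (\<integral>x. frechet_derivative v (at (tc x, yc x)) (w0c x ^ p, \<chi> j. peval (homog p (f j)) x) \<partial>\<gamma>)
           = v (tf, yf) - v (t0, y0)"
      obtain z where "lz z (homog p l) = (\<integral>x. peval (homog p l) x \<partial>\<gamma>)"
        "\<forall>\<alpha>. lz z (dyn_poly p f \<alpha>) = bval t0 tf y0 yf \<alpha>" "\<forall>i\<le>nG. \<forall>d. loc_psd d (g i) z"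
        using to_moments[OF feas] by (elim exE conjE)
      then show "pinf t0 tf y0 yf p l f nG g \<le> e"
        unfolding pinf_def e by (intro Inf_lower CollectI exI[of _ z]) simp
    qed
    show "pF t0 tf y0 yf p l f (semialg nY gY) \<le> pinf t0 tf y0 yf p l f nG g"
      unfolding pinf_def
    proof (rule Inf_greatest, elim CollectE exE conjE)
      fix e z assume e: "e = ereal (lz z (homog p l))" and feas: "\<forall>\<alpha>. lz z (dyn_poly p f \<alpha>) = bval t0 tf y0 yf \<alpha>"
        "\<forall>i\<le>nG. \<forall>d. loc_psd d (g i) z"
      obtain \<gamma> where \<gamma>: "lz z (homog p l) = (\<integral>x. peval (homog p l) x \<partial>\<gamma>)" "\<gamma> \<in> pos_measures ?G"
        "\<forall>v :: real \<times> (real^'n) \<Rightarrow> real. is_C1 v \<longrightarrow>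
         (\<integral>x. frechet_derivative v (at (tc x, yc x)) (w0c x ^ p, \<chi> j. peval (homog p (f j)) x) \<partial>\<gamma>)
           = v (tf, yf) - v (t0, y0)"
        using to_measure[OF feas] by (elim exE conjE)
      show "pF t0 tf y0 yf p l f (semialg nY gY) \<le> e"
        unfolding pF_def e \<gamma>(1) by (rule Inf_lower, rule CollectI, rule exI[of _ \<gamma>]) (intro conjI refl \<gamma>(2,3))
    qed
  qed
  then show ?thesis
    using pd_antimono[OF le_SucI[OF order_refl] deg] pd_le_pinf[OF deg] by blast
qed

end
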